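(* Let $\mathbf{x}_1,\mathbf{x}_2,\ldots$ be i.i.d. from the normal mixture $\alpha_1\mathcal{N}_p(\boldsymbol{\mu}_1,\boldsymbol{\Sigma})+\alpha_2\mathcal{N}_p(\boldsymbol{\mu}_2,\boldsymbol{\Sigma})$, where $0<\alpha_1<1$, $\alpha_2=1-\alpha_1$, $\boldsymbol{\mu}_1\neq\boldsymbol{\mu}_2\in\mathbb{R}^p$ and $\boldsymbol{\Sigma}\in\mathbb{R}^{p\times p}$ is a full-rank covariance matrix. Assume that $\alpha_1\notin\{1/2-1/\sqrt{12},\,1/2+1/\sqrt{12}\}$, and let $\mathbf{u}_n$ be any sequence of maximizers over $\mathbb{S}^{p-1}$ of $\mathbf{u}\mapsto\{\kappa_n(\mathbf{u})-3\}^2$, where $\kappa_n$ is the sample kurtosis of the projection of $\mathbf{x}_1,\ldots,\mathbf{x}_n$ onto $\mathbf{u}$. Let $\boldsymbol{\theta}=\boldsymbol{\Sigma}^{-1}(\boldsymbol{\mu}_2-\boldsymbol{\mu}_1)$, $\beta=\alpha_1\alpha_2$ and $\tau=(\boldsymbol{\mu}_2-\boldsymbol{\mu}_1)'\boldsymbol{\Sigma}^{-1}(\boldsymbol{\mu}_2-\boldsymbol{\mu}_1)$. Then there exists a sequence of (random) signs $s_n\in\{-1,1\}$ such that, as $n\to\infty$, 1) $s_n\mathbf{u}_n\to\boldsymbol{\theta}/\|\boldsymbol{\theta}\|$ almost surely; 2) $\sqrt{n}(s_n\mathbf{u}_n-\boldsymbol{\theta}/\|\boldsymbol{\theta}\|)\xrightarrow{d}\mathcal{N}_p(\mathbf{0},\boldsymbol{\Psi}_\kappa)$,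 where $$\boldsymbol{\Psi}_\kappa:=C_\kappa\left(\frac{1+\beta\tau}{\|\boldsymbol{\theta}\|^2\beta}\right)\left(\mathbf{I}_p-\frac{\boldsymbol{\theta}\boldsymbol{\theta}'}{\|\boldsymbol{\theta}\|^2}\right)\boldsymbol{\Sigma}^{-1}\left(\mathbf{I}_p-\frac{\boldsymbol{\theta}\boldsymbol{\theta}'}{\|\boldsymbol{\theta}\|^2}\right)$$ and $$C_\kappa:=\frac{6+24\beta\tau+9\beta(1-2\beta)\tau^2+\beta(1-3\beta)\tau^3}{\beta\tau^3(1-6\beta)^2}.$$
   Context: A prime denotes transpose, $\|\cdot\|$ is the Euclidean norm, $\mathbb{S}^{p-1}$ is the unit sphere of $\mathbb{R}^p$, and $\xrightarrow{d}$ is convergence in distribution. Sample kurtosis: with $\bar{\mathbf{x}}=(1/n)\sum_{i=1}^n\mathbf{x}_i$ and $\tilde{\mathbf{x}}_i:=\mathbf{x}_i-\bar{\mathbf{x}}$, $$\kappa_n:\mathbb{S}^{p-1}\to\mathbb{R},\qquad \kappa_n(\mathbf{u})=\frac{(1/n)\sum_{i=1}^n(\mathbf{u}'\tilde{\mathbf{x}}_i)^4}{\{(1/n)\sum_{i=1}^n(\mathbf{u}'\tilde{\mathbf{x}}_i)^2\}^2}.$$ For $n$ large enough the denominator is almost surely positive for all $\mathbf{u}\in\mathbb{S}^{p-1}$, so that $\kappa_n$ is well-defined and continuous and maximizers exist. Each $\mathbf{u}_n$ is a random unit vector and the signs $s_n$ may depend on the sample. *)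

theory Defs
  imports "HOL-Probability.Probability"
begin

definition covariance_matrix :: "real^'p^'p \<Rightarrow> bool" where
  "covariance_matrix S \<longleftrightarrow> transpose S = S \<and> (\<forall>v. 0 \<le> v \<bullet> (S *v v))"

definition std_mvnormal :: "(real^'p) measure" where
  "std_mvnormal =
     distr (\<Pi>\<^sub>M i\<in>UNIV. density lborel std_normal_density) borel (\<lambda>z. \<chi> i. z i)"

text \<open>
  The law of \<open>\<mu> + A Z\<close>, where \<open>A A' = S\<close> and \<open>Z\<close> has independent standard normal
  coordinates. For a covariance matrix \<open>S\<close> such an \<open>A\<close> exists (see
  \<open>covariance_matrix_factorization\<close>), and the law does not depend on
  which one is taken. The matrix \<open>S\<close> may be singular, in which case there is no density.
\<close>

definition mvnormal :: "real^'p \<Rightarrow> real^'p^'p \<Rightarrow> (real^'p) measure" where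
  "mvnormal \<mu> S =
     (let A = (SOME A :: real^'p^'p. A ** transpose A = S)
      in distr std_mvnormal borel (\<lambda>z. \<mu> + A *v z))"

text \<open>
  The mixture \<open>a N + (1 - a) N'\<close> for \<open>0 \<le> a \<le> 1\<close>; see \<open>emeasure_mixture\<close>.
\<close>

definition mixture :: "real \<Rightarrow> 'a measure \<Rightarrow> 'a measure \<Rightarrow> 'a measure" where
  "mixture a N N' = measure_pmf (bernoulli_pmf a) \<bind> (\<lambda>b. if b then N else N')"

text \<open>Samples are indexed from \<open>0\<close>: the first \<open>n\<close> observations are \<open>x 0, \<dots>, x (n - 1)\<close>.\<close>

definition sample_mean :: "(nat \<Rightarrow> real^'p) \<Rightarrow> nat \<Rightarrow> real^'p" where
  "sample_mean x n = (1 / real n) *\<^sub>R (\<Sum>i<n. x i)"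

definition sample_kurtosis :: "(nat \<Rightarrow> real^'p) \<Rightarrow> nat \<Rightarrow> real^'p \<Rightarrow> real" where
  "sample_kurtosis x n v =
     ((1 / real n) * (\<Sum>i<n. (v \<bullet> (x i - sample_mean x n)) ^ 4)) /
     ((1 / real n) * (\<Sum>i<n. (v \<bullet> (x i - sample_mean x n))\<^sup>2))\<^sup>2"

definition outer_prod :: "real^'p \<Rightarrow> real^'p \<Rightarrow> real^'p^'p" where
  "outer_prod v w = (\<chi> i j. v $ i * w $ j)"

text \<open>
  The library's \<open>weak_conv_m\<close> is stated through distribution functions, for measures on
  the real line only.
\<close>

definition weakly_converges ::
    "(nat \<Rightarrow> 'b::topological_space measure) \<Rightarrow> 'b measure \<Rightarrow> bool" where
  "weakly_converges N N' \<longleftrightarrow>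
     (\<forall>f :: 'b \<Rightarrow> real. continuous_on UNIV f \<and> bounded (range f) \<longrightarrow>
        (\<lambda>n. \<integral>y. f y \<partial>N n) \<longlonglongrightarrow> (\<integral>y. f y \<partial>N'))"

definition converges_in_distribution ::
    "'a measure \<Rightarrow> (nat \<Rightarrow> 'a \<Rightarrow> 'b::topological_space) \<Rightarrow> 'b measure \<Rightarrow> bool" where
  "converges_in_distribution M Y N \<longleftrightarrow> weakly_converges (\<lambda>n. distr M borel (Y n)) N"

lemma covariance_matrix_factorization_aux:
  fixes S :: "real^'p^'p"
  assumes "finite I" "covariance_matrix S" "\<And>i j. i \<notin> I \<Longrightarrow> S $ i $ j = 0"
  shows "\<exists>A :: real^'p^'p. A ** transpose A = S \<and> (\<forall>i j. j \<notin> I \<longrightarrow> A $ i $ j = 0)"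
  using assms
proof (induction I arbitrary: S rule: finite_induct)
  case empty
  then have "S = 0" by (simp add: vec_eq_iff)
  then have "(0 :: real^'p^'p) ** transpose 0 = S"
    by (simp add: matrix_matrix_mult_def vec_eq_iff)
  then show ?case by (intro exI[of _ 0]) simp
next
  case (insert k I)
  let ?e = "axis k 1 :: real^'p"
  have "transpose S $ i $ j = S $ i $ j" for i j
    using insert.prems(1) by (simp add: covariance_matrix_def)
  then have sym: "S $ i $ j = S $ j $ i" for i j
    by (simp add: transpose_def)
  have psd: "0 \<le> v \<bullet> (S *v v)" for v
    using insert.prems(1) by (simp add: covariance_matrix_def)
  have row: "?e \<bullet> (S *v v) = (\<Sum>j\<in>UNIV. S $ k $ j * v $ j)" for v
    by (simp add: inner_axis' matrix_vector_mult_def)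
  have col: "(S *v ?e) $ i = S $ i $ k" for i
    by (simp add: matrix_vector_mult_basis column_def)
  have col': "v \<bullet> (S *v ?e) = ?e \<bullet> (S *v v)" for v
    unfolding row unfolding inner_vec_def
    by (intro sum.cong) (simp_all add: col sym[of k])
  have quad: "(v + t *\<^sub>R ?e) \<bullet> (S *v (v + t *\<^sub>R ?e)) =
      v \<bullet> (S *v v) + 2 * t * (?e \<bullet> (S *v v)) + t\<^sup>2 * S $ k $ k" for v t
  proof -
    have "?e \<bullet> (S *v ?e) = S $ k $ k" by (simp add: inner_axis' col)
    then show ?thesis
      by (simp add: matrix_vector_right_distrib inner_add_left inner_add_right
          matrix_vector_mult_scaleR col'[of v] power2_eq_square algebra_simps)
  qed
  have nn: "0 \<le> S $ k $ k" using psd[of ?e] by (simp add: inner_axis' col)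
  show ?case
  proof (cases "S $ k $ k = 0")
    case True
    have "S $ k $ j = 0" for j
    proof (rule ccontr)
      let ?v = "axis j 1 :: real^'p"
      assume nz: "S $ k $ j \<noteq> 0"
      have r: "?e \<bullet> (S *v ?v) = S $ k $ j"
        by (simp add: inner_axis' matrix_vector_mult_basis column_def)
      define t where "t = - (?v \<bullet> (S *v ?v) + 1) / (2 * S $ k $ j)"
      have "2 * t * S $ k $ j = - (?v \<bullet> (S *v ?v) + 1)"
        using nz by (simp add: t_def field_simps)
      with psd[of "?v + t *\<^sub>R ?e"] show False
        unfolding quad r by (simp add: True)
    qed
    then have "S $ i $ j = 0" if "i \<notin> I" for i j
      using insert.prems(2)[of i j] that by (cases "i = k") auto
    from insert.IH[OF insert.prems(1) this] show ?thesis by auto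
  next
    case False
    with nn have pos: "0 < S $ k $ k" by simp
    define S' :: "real^'p^'p" where "S' = (\<chi> i j. S $ i $ j - S $ i $ k * S $ k $ j / S $ k $ k)"
    have S'v: "v \<bullet> (S' *v v) = v \<bullet> (S *v v) - (?e \<bullet> (S *v v))\<^sup>2 / S $ k $ k" for v
    proof -
      have "S' *v v = S *v v - ((?e \<bullet> (S *v v)) / S $ k $ k) *\<^sub>R (S *v ?e)"
        unfolding row
        by (simp add: vec_eq_iff col)
          (simp add: S'_def matrix_vector_mult_def left_diff_distrib sum_subtractf
            sum_divide_distrib sum_distrib_left algebra_simps)
      then show ?thesis
        by (simp add: inner_diff_right col'[of v] power2_eq_square)
    qed
    have "covariance_matrix S'"
      unfolding covariance_matrix_def
    proof (intro conjI allI)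
      show "transpose S' = S'"
        unfolding vec_eq_iff
      proof (intro allI)
        fix i j
        show "transpose S' $ i $ j = S' $ i $ j"
          using sym[of j i] sym[of j k] sym[of k i] by (simp add: transpose_def S'_def)
      qed
      fix v :: "real^'p"
      let ?t = "- (?e \<bullet> (S *v v)) / S $ k $ k"
      have "0 \<le> (v + ?t *\<^sub>R ?e) \<bullet> (S *v (v + ?t *\<^sub>R ?e))" by (rule psd)
      also have "\<dots> = v \<bullet> (S' *v v)"
        unfolding quad S'v using pos by (simp add: power2_eq_square field_simps)
      finally show "0 \<le> v \<bullet> (S' *v v)" .
    qed
    moreover have "S' $ i $ j = 0" if "i \<notin> I" for i j
      using insert.prems(2)[of i] that pos by (cases "i = k") (auto simp: S'_def)
    ultimately obtain A :: "real^'p^'p"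
      where A: "A ** transpose A = S'" "\<And>i j. j \<notin> I \<Longrightarrow> A $ i $ j = 0"
      using insert.IH by blast
    define B :: "real^'p^'p"
      where "B = (\<chi> i j. if j = k then S $ i $ k / sqrt (S $ k $ k) else A $ i $ j)"
    have "(B ** transpose B) $ i $ j = S $ i $ j" for i j
    proof -
      have "(A ** transpose A) $ i $ j = (\<Sum>l\<in>UNIV. A $ i $ l * A $ j $ l)"
        by (simp add: matrix_matrix_mult_def transpose_def)
      also have "\<dots> = (\<Sum>l\<in>UNIV - {k}. A $ i $ l * A $ j $ l)"
        by (subst sum.remove[of _ k]) (use A(2)[of k] insert.hyps in auto)
      finally have 1: "(\<Sum>l\<in>UNIV - {k}. A $ i $ l * A $ j $ l) = S' $ i $ j"
        by (simp add: A(1))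
      have "(B ** transpose B) $ i $ j = (\<Sum>l\<in>UNIV. B $ i $ l * B $ j $ l)"
        by (simp add: matrix_matrix_mult_def transpose_def)
      also have "\<dots> = B $ i $ k * B $ j $ k + (\<Sum>l\<in>UNIV - {k}. A $ i $ l * A $ j $ l)"
        by (subst sum.remove[of _ k]) (auto simp: B_def)
      also have "\<dots> = S $ i $ j"
        unfolding 1 using pos sym[of j k] by (simp add: B_def S'_def)
      finally show ?thesis .
    qed
    then have "B ** transpose B = S" by (simp add: vec_eq_iff)
    moreover have "\<forall>i j. j \<notin> insert k I \<longrightarrow> B $ i $ j = 0"
      using A(2) by (simp add: B_def)
    ultimately show ?thesis by blast
  qed
qed

lemma covariance_matrix_factorization:
  fixes S :: "real^'p^'p"
  assumes "covariance_matrix S"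
  shows "\<exists>A :: real^'p^'p. A ** transpose A = S"
  using covariance_matrix_factorization_aux[of UNIV S] assms by auto

lemma measurable_vec_lambda_PiM:
  fixes N :: "'p::finite \<Rightarrow> real measure"
  assumes "\<And>i. sets (N i) = sets borel"
  shows "(\<lambda>z. \<chi> i. z i) \<in> borel_measurable (\<Pi>\<^sub>M i\<in>UNIV. N i)"
proof (subst borel_measurable_euclidean_space, intro ballI)
  fix b :: "real^'p" assume "b \<in> Basis"
  then obtain k where b: "b = axis k 1"
    by (auto simp: Basis_vec_def)
  have "(\<lambda>z. z k) \<in> measurable (\<Pi>\<^sub>M i\<in>(UNIV :: 'p set). N i) (N k)"
    by (rule measurable_component_singleton) simp
  then have "(\<lambda>z. z k) \<in> borel_measurable (\<Pi>\<^sub>M i\<in>(UNIV :: 'p set). N i)"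
    using measurable_cong_sets[OF refl assms] by blast
  then show "(\<lambda>z. (\<chi> i. z i) \<bullet> b) \<in> borel_measurable (\<Pi>\<^sub>M i\<in>(UNIV :: 'p set). N i)"
    by (simp add: b inner_axis)
qed

lemma prob_space_std_mvnormal: "prob_space (std_mvnormal :: (real^'p) measure)"
  unfolding std_mvnormal_def
  by (intro prob_space.prob_space_distr prob_space_PiM measurable_vec_lambda_PiM
        prob_space_normal_density) auto

lemma sets_mvnormal [simp, measurable_cong]: "sets (mvnormal \<mu> S) = sets borel"
  by (simp add: mvnormal_def Let_def)

lemma prob_space_mvnormal:
  fixes \<mu> :: "real^'p" and S :: "real^'p^'p"
  shows "prob_space (mvnormal \<mu> S)"
proof -
  have "(\<lambda>z. \<mu> + A *v z) \<in> measurable std_mvnormal borel" for A :: "real^'p^'p"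
  proof -
    have "(\<lambda>z. \<mu> + A *v z) \<in> borel_measurable borel"
      by (intro borel_measurable_continuous_onI continuous_intros
          linear_continuous_on linear_linear[THEN iffD2] matrix_vector_mul_linear)
    then show ?thesis by (simp add: std_mvnormal_def)
  qed
  then show ?thesis
    unfolding mvnormal_def Let_def by (intro prob_space.prob_space_distr prob_space_std_mvnormal)
qed

lemma emeasure_mixture:
  assumes a: "0 \<le> a" "a \<le> 1" and N: "prob_space N" "prob_space N'"
    and S: "sets N' = sets N" and B: "B \<in> sets N"
  shows "emeasure (mixture a N N') B =
           ennreal a * emeasure N B + ennreal (1 - a) * emeasure N' B"
proof -
  have *: "(\<lambda>b. if b then N else N') \<in> measurable (measure_pmf (bernoulli_pmf a)) (subprob_algebra N)"
    using N S by (auto simp: space_subprob_algebra prob_space_imp_subprob_space)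
  show ?thesis
    unfolding mixture_def using a
    by (subst emeasure_bind[OF _ * B]) (simp_all add: mult.commute)
qed

end

theory Submission
  imports Defs
begin

text \<open>
  For a unit vector \<open>v\<close> with \<open>s = v \<bullet> \<Sigma> v\<close> and \<open>D = v \<bullet> (\<mu>\<^sub>2 - \<mu>\<^sub>1)\<close>, the excess kurtosis of the projection is
  \<open>\<beta> (1 - 6 \<beta>) D\<^sup>4 / (s + \<beta> D\<^sup>2)\<^sup>2\<close>, whose square is maximal only at \<open>\<plusminus> \<theta> / |\<theta>|\<close> by Cauchy--Schwarz.
  The sample moments converge almost surely, and compactness of the sphere gives consistency.

  For the second part, the maximiser is a critical point of a ratio of forms in \<open>v\<close>. Expanding the
  first-order condition at \<open>e = \<theta> / |\<theta>|\<close> gives \<open>v - e\<close> as a linear image of the first-order condition at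
  \<open>e\<close>, up to a negligible remainder. The relevant directions \<open>w\<close> satisfy \<open>w \<bullet> (\<mu>\<^sub>2 - \<mu>\<^sub>1) = 0\<close> and
  \<open>e \<bullet> \<Sigma> w = 0\<close>. Hence \<open>w \<bullet> x\<close> is a Gaussian factor independent of \<open>e \<bullet> x\<close>, and the linearised statistic
  is a normalised sum of centred i.i.d. vectors. Its covariance needs moments up to order six of
  a univariate mixture only.

  Multivariate weak convergence reduces to characteristic functions by approximating a bounded
  continuous function with trigonometric polynomials, so the univariate central limit theorem suffices.
\<close>

section \<open>Moments of Gaussian vectors\<close>

text \<open>The test directions \<open>dual t\<close>, the inverse of \<Sigma> applied to the
  tangential part of a basis vector, keep the expansion explicit: paired with them, the derivative
  of the limiting first-order condition is a scalar multiple of the tangential projection, so no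
  Hessian has to be inverted. The scalar is minus \<open>c0\<close>, where
  \<open>c0 = M4 e e e e - 3 * (M2 e e)\<^sup>2\<close> equals
  \<open>\<beta> * (1 - 6 * \<beta>) * (e \<bullet> \<delta>) ^ 4\<close> and vanishes exactly at
  the excluded mixing weights. The factor 1 - 6 \<beta> also keeps the sample kurtosis at the
  maximiser away from 3, so that criticality of the square yields criticality of the kurtosis. The
  obstacle is the remainder, whose bounds hold only from a path-dependent index on. It is compared
  with \<open>gauge\<close>, a sum of absolute normalised sums with bounded expectation: for each
  \<epsilon> it is almost surely at most \<epsilon> times \<open>gauge\<close> eventually. This
  yields convergence in probability. The norm of the influence sum is no substitute for
  \<open>gauge\<close>: it fixes one combination of these sums, while the error involves each of
  them.\<close>

definition poly_bounded :: "('b::real_normed_vector \<Rightarrow> real) \<Rightarrow> bool" where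
  "poly_bounded h \<longleftrightarrow> h \<in> borel_measurable borel \<and> (\<exists>C k. \<forall>x. \<bar>h x\<bar> \<le> C * (1 + norm x) ^ k)"

lemma poly_bounded_measurable [measurable_dest]: "poly_bounded h \<Longrightarrow> h \<in> borel_measurable borel"
  by (simp add: poly_bounded_def)

lemma poly_bounded_const: "poly_bounded (\<lambda>_. c)"
  unfolding poly_bounded_def by (rule conjI, simp, rule exI[of _ "\<bar>c\<bar>"], rule exI[of _ 0], simp)

lemma poly_bounded_inner: "poly_bounded (\<lambda>x::'b::euclidean_space. v \<bullet> x)"
  unfolding poly_bounded_def
proof (intro conjI exI allI)
  fix x :: 'b
  have "\<bar>v \<bullet> x\<bar> \<le> norm v * norm x" by (rule Cauchy_Schwarz_ineq2)
  also have "\<dots> \<le> norm v * (1 + norm x) ^ 1" by (intro mult_left_mono) auto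
  finally show "\<bar>v \<bullet> x\<bar> \<le> norm v * (1 + norm x) ^ 1" .
qed simp

lemma poly_bounded_norm: "poly_bounded (norm :: 'b::euclidean_space \<Rightarrow> real)"
  unfolding poly_bounded_def
proof (intro conjI exI allI)
  show "\<bar>norm x\<bar> \<le> 1 * (1 + norm x) ^ 1" for x :: 'b by simp
qed simp

lemma poly_bounded_mult:
  fixes g h :: "'b::euclidean_space \<Rightarrow> real"
  assumes "poly_bounded g" "poly_bounded h"
  shows "poly_bounded (\<lambda>x. g x * h x)"
proof -
  from assms obtain C k D l where *: "\<And>x. \<bar>g x\<bar> \<le> C * (1 + norm x) ^ k" "\<And>x. \<bar>h x\<bar> \<le> D * (1 + norm x) ^ l"
    unfolding poly_bounded_def by blast
  have "\<bar>g x * h x\<bar> \<le> (C * D) * (1 + norm x) ^ (k + l)" for x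
  proof -
    have "\<bar>g x * h x\<bar> \<le> (C * (1 + norm x) ^ k) * (D * (1 + norm x) ^ l)"
      unfolding abs_mult using *[of x] by (intro mult_mono) (auto intro: order_trans[OF abs_ge_zero])
    then show ?thesis by (simp add: power_add mult_ac)
  qed
  then show ?thesis using assms unfolding poly_bounded_def by auto
qed

lemma poly_bounded_add:
  fixes g h :: "'b::euclidean_space \<Rightarrow> real"
  assumes "poly_bounded g" "poly_bounded h"
  shows "poly_bounded (\<lambda>x. g x + h x)"
proof -
  from assms obtain C k D l where *: "\<And>x. \<bar>g x\<bar> \<le> C * (1 + norm x) ^ k" "\<And>x. \<bar>h x\<bar> \<le> D * (1 + norm x) ^ l"
    unfolding poly_bounded_def by blast
  have pos: "0 \<le> C" "0 \<le> D"
    using *[of 0] by (auto intro: order_trans[OF abs_ge_zero])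
  have "\<bar>g x + h x\<bar> \<le> (C + D) * (1 + norm x) ^ (k + l)" for x
  proof -
    have "C * (1 + norm x) ^ k \<le> C * (1 + norm x) ^ (k + l)" "D * (1 + norm x) ^ l \<le> D * (1 + norm x) ^ (k + l)"
      using pos by (intro mult_left_mono power_increasing; simp)+
    with *[of x] show ?thesis by (simp add: distrib_right)
  qed
  then show ?thesis using assms unfolding poly_bounded_def by auto
qed

lemma poly_bounded_power:
  fixes g :: "'b::euclidean_space \<Rightarrow> real"
  assumes "poly_bounded g"
  shows "poly_bounded (\<lambda>x. g x ^ n)"
proof (induction n)
  case (Suc n)
  show ?case using poly_bounded_mult[OF assms Suc.IH] by simp
qed (simp add: poly_bounded_const)

lemma poly_bounded_uminus:
  fixes g :: "'b::euclidean_space \<Rightarrow> real"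
  assumes "poly_bounded g"
  shows "poly_bounded (\<lambda>x. - g x)"
  using poly_bounded_mult[OF poly_bounded_const[of "-1"] assms] by simp

lemma poly_bounded_diff:
  fixes g h :: "'b::euclidean_space \<Rightarrow> real"
  assumes "poly_bounded g" "poly_bounded h"
  shows "poly_bounded (\<lambda>x. g x - h x)"
  using poly_bounded_add[OF assms(1) poly_bounded_uminus[OF assms(2)]] by simp

lemma poly_bounded_shift:
  fixes h :: "'b::euclidean_space \<Rightarrow> real"
  assumes "poly_bounded h"
  shows "poly_bounded (\<lambda>x. h (x - m))"
proof -
  have meas: "(\<lambda>x. h (x - m)) \<in> borel_measurable borel"
    by (rule measurable_compose[OF _ poly_bounded_measurable[OF assms]]) measurable
  from assms obtain C k where *: "\<And>x. \<bar>h x\<bar> \<le> C * (1 + norm x) ^ k"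
    unfolding poly_bounded_def by blast
  have C: "0 \<le> C" using *[of 0] by (auto intro: order_trans[OF abs_ge_zero])
  have "\<bar>h (x - m)\<bar> \<le> (C * (1 + norm m) ^ k) * (1 + norm x) ^ k" for x
  proof -
    have "1 + norm (x - m) \<le> (1 + norm m) * (1 + norm x)"
      using norm_triangle_ineq4[of x m] mult_nonneg_nonneg[OF norm_ge_zero[of m] norm_ge_zero[of x]]
      by (simp only: distrib_left distrib_right)
    then have "(1 + norm (x - m)) ^ k \<le> ((1 + norm m) * (1 + norm x)) ^ k" by (intro power_mono) auto
    with C have "C * (1 + norm (x - m)) ^ k \<le> C * ((1 + norm m) * (1 + norm x)) ^ k"
      by (intro mult_left_mono)
    with *[of "x - m"] show ?thesis by (simp add: power_mult_distrib mult_ac)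
  qed
  with meas show ?thesis unfolding poly_bounded_def by blast
qed

lemmas poly_bounded_intros = poly_bounded_const poly_bounded_inner poly_bounded_mult poly_bounded_add
  poly_bounded_power poly_bounded_uminus poly_bounded_diff

text \<open>Together with \<open>poly_bounded\<close> this replaces case-by-case integrability
  proofs: functions of polynomial growth are closed under sums, products and shifts, and each is
  dominated by a multiple of one power of \<open>1 + norm x\<close>. The summand 1 lets powers be
  compared by exponent, also near the origin.\<close>

definition has_all_moments :: "'b::real_normed_vector measure \<Rightarrow> bool" where
  "has_all_moments N \<longleftrightarrow> sets N = sets borel \<and> (\<forall>k. integrable N (\<lambda>x. (1 + norm x) ^ k))"

lemma integrable_poly_bounded:
  fixes N :: "'b::euclidean_space measure"
  assumes "has_all_moments N" "poly_bounded h"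
  shows "integrable N h"
proof -
  from assms obtain C k where *: "\<And>x. \<bar>h x\<bar> \<le> C * (1 + norm x) ^ k"
    unfolding poly_bounded_def by blast
  have "integrable N (\<lambda>x. C * (1 + norm x) ^ k)"
    using assms(1) by (simp add: has_all_moments_def)
  then show ?thesis
  proof (rule Bochner_Integration.integrable_bound)
    show "h \<in> borel_measurable N"
      using assms unfolding has_all_moments_def poly_bounded_def
      by (metis measurable_cong_sets)
    show "AE x in N. norm (h x) \<le> norm (C * (1 + norm x) ^ k)"
      using * by (auto intro: order_trans[OF _ abs_ge_self])
  qed
qed

section \<open>Linear forms of a standard normal vector\<close>

lemma sets_std_mvnormal [simp, measurable_cong]: "sets std_mvnormal = sets borel"
  by (simp add: std_mvnormal_def)

lemma iexp_std_mvnormal: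
  fixes b :: "real^'p"
  shows "(CLINT z|std_mvnormal. iexp (b \<bullet> z)) = complex_of_real (exp (- (norm b)\<^sup>2 / 2))"
proof -
  let ?N = "std_normal_distribution"
  let ?P = "PiM (UNIV :: 'p set) (\<lambda>_. ?N)"
  interpret N: prob_space ?N by (rule prob_space_normal_density) simp
  interpret product_sigma_finite "\<lambda>_::'p. ?N" ..
  have "(CLINT z|std_mvnormal. iexp (b \<bullet> z)) = (CLINT z|?P. iexp (b \<bullet> (\<chi> i. z i)))"
    unfolding std_mvnormal_def
    by (subst integral_distr) (auto intro!: measurable_vec_lambda_PiM)
  also have "\<dots> = (CLINT z|?P. (\<Prod>i\<in>UNIV. iexp (b $ i * z i)))"
    by (simp add: inner_vec_def exp_sum[symmetric] sum_distrib_left)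
  also have "\<dots> = (\<Prod>i\<in>UNIV. (CLINT x|?N. iexp (b $ i * x)))"
    by (rule product_integral_prod) (auto intro!: N.integrable_iexp)
  also have "\<dots> = (\<Prod>i\<in>UNIV. complex_of_real (exp (- (b $ i)\<^sup>2 / 2)))"
    using char_std_normal_distribution by (intro prod.cong) (simp_all add: char_def fun_eq_iff)
  also have "\<dots> = complex_of_real (exp (\<Sum>i\<in>UNIV. - (b $ i)\<^sup>2 / 2))"
    by (simp add: exp_sum del: of_real_exp)
  also have "(\<Sum>i\<in>UNIV. - (b $ i)\<^sup>2 / 2) = - (norm b)\<^sup>2 / 2"
    by (simp add: norm_vec_def L2_set_def sum_nonneg sum_negf sum_divide_distrib)
  finally show ?thesis .
qed

text \<open>This is rotation invariance for one linear form: the characteristic function of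
  \<open>b \<bullet> z\<close> sees \<open>b\<close> only through its norm. It reduces every moment
  of a linear form to a univariate one.\<close>

lemma distr_inner_std_mvnormal:
  fixes b :: "real^'p"
  shows "distr std_mvnormal borel (\<lambda>z. b \<bullet> z) = distr std_normal_distribution borel (\<lambda>x. norm b * x)"
proof (rule Levy_uniqueness)
  interpret S: prob_space "std_mvnormal :: (real^'p) measure" by (rule prob_space_std_mvnormal)
  interpret N: prob_space std_normal_distribution by (rule prob_space_normal_density) simp
  show "real_distribution (distr std_mvnormal borel (\<lambda>z. b \<bullet> z))"
    by (rule S.real_distribution_distr) measurable
  show "real_distribution (distr std_normal_distribution borel (\<lambda>x. norm b * x))"
    by (rule N.real_distribution_distr) measurable
  show "char (distr std_mvnormal borel (\<lambda>z. b \<bullet> z)) = char (distr std_normal_distribution borel (\<lambda>x. norm b * x))"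
  proof
    fix t :: real
    have "char (distr std_mvnormal borel (\<lambda>z. b \<bullet> z)) t = (CLINT z|std_mvnormal. iexp ((t *\<^sub>R b) \<bullet> z))"
      unfolding char_def by (subst integral_distr) auto
    also have "\<dots> = complex_of_real (exp (- (t * norm b)\<^sup>2 / 2))"
      unfolding iexp_std_mvnormal by (simp add: power_mult_distrib)
    also have "\<dots> = char std_normal_distribution (t * norm b)"
      by (simp add: char_std_normal_distribution)
    also have "\<dots> = char (distr std_normal_distribution borel (\<lambda>x. norm b * x)) t"
      unfolding char_def by (subst integral_distr) (auto simp: mult_ac)
    finally show "char (distr std_mvnormal borel (\<lambda>z. b \<bullet> z)) t = char (distr std_normal_distribution borel (\<lambda>x. norm b * x)) t" .
  qed
qed

lemma integral_inner_std_mvnormal: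
  fixes b :: "real^'p" and f :: "real \<Rightarrow> real"
  assumes [measurable]: "f \<in> borel_measurable borel"
  shows "(\<integral>z. f (b \<bullet> z) \<partial>std_mvnormal) = (\<integral>x. f (norm b * x) \<partial>std_normal_distribution)"
proof -
  have "(\<integral>z. f (b \<bullet> z) \<partial>std_mvnormal) = integral\<^sup>L (distr std_mvnormal borel (\<lambda>z. b \<bullet> z)) f"
    by (subst integral_distr) auto
  also have "\<dots> = (\<integral>x. f (norm b * x) \<partial>std_normal_distribution)"
    unfolding distr_inner_std_mvnormal by (subst integral_distr) auto
  finally show ?thesis .
qed

lemma integrable_inner_std_mvnormal:
  fixes b :: "real^'p"
  shows "integrable std_mvnormal (\<lambda>z. \<bar>b \<bullet> z\<bar> ^ k)"
proof -
  have "integrable std_normal_distribution (\<lambda>x. norm b ^ k * norm (x ^ k))"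
    by (intro integrable_mult_right integrable_norm integrable_std_normal_distribution_moment)
  then have "integrable std_normal_distribution (\<lambda>x. \<bar>norm b * x\<bar> ^ k)"
    by (simp add: abs_mult power_mult_distrib power_abs)
  then have "integrable (distr std_normal_distribution borel (\<lambda>x. norm b * x)) (\<lambda>x. \<bar>x\<bar> ^ k)"
    by (subst integrable_distr_eq) auto
  then have "integrable (distr std_mvnormal borel (\<lambda>z. b \<bullet> z)) (\<lambda>x. \<bar>x\<bar> ^ k)"
    by (simp add: distr_inner_std_mvnormal)
  then show ?thesis by (subst (asm) integrable_distr_eq) auto
qed

text \<open>Some coordinate realises the maximum, and its power is one term of the sum on the right;
  comparing with \<open>max 1 m\<close> covers vectors whose coordinates are all small. The bound
  passes from moments of coordinates to moments of the norm.\<close>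

lemma power_one_plus_norm_le:
  fixes z :: "real^'p"
  shows "(1 + norm z) ^ k \<le> (1 + real CARD('p)) ^ k * (1 + (\<Sum>i\<in>UNIV. \<bar>z $ i\<bar> ^ k))"
proof -
  define m where "m = Max (range (\<lambda>i. \<bar>z $ i\<bar>))"
  have "m \<in> range (\<lambda>i. \<bar>z $ i\<bar>)" unfolding m_def by (intro Max_in) auto
  then obtain j where j: "m = \<bar>z $ j\<bar>" by blast
  have le: "\<bar>z $ i\<bar> \<le> m" for i unfolding m_def by (intro Max_ge) auto
  have "norm z \<le> (\<Sum>i\<in>UNIV. \<bar>z $ i\<bar>)" by (rule norm_le_l1_cart)
  also have "\<dots> \<le> real CARD('p) * m" using sum_bounded_above[of UNIV "\<lambda>i. \<bar>z $ i\<bar>" m] le by simp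
  also have "\<dots> \<le> real CARD('p) * max 1 m" by (intro mult_left_mono) auto
  finally have "1 + norm z \<le> (1 + real CARD('p)) * max 1 m" by (simp add: algebra_simps)
  then have "(1 + norm z) ^ k \<le> ((1 + real CARD('p)) * max 1 m) ^ k" by (intro power_mono) auto
  also have "\<dots> = (1 + real CARD('p)) ^ k * (max 1 m) ^ k" by (rule power_mult_distrib)
  also have "(max 1 m) ^ k \<le> 1 + (\<Sum>i\<in>UNIV. \<bar>z $ i\<bar> ^ k)"
  proof -
    have "\<bar>z $ j\<bar> ^ k \<le> (\<Sum>i\<in>UNIV. \<bar>z $ i\<bar> ^ k)"
      by (rule member_le_sum) auto
    moreover have "0 \<le> (\<Sum>i\<in>UNIV. \<bar>z $ i\<bar> ^ k)" by (intro sum_nonneg) auto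
    ultimately show ?thesis unfolding j by (auto simp: max_def)
  qed
  finally show ?thesis by (simp add: mult_left_mono)
qed

lemma has_all_moments_std_mvnormal: "has_all_moments (std_mvnormal :: (real^'p) measure)"
  unfolding has_all_moments_def
proof (intro conjI allI)
  fix k :: nat
  interpret S: prob_space "std_mvnormal :: (real^'p) measure" by (rule prob_space_std_mvnormal)
  have i: "integrable std_mvnormal (\<lambda>z::real^'p. \<bar>z $ i\<bar> ^ k)" for i
    using integrable_inner_std_mvnormal[of "axis i 1" k] by (simp add: inner_axis')
  have int: "integrable std_mvnormal (\<lambda>z::real^'p. (1 + real CARD('p)) ^ k * (1 + (\<Sum>i\<in>UNIV. \<bar>z $ i\<bar> ^ k)))"
    by (intro integrable_mult_right Bochner_Integration.integrable_add Bochner_Integration.integrable_sum i) simp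
  have le: "norm ((1 + norm z) ^ k) \<le> norm ((1 + real CARD('p)) ^ k * (1 + (\<Sum>i\<in>UNIV. \<bar>z $ i\<bar> ^ k)))" for z :: "real^'p"
    using order_trans[OF power_one_plus_norm_le[of z k] abs_ge_self] by simp
  show "integrable std_mvnormal (\<lambda>z::real^'p. (1 + norm z) ^ k)"
  proof (rule Bochner_Integration.integrable_bound[OF int])
    show "AE z::real^'p in std_mvnormal. norm ((1 + norm z) ^ k) \<le> norm ((1 + real CARD('p)) ^ k * (1 + (\<Sum>i\<in>UNIV. \<bar>z $ i\<bar> ^ k)))"
      by (rule AE_I2) (rule le)
  qed simp
qed simp

definition gauss_moment :: "nat \<Rightarrow> real" where
  "gauss_moment k = (\<integral>x. x ^ k \<partial>std_normal_distribution)"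

lemma gauss_moment_odd: "odd k \<Longrightarrow> gauss_moment k = 0"
  by (simp add: gauss_moment_def integral_std_normal_distribution_moment_odd)

lemma gauss_moment_even: "gauss_moment (2 * k) = fact (2 * k) / (2 ^ k * fact k)"
  using std_normal_distribution_even_moments[of k] by (simp add: gauss_moment_def)

lemma moment_std_mvnormal:
  fixes b :: "real^'p"
  shows "(\<integral>z. (b \<bullet> z) ^ k \<partial>std_mvnormal) = norm b ^ k * gauss_moment k"
  by (subst integral_inner_std_mvnormal) (simp_all add: power_mult_distrib gauss_moment_def)

lemma integrable_std_mvnormal_poly:
  fixes h :: "real^'p \<Rightarrow> real"
  shows "poly_bounded h \<Longrightarrow> integrable std_mvnormal h"
  by (rule integrable_poly_bounded[OF has_all_moments_std_mvnormal])

text \<open>Serves to compare coefficients: a polynomial in \<open>t\<^sup>2\<close> is padded with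
  zero odd coefficients and becomes a polynomial in \<open>t\<close>.\<close>

lemma sum_even_powers:
  fixes t :: real
  shows "(\<Sum>k\<le>2 * l. (if even k then f (k div 2) else 0) * t ^ k) = (\<Sum>j\<le>l. f j * (t\<^sup>2) ^ j)"
proof (induction l)
  case (Suc l)
  have e: "2 * Suc l = Suc (Suc (2 * l))" and p: "t ^ Suc (Suc (2 * l)) = (t\<^sup>2) ^ Suc l"
    by (simp_all add: power_mult power2_eq_square)
  show ?case unfolding e sum.atMost_Suc Suc.IH p by simp
qed simp

text \<open>
  For \<open>p\<close> orthogonal to \<open>q\<close> the \<open>m\<close>-th moment of \<open>(p + t q) \<bullet> z\<close> is a function of
  \<open>|p|\<^sup>2 + t\<^sup>2 |q|\<^sup>2\<close>, and the mixed moments are its coefficients as a polynomial in \<open>t\<close>.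
\<close>

lemma mixed_moment_std_mvnormal:
  fixes p q :: "real^'p"
  assumes orth: "p \<bullet> q = 0" and k: "k \<le> m"
  shows "real (m choose k) * (\<integral>z. (p \<bullet> z) ^ (m - k) * (q \<bullet> z) ^ k \<partial>std_mvnormal) =
    (if even m \<and> even k then gauss_moment m * real ((m div 2) choose (k div 2)) * norm q ^ k * norm p ^ (m - k) else 0)"
proof -
  let ?c = "\<lambda>k. real (m choose k) * (\<integral>z. (p \<bullet> z) ^ (m - k) * (q \<bullet> z) ^ k \<partial>std_mvnormal)"
  let ?d = "\<lambda>k. (if even m \<and> even k then gauss_moment m * real ((m div 2) choose (k div 2)) * norm q ^ k * norm p ^ (m - k) else 0)"
  have "(\<Sum>k\<le>m. ?c k * t ^ k) = (\<Sum>k\<le>m. ?d k * t ^ k)" for t :: real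
  proof -
    have int: "integrable std_mvnormal (\<lambda>z. (p \<bullet> z) ^ (m - k) * (q \<bullet> z) ^ k)" for k
      by (intro integrable_std_mvnormal_poly poly_bounded_intros)
    have "(\<Sum>k\<le>m. ?c k * t ^ k) = (\<integral>z. (\<Sum>k\<le>m. real (m choose k) * t ^ k * ((p \<bullet> z) ^ (m - k) * (q \<bullet> z) ^ k)) \<partial>std_mvnormal)"
      by (subst Bochner_Integration.integral_sum) (simp_all add: int mult.assoc integrable_mult_right, simp add: mult_ac)
    also have "\<dots> = (\<integral>z. ((p + t *\<^sub>R q) \<bullet> z) ^ m \<partial>std_mvnormal)"
    proof (intro Bochner_Integration.integral_cong refl)
      fix z :: "real^'p"
      have "((p + t *\<^sub>R q) \<bullet> z) ^ m = (t * (q \<bullet> z) + p \<bullet> z) ^ m"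
        by (simp add: inner_add_left add_ac)
      also have "\<dots> = (\<Sum>k\<le>m. real (m choose k) * t ^ k * ((p \<bullet> z) ^ (m - k) * (q \<bullet> z) ^ k))"
        unfolding binomial_ring by (intro sum.cong) (auto simp: power_mult_distrib)
      finally show "(\<Sum>k\<le>m. real (m choose k) * t ^ k * ((p \<bullet> z) ^ (m - k) * (q \<bullet> z) ^ k)) = ((p + t *\<^sub>R q) \<bullet> z) ^ m" ..
    qed
    also have "\<dots> = norm (p + t *\<^sub>R q) ^ m * gauss_moment m" by (rule moment_std_mvnormal)
    also have "\<dots> = (\<Sum>k\<le>m. ?d k * t ^ k)"
    proof (cases "even m")
      case False
      then show ?thesis by (simp add: gauss_moment_odd)
    next
      case True
      then obtain l where m: "m = 2 * l" by (elim evenE)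
      \<comment> \<open>Orthogonality removes the cross term, so no odd power of \<open>t\<close>
        can occur.\<close>
      have "(norm (p + t *\<^sub>R q))\<^sup>2 = (norm p)\<^sup>2 + t\<^sup>2 * (norm q)\<^sup>2"
        using orth unfolding power2_norm_eq_inner by (simp add: inner_add_left inner_add_right inner_commute power2_eq_square)
      then have "norm (p + t *\<^sub>R q) ^ m = (t\<^sup>2 * (norm q)\<^sup>2 + (norm p)\<^sup>2) ^ l"
        by (simp add: m power_mult add.commute)
      also have "\<dots> = (\<Sum>j\<le>l. (real (l choose j) * (norm q) ^ (2 * j) * (norm p) ^ (m - 2 * j)) * (t\<^sup>2) ^ j)"
        unfolding binomial_ring m
      proof (intro sum.cong refl)
        fix j assume "j \<in> {..l}"
        have e: "norm p ^ (2 * l - 2 * j) = ((norm p)\<^sup>2) ^ (l - j)"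
          by (simp add: power_mult[symmetric] diff_mult_distrib2)
        show "real (l choose j) * (t\<^sup>2 * (norm q)\<^sup>2) ^ j * ((norm p)\<^sup>2) ^ (l - j) =
          real (l choose j) * norm q ^ (2 * j) * norm p ^ (2 * l - 2 * j) * (t\<^sup>2) ^ j"
          unfolding e by (simp add: power_mult_distrib power_mult)
      qed
      also have "\<dots> = (\<Sum>k\<le>m. (if even k then real (l choose (k div 2)) * (norm q) ^ (2 * (k div 2)) * (norm p) ^ (m - 2 * (k div 2)) else 0) * t ^ k)"
        unfolding m by (rule sum_even_powers[symmetric])
      finally have "norm (p + t *\<^sub>R q) ^ m * gauss_moment m = (\<Sum>k\<le>m. gauss_moment m * ((if even k then real (l choose (k div 2)) * (norm q) ^ (2 * (k div 2)) * (norm p) ^ (m - 2 * (k div 2)) else 0) * t ^ k))"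
        by (simp add: sum_distrib_left mult_ac)
      also have "\<dots> = (\<Sum>k\<le>m. ?d k * t ^ k)"
        by (intro sum.cong) (auto simp: m)
      finally show ?thesis .
    qed
    finally show ?thesis .
  qed
  then have "\<forall>k\<le>m. ?c k = ?d k"
    using polyfun_eq_coeffs[of ?c m ?d] by blast
  with k show ?thesis by blast
qed

text \<open>The exponent of the second factor is odd, so the coefficient vanishes, while the
  binomial factor \<open>Suc k choose 1\<close> does not.\<close>

lemma mixed_moment_std_mvnormal_1:
  fixes p q :: "real^'p"
  assumes orth: "p \<bullet> q = 0"
  shows "(\<integral>z. (p \<bullet> z) ^ k * (q \<bullet> z) \<partial>std_mvnormal) = 0"
  using mixed_moment_std_mvnormal[OF orth, of 1 "Suc k"] by simp

text \<open>The recursion known from integration by parts, here read off the factorial formula; odd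
  orders give zero on both sides.\<close>

lemma gauss_moment_step: "gauss_moment (k + 2) = (real k + 1) * gauss_moment k"
proof (cases "even k")
  case False
  then show ?thesis by (simp add: gauss_moment_odd)
next
  case True
  then obtain l where l: "k = 2 * l" by (elim evenE)
  have "k + 2 = 2 * Suc l" by (simp add: l)
  then show ?thesis unfolding l
    unfolding \<open>k + 2 = 2 * Suc l\<close>[unfolded l] gauss_moment_even
    by (simp add: divide_simps)
qed

text \<open>Orthogonal forms are independent, whence the product; the proof takes it from the
  coefficient identity of order \<open>k + 2\<close> instead. There \<open>gauss_moment_step\<close>
  supplies the factor k + 1 and \<open>(k + 2) div 2\<close> the factor (k + 2) / 2, which together
  cancel the binomial coefficient.\<close>

lemma mixed_moment_std_mvnormal_2:
  fixes p q :: "real^'p"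
  assumes orth: "p \<bullet> q = 0"
  shows "(\<integral>z. (p \<bullet> z) ^ k * (q \<bullet> z)\<^sup>2 \<partial>std_mvnormal) = (\<integral>z. (p \<bullet> z) ^ k \<partial>std_mvnormal) * (norm q)\<^sup>2"
proof (cases "even k")
  case False
  then show ?thesis
    using mixed_moment_std_mvnormal[OF orth, of 2 "k + 2"] by (simp add: moment_std_mvnormal gauss_moment_odd)
next
  case True
  let ?I = "\<integral>z. (p \<bullet> z) ^ k * (q \<bullet> z)\<^sup>2 \<partial>std_mvnormal"
  have "real (k + 2 choose 2) * ?I = gauss_moment (k + 2) * real ((k + 2) div 2) * (norm q)\<^sup>2 * norm p ^ k"
    using mixed_moment_std_mvnormal[OF orth, of 2 "k + 2"] True by simp
  moreover have "real (k + 2 choose 2) = (real k + 2) * (real k + 1) / 2"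
  proof -
    have "2 * (k + 2 choose 2) = (k + 2) * (k + 1)"
      by (simp add: choose_two)
    then have "real (2 * (k + 2 choose 2)) = real ((k + 2) * (k + 1))" by (rule arg_cong)
    then show ?thesis by (simp add: algebra_simps)
  qed
  moreover have "real ((k + 2) div 2) = (real k + 2) / 2"
    using True by (auto elim!: evenE)
  ultimately have "(real k + 2) * (real k + 1) / 2 * ?I = (real k + 2) * (real k + 1) / 2 * (gauss_moment k * (norm q)\<^sup>2 * norm p ^ k)"
    by (simp only: gauss_moment_step) (simp add: mult_ac)
  moreover have "(real k + 2) * (real k + 1) / 2 \<noteq> 0"
    by (simp add: add_nonneg_eq_0_iff)
  ultimately have "?I = gauss_moment k * (norm q)\<^sup>2 * norm p ^ k"
    using mult_left_cancel by blast
  then show ?thesis by (simp add: moment_std_mvnormal mult_ac)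
qed

section \<open>Normal vectors with a given covariance matrix\<close>

lemma mvnormal_factor:
  fixes S :: "real^'p^'p"
  assumes "covariance_matrix S"
  shows "\<exists>A :: real^'p^'p. A ** transpose A = S \<and>
    (\<forall>\<mu>. mvnormal \<mu> S = distr std_mvnormal borel (\<lambda>z. \<mu> + A *v z))"
proof -
  \<comment> \<open>The chosen factor depends on \<open>S\<close> alone, so one \<open>A\<close>
    serves all means.\<close>
  have "(SOME A :: real^'p^'p. A ** transpose A = S) ** transpose (SOME A :: real^'p^'p. A ** transpose A = S) = S"
    using covariance_matrix_factorization[OF assms] by (rule someI_ex)
  then show ?thesis unfolding mvnormal_def Let_def by blast
qed

lemma borel_measurable_affine [measurable]:
  fixes A :: "real^'p^'p"
  shows "(\<lambda>z. \<mu> + A *v z) \<in> borel_measurable borel"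
  by (intro borel_measurable_continuous_onI continuous_intros
          linear_continuous_on linear_linear[THEN iffD2] matrix_vector_mul_linear)

lemma inner_matrix_mult: "v \<bullet> ((A::real^'p^'p) *v z) = (transpose A *v v) \<bullet> z"
  by (simp add: dot_lmul_matrix)

text \<open>\<open>transpose A\<close> carries the form given by \<open>S\<close> to the Euclidean
  inner product, so vectors orthogonal for \<open>S\<close> become orthogonal and the results on
  \<open>std_mvnormal\<close> apply.\<close>

lemma transpose_factor_inner:
  fixes A S :: "real^'p^'p"
  assumes "A ** transpose A = S"
  shows "(transpose A *v v) \<bullet> (transpose A *v w) = v \<bullet> (S *v w)"
  unfolding assms[symmetric] matrix_vector_mul_assoc[symmetric] inner_matrix_mult ..

lemma has_all_moments_mvnormal:
  fixes S :: "real^'p^'p"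
  assumes "covariance_matrix S"
  shows "has_all_moments (mvnormal \<mu> S)"
proof -
  from mvnormal_factor[OF assms] obtain A :: "real^'p^'p" where A: "A ** transpose A = S"
    "\<And>\<mu>. mvnormal \<mu> S = distr std_mvnormal borel (\<lambda>z. \<mu> + A *v z)" by blast
  have "integrable (mvnormal \<mu> S) (\<lambda>x. (1 + norm x) ^ k)" for k
    unfolding A(2)
  proof (subst integrable_distr_eq)
    obtain K where K: "\<And>z. norm (A *v z) \<le> norm z * K" "K > 0"
      using bounded_linear.pos_bounded[OF matrix_vector_mul_bounded_linear[of A]] by blast
    have "poly_bounded (\<lambda>z. (1 + norm (\<mu> + A *v z)) ^ k)"
      unfolding poly_bounded_def
    proof (intro conjI exI allI)
      fix z :: "real^'p"
      have "1 + norm (\<mu> + A *v z) \<le> 1 + norm \<mu> + norm z * K"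
        using norm_triangle_ineq[of \<mu> "A *v z"] K(1)[of z] by simp
      also have "\<dots> \<le> (1 + norm \<mu> + K) * (1 + norm z)"
        using K(2) by (simp add: algebra_simps add_increasing add_increasing2)
      finally have "(1 + norm (\<mu> + A *v z)) ^ k \<le> ((1 + norm \<mu> + K) * (1 + norm z)) ^ k"
        by (intro power_mono) auto
      then show "\<bar>(1 + norm (\<mu> + A *v z)) ^ k\<bar> \<le> (1 + norm \<mu> + K) ^ k * (1 + norm z) ^ k"
        by (simp add: power_mult_distrib)
    qed measurable
    then show "integrable std_mvnormal (\<lambda>z. (1 + norm (\<mu> + A *v z)) ^ k)"
      by (rule integrable_std_mvnormal_poly)
  qed auto
  then show ?thesis by (simp add: has_all_moments_def)
qed

lemma iexp_mvnormal:
  fixes S :: "real^'p^'p"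
  assumes "covariance_matrix S"
  shows "(CLINT x|mvnormal 0 S. iexp (t \<bullet> x)) = complex_of_real (exp (- (t \<bullet> (S *v t)) / 2))"
proof -
  from mvnormal_factor[OF assms] obtain A :: "real^'p^'p" where A: "A ** transpose A = S"
    "\<And>\<mu>. mvnormal \<mu> S = distr std_mvnormal borel (\<lambda>z. \<mu> + A *v z)" by blast
  have "(CLINT x|mvnormal 0 S. iexp (t \<bullet> x)) = (CLINT z|std_mvnormal. iexp (t \<bullet> (0 + A *v z)))"
    unfolding A(2) by (subst integral_distr) measurable
  also have "\<dots> = complex_of_real (exp (- (norm (transpose A *v t))\<^sup>2 / 2))"
    by (simp only: inner_add_right inner_zero_right add_0_left inner_matrix_mult iexp_std_mvnormal)
  also have "(norm (transpose A *v t))\<^sup>2 = t \<bullet> (S *v t)"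
    unfolding power2_norm_eq_inner by (rule transpose_factor_inner[OF A(1)])
  finally show ?thesis .
qed

text \<open>The centre \<open>m\<close> is left free because the moments of a mixture are taken
  about the mixture mean, which is not the mean of either component.\<close>

lemma moment_mvnormal:
  fixes S :: "real^'p^'p"
  assumes "covariance_matrix S"
  shows "(\<integral>x. (v \<bullet> (x - m)) ^ k \<partial>mvnormal \<mu> S) =
    (\<Sum>i\<le>k. real (k choose i) * (v \<bullet> (\<mu> - m)) ^ (k - i) * (sqrt (v \<bullet> (S *v v)) ^ i * gauss_moment i))"
proof -
  from mvnormal_factor[OF assms] obtain A :: "real^'p^'p" where A: "A ** transpose A = S"
    "\<And>\<mu>. mvnormal \<mu> S = distr std_mvnormal borel (\<lambda>z. \<mu> + A *v z)" by blast
  let ?p = "transpose A *v v"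
  have "(\<integral>x. (v \<bullet> (x - m)) ^ k \<partial>mvnormal \<mu> S) = (\<integral>z. (v \<bullet> (\<mu> + A *v z - m)) ^ k \<partial>std_mvnormal)"
    unfolding A(2) by (subst integral_distr) measurable
  also have "\<dots> = (\<integral>z. (?p \<bullet> z + v \<bullet> (\<mu> - m)) ^ k \<partial>std_mvnormal)"
    by (simp only: inner_matrix_mult[symmetric] inner_simps) (simp add: algebra_simps)
  also have "\<dots> = (\<Sum>i\<le>k. (\<integral>z. real (k choose i) * (?p \<bullet> z) ^ i * (v \<bullet> (\<mu> - m)) ^ (k - i) \<partial>std_mvnormal))"
    unfolding binomial_ring
    by (intro Bochner_Integration.integral_sum integrable_std_mvnormal_poly poly_bounded_intros)
  also have "\<dots> = (\<Sum>i\<le>k. real (k choose i) * (v \<bullet> (\<mu> - m)) ^ (k - i) * (norm ?p ^ i * gauss_moment i))"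
    by (simp add: moment_std_mvnormal mult_ac)
  also have "norm ?p = sqrt (v \<bullet> (S *v v))"
    unfolding norm_eq_sqrt_inner transpose_factor_inner[OF A(1)] ..
  finally show ?thesis .
qed

text \<open>The two conditions act separately: orthogonality for \<open>S\<close> makes the
  transformed vectors orthogonal, and \<open>q \<bullet> (\<mu> - m) = 0\<close> removes the shift
  from the factor in \<open>q\<close>. The shift in \<open>p\<close> stays and is expanded
  binomially, the claims being applied term by term.\<close>

lemma mixed_moment_mvnormal:
  fixes S :: "real^'p^'p"
  assumes S: "covariance_matrix S" and orth: "p \<bullet> (S *v q) = 0" and q: "q \<bullet> (\<mu> - m) = 0"
  shows "(\<integral>x. (p \<bullet> (x - m)) ^ k * (q \<bullet> (x - m)) \<partial>mvnormal \<mu> S) = 0"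
    and "(\<integral>x. (p \<bullet> (x - m)) ^ k * (q \<bullet> (x - m))\<^sup>2 \<partial>mvnormal \<mu> S) =
      (\<integral>x. (p \<bullet> (x - m)) ^ k \<partial>mvnormal \<mu> S) * (q \<bullet> (S *v q))"
proof -
  from mvnormal_factor[OF S] obtain A :: "real^'p^'p" where A: "A ** transpose A = S"
    "\<And>\<mu>. mvnormal \<mu> S = distr std_mvnormal borel (\<lambda>z. \<mu> + A *v z)" by blast
  define p' q' where "p' = transpose A *v p" and "q' = transpose A *v q"
  let ?c = "p \<bullet> (\<mu> - m)"
  have pq: "p \<bullet> (A *v z) = p' \<bullet> z" "q \<bullet> (A *v z) = q' \<bullet> z" for z
    unfolding p'_def q'_def by (rule inner_matrix_mult)+
  have o: "p' \<bullet> q' = 0" using orth unfolding p'_def q'_def transpose_factor_inner[OF A(1)] .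
  have tr: "(\<integral>x. (p \<bullet> (x - m)) ^ k * (q \<bullet> (x - m)) ^ j \<partial>mvnormal \<mu> S) =
    (\<Sum>i\<le>k. real (k choose i) * ?c ^ (k - i) * (\<integral>z. (p' \<bullet> z) ^ i * (q' \<bullet> z) ^ j \<partial>std_mvnormal))" for j
  proof -
    have "(\<integral>x. (p \<bullet> (x - m)) ^ k * (q \<bullet> (x - m)) ^ j \<partial>mvnormal \<mu> S) =
      (\<integral>z. (p \<bullet> (\<mu> + A *v z - m)) ^ k * (q \<bullet> (\<mu> + A *v z - m)) ^ j \<partial>std_mvnormal)"
      unfolding A(2) by (subst integral_distr) measurable
    also have "\<dots> = (\<integral>z. (p' \<bullet> z + ?c) ^ k * (q' \<bullet> z) ^ j \<partial>std_mvnormal)"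
    proof (intro Bochner_Integration.integral_cong refl)
      fix z
      have "p \<bullet> (\<mu> + A *v z - m) = p' \<bullet> z + ?c" "q \<bullet> (\<mu> + A *v z - m) = q' \<bullet> z"
        using q by (simp_all add: pq inner_simps)
      then show "(p \<bullet> (\<mu> + A *v z - m)) ^ k * (q \<bullet> (\<mu> + A *v z - m)) ^ j = (p' \<bullet> z + ?c) ^ k * (q' \<bullet> z) ^ j"
        by simp
    qed
    also have "\<dots> = (\<integral>z. (\<Sum>i\<le>k. real (k choose i) * (p' \<bullet> z) ^ i * ?c ^ (k - i) * (q' \<bullet> z) ^ j) \<partial>std_mvnormal)"
      unfolding binomial_ring sum_distrib_right ..
    also have "\<dots> = (\<Sum>i\<le>k. (\<integral>z. real (k choose i) * (p' \<bullet> z) ^ i * ?c ^ (k - i) * (q' \<bullet> z) ^ j \<partial>std_mvnormal))"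
      by (intro Bochner_Integration.integral_sum integrable_std_mvnormal_poly poly_bounded_intros)
    also have "\<dots> = (\<Sum>i\<le>k. (\<integral>z. (real (k choose i) * ?c ^ (k - i)) * ((p' \<bullet> z) ^ i * (q' \<bullet> z) ^ j) \<partial>std_mvnormal))"
      by (simp only: mult_ac)
    finally show ?thesis by simp
  qed
  show "(\<integral>x. (p \<bullet> (x - m)) ^ k * (q \<bullet> (x - m)) \<partial>mvnormal \<mu> S) = 0"
    using tr[of 1] by (simp add: mixed_moment_std_mvnormal_1[OF o])
  have "(\<integral>x. (p \<bullet> (x - m)) ^ k * (q \<bullet> (x - m))\<^sup>2 \<partial>mvnormal \<mu> S) =
    (\<integral>x. (p \<bullet> (x - m)) ^ k * (q \<bullet> (x - m)) ^ 0 \<partial>mvnormal \<mu> S) * (norm q')\<^sup>2"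
    unfolding tr by (simp add: mixed_moment_std_mvnormal_2[OF o] sum_distrib_left mult_ac)
  then show "(\<integral>x. (p \<bullet> (x - m)) ^ k * (q \<bullet> (x - m))\<^sup>2 \<partial>mvnormal \<mu> S) =
      (\<integral>x. (p \<bullet> (x - m)) ^ k \<partial>mvnormal \<mu> S) * (q \<bullet> (S *v q))"
    unfolding power2_norm_eq_inner q'_def transpose_factor_inner[OF A(1)] by simp
qed

section \<open>Integrals against a mixture\<close>

lemma sets_mixture:
  assumes N: "prob_space N" "prob_space N'" and S: "sets N' = sets N"
  shows "sets (mixture a N N') = sets N"
proof -
  have *: "(\<lambda>b. if b then N else N') \<in> measurable (measure_pmf (bernoulli_pmf a)) (subprob_algebra N)"
    using N S by (auto simp: space_subprob_algebra prob_space_imp_subprob_space)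
  show ?thesis unfolding mixture_def by (rule sets_bind) (use S in auto)
qed

lemma nn_integral_mixture:
  assumes a: "0 \<le> a" "a \<le> 1" and N: "prob_space N" "prob_space N'"
    and S: "sets N' = sets N" and f: "f \<in> borel_measurable N"
  shows "(\<integral>\<^sup>+x. f x \<partial>mixture a N N') = ennreal a * (\<integral>\<^sup>+x. f x \<partial>N) + ennreal (1 - a) * (\<integral>\<^sup>+x. f x \<partial>N')"
proof -
  have *: "(\<lambda>b. if b then N else N') \<in> measurable (measure_pmf (bernoulli_pmf a)) (subprob_algebra N)"
    using N S by (auto simp: space_subprob_algebra prob_space_imp_subprob_space)
  show ?thesis
    unfolding mixture_def using a
    by (subst nn_integral_bind[OF f *]) (simp_all add: mult.commute)
qed

lemma
  fixes f :: "'b \<Rightarrow> real"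
  assumes a: "0 \<le> a" "a \<le> 1" and N: "prob_space N" "prob_space N'"
    and S: "sets N' = sets N" and f: "integrable N f" "integrable N' f"
  shows integrable_mixture: "integrable (mixture a N N') f"
    and integral_mixture: "(\<integral>x. f x \<partial>mixture a N N') = a * (\<integral>x. f x \<partial>N) + (1 - a) * (\<integral>x. f x \<partial>N')"
proof -
  have [measurable]: "f \<in> borel_measurable N" using f by simp
  have fin: "(\<integral>\<^sup>+x. ennreal (s * f x) \<partial>K) < \<infinity>" if "integrable K f" "\<bar>s\<bar> = 1" for s and K :: "'b measure"
  proof -
    have "(\<integral>\<^sup>+x. ennreal (s * f x) \<partial>K) \<le> (\<integral>\<^sup>+x. norm (s * f x) \<partial>K)"
      by (intro nn_integral_mono) (auto intro: ennreal_leI)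
    also have "\<dots> < \<infinity>" using that by (auto simp: integrable_iff_bounded abs_mult)
    finally show ?thesis .
  qed
  have "(\<integral>\<^sup>+x. norm (f x) \<partial>mixture a N N') < \<infinity>"
    using f by (subst nn_integral_mixture[OF a N S])
      (auto simp: integrable_iff_bounded ennreal_mult_less_top)
  moreover have "f \<in> borel_measurable (mixture a N N')"
    using sets_mixture[OF N S, of a] by (metis measurable_cong_sets \<open>f \<in> borel_measurable N\<close>)
  ultimately show i: "integrable (mixture a N N') f" by (simp add: integrable_iff_bounded)
  \<comment> \<open>With s = 1 and s = -1 these are the positive and the negative part, through
    which the identity for nonnegative integrals passes to real ones.\<close>
  have e: "enn2real (\<integral>\<^sup>+x. ennreal (s * f x) \<partial>mixture a N N') =
    a * enn2real (\<integral>\<^sup>+x. ennreal (s * f x) \<partial>N) + (1 - a) * enn2real (\<integral>\<^sup>+x. ennreal (s * f x) \<partial>N')" if "\<bar>s\<bar> = 1" for s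
    using a fin[OF f(1) that] fin[OF f(2) that]
    by (subst nn_integral_mixture[OF a N S])
      (auto simp: enn2real_plus enn2real_mult ennreal_mult_less_top)
  show "(\<integral>x. f x \<partial>mixture a N N') = a * (\<integral>x. f x \<partial>N) + (1 - a) * (\<integral>x. f x \<partial>N')"
    unfolding real_lebesgue_integral_def[OF i] real_lebesgue_integral_def[OF f(1)] real_lebesgue_integral_def[OF f(2)]
    using e[of 1] e[of "-1"] by (simp add: right_diff_distrib)
qed

lemma has_all_moments_mixture:
  fixes N N' :: "'b::euclidean_space measure"
  assumes a: "0 \<le> a" "a \<le> 1" and N: "prob_space N" "prob_space N'"
    and m: "has_all_moments N" "has_all_moments N'"
  shows "has_all_moments (mixture a N N')"
proof -
  have S: "sets N' = sets N" using m by (simp add: has_all_moments_def)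
  show ?thesis
    using m sets_mixture[OF N S, of a] integrable_mixture[OF a N S]
    unfolding has_all_moments_def by auto
qed

section \<open>Convergence in distribution through characteristic functions\<close>

text \<open>The inductive form reduces convergence of integrals to single exponentials. Complex
  coefficients let sines be written as exponentials, and products stay in the class because
  frequencies add.\<close>

inductive trig_poly :: "('b::real_inner \<Rightarrow> complex) \<Rightarrow> bool" where
  trig_poly_iexp: "trig_poly (\<lambda>y. c * iexp (t \<bullet> y))"
| trig_poly_add: "trig_poly f \<Longrightarrow> trig_poly g \<Longrightarrow> trig_poly (\<lambda>y. f y + g y)"

lemma trig_poly_const: "trig_poly (\<lambda>_. c)"
  using trig_poly_iexp[of c 0] by simp

lemma trig_poly_mult:
  assumes "trig_poly f" "trig_poly g"
  shows "trig_poly (\<lambda>y. f y * g y)"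
  using assms
proof (induction f rule: trig_poly.induct)
  case (trig_poly_iexp c t)
  from trig_poly_iexp show ?case
  proof (induction g rule: trig_poly.induct)
    case (trig_poly_iexp d s)
    have "(\<lambda>y. c * iexp (t \<bullet> y) * (d * iexp (s \<bullet> y))) = (\<lambda>y. (c * d) * iexp ((t + s) \<bullet> y))"
      by (simp add: inner_add_left exp_add distrib_left mult_ac)
    then show ?case by (metis trig_poly.trig_poly_iexp)
  next
    case (trig_poly_add f g)
    then show ?case by (simp add: distrib_left trig_poly.trig_poly_add)
  qed
next
  case (trig_poly_add f h)
  then show ?case by (simp add: distrib_right trig_poly.trig_poly_add)
qed

lemma trig_poly_sum:
  assumes "\<And>i. i \<in> I \<Longrightarrow> trig_poly (f i)"
  shows "trig_poly (\<lambda>y. \<Sum>i\<in>I. f i y)"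
  using assms by (induction I rule: infinite_finite_induct) (auto intro: trig_poly_const trig_poly_add)

lemma trig_poly_sin: "trig_poly (\<lambda>y. complex_of_real (sin (t \<bullet> y)))"
proof -
  have "complex_of_real (sin (t \<bullet> y)) = (1 / (2 * \<i>)) * iexp (t \<bullet> y) + (- 1 / (2 * \<i>)) * iexp ((- t) \<bullet> y)" for y
    unfolding sin_of_real[symmetric] sin_exp_eq by (simp add: field_simps)
  then show ?thesis by (simp only: trig_poly_add trig_poly_iexp)
qed

lemma integrable_trig_poly:
  fixes N :: "'b::euclidean_space measure"
  assumes "prob_space N" and [measurable_cong, simp]: "sets N = sets borel" and f: "trig_poly f"
  shows "integrable N f"
  using f
proof (induction f rule: trig_poly.induct)
  case (trig_poly_iexp c t)
  interpret prob_space N by fact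
  have "integrable N (\<lambda>y. iexp (t \<bullet> y))"
    by (rule integrable_iexp) measurable
  then show ?case by simp
qed auto

lemma trig_poly_integral_tendsto:
  fixes N :: "nat \<Rightarrow> 'b::euclidean_space measure"
  assumes N: "\<And>n. prob_space (N n)" "\<And>n. sets (N n) = sets borel"
    and L: "prob_space L" "sets L = sets borel"
    and char: "\<And>t. (\<lambda>n. CLINT y|N n. iexp (t \<bullet> y)) \<longlonglongrightarrow> (CLINT y|L. iexp (t \<bullet> y))"
    and f: "trig_poly f"
  shows "(\<lambda>n. CLINT y|N n. f y) \<longlonglongrightarrow> (CLINT y|L. f y)"
  using f
proof (induction f rule: trig_poly.induct)
  case (trig_poly_iexp c t)
  show ?case using tendsto_mult_left[OF char] by simp
next
  case (trig_poly_add f g)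
  then show ?case
    using integrable_trig_poly[OF N] integrable_trig_poly[OF L] by (simp add: tendsto_add)
qed

text \<open>Induction over polynomials leaves the linear case, where \<open>g\<close> becomes a
  combination of the functions \<open>sin (c * y $ i)\<close>, each a difference of two
  exponentials.\<close>

lemma real_polynomial_sin_trig_poly:
  fixes g :: "real^'p \<Rightarrow> real"
  assumes "real_polynomial_function g"
  shows "trig_poly (\<lambda>y::real^'p. complex_of_real (g (\<chi> i. sin (c * y $ i))))"
  using assms
proof (induction g rule: real_polynomial_function.induct)
  case (linear g)
  have "g (\<chi> i. sin (c * y $ i)) = (\<Sum>i\<in>UNIV. g (axis i 1) * sin ((c *\<^sub>R axis i 1) \<bullet> y))" for y :: "real^'p"
  proof -
    interpret bounded_linear g by fact
    have "(\<chi> i. sin (c * y $ i)) = (\<Sum>i\<in>UNIV. sin (c * y $ i) *\<^sub>R axis i (1::real))"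
      by (simp add: vec_eq_iff axis_def if_distrib cong: if_cong)
    then show ?thesis by (simp add: sum scaleR mult.commute inner_axis')
  qed
  then show ?case
    by (simp only: of_real_sum of_real_mult) (intro trig_poly_sum trig_poly_mult trig_poly_const trig_poly_sin)
qed (simp_all add: trig_poly_const trig_poly_add trig_poly_mult)

lemma markov_norm:
  fixes N :: "'b::euclidean_space measure"
  assumes "prob_space N" and sets: "sets N = sets borel" and int: "integrable N norm"
    and K: "(\<integral>y. norm y \<partial>N) \<le> K" and R: "R > 0"
  shows "measure N {y. R < norm y} \<le> K / R"
proof -
  interpret prob_space N by fact
  have sp: "space N = UNIV" using sets_eq_imp_space_eq[OF sets] by simp
  have "{y. R < norm y} \<in> sets N" unfolding sets by measurable
  then have "measure N {y. R < norm y} = (\<integral>y. indicator {y. R < norm y} y \<partial>N)" by (simp add: sp)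
  also have "\<dots> \<le> (\<integral>y. norm y / R \<partial>N)"
  proof (intro integral_mono)
    show "integrable N (indicator {y. R < norm y} :: _ \<Rightarrow> real)"
      using \<open>{y. R < norm y} \<in> sets N\<close> by (intro integrable_real_indicator) (auto simp: less_top[symmetric])
    show "integrable N (\<lambda>y. norm y / R)" using int by simp
    fix y show "indicator {y. R < norm y} y \<le> norm y / R" using R by (auto simp: indicator_def)
  qed
  also have "\<dots> \<le> K / R" using K R by (simp add: divide_right_mono)
  finally show ?thesis .
qed

text \<open>
  On the cube \<open>|y $ i| \<le> R\<close> the function \<open>f\<close> equals \<open>F\<close> of the vector of \<open>sin (y $ i / R)\<close>, with
  \<open>F\<close> continuous on \<open>[-1,1]\<^sup>p\<close>. A polynomial uniformly close to \<open>F\<close> there becomes a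
  trigonometric polynomial that is close to \<open>f\<close> on the cube and bounded everywhere.
\<close>

lemma trig_poly_approx:
  fixes f :: "real^'p \<Rightarrow> real"
  assumes f: "continuous_on UNIV f" and B: "\<And>y. \<bar>f y\<bar> \<le> B" and R: "R > 0" and e: "e > 0"
  obtains k where "trig_poly (\<lambda>y. complex_of_real (k y))" "k \<in> borel_measurable borel"
    "\<And>y. \<bar>f y - k y\<bar> \<le> e + 2 * B * indicator {y. R < norm y} y"
proof -
  define F where "F w = f (\<chi> i. R * arcsin (w $ i))" for w :: "real^'p"
  let ?K = "cbox (- 1) (1 :: real^'p)"
  have in_K: "(\<chi> i. sin (y $ i / R)) \<in> ?K" for y :: "real^'p"
    by (simp add: mem_box_cart)
  have "continuous_on ?K F"
    unfolding F_def
  proof (rule continuous_on_compose2[OF f])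
    show "continuous_on ?K (\<lambda>w. \<chi> i. R * arcsin (w $ i))"
    proof (intro continuous_on_vec_lambda continuous_intros ballI)
      fix i and x :: "real^'p" assume "x \<in> ?K"
      then show "- 1 \<le> x $ i \<and> x $ i \<le> 1" by (simp add: mem_box_cart)
    qed
  qed auto
  from Stone_Weierstrass_real_polynomial_function[OF compact_cbox this e]
  obtain g where g: "real_polynomial_function g" "\<And>x. x \<in> ?K \<Longrightarrow> \<bar>F x - g x\<bar> < e" by blast
  define k where "k y = g (\<chi> i. sin (1 / R * y $ i))" for y :: "real^'p"
  have near: "\<bar>F (\<chi> i. sin (1 / R * y $ i)) - k y\<bar> < e" for y :: "real^'p"
    unfolding k_def by (intro g(2)) (use in_K[of y] in simp)
  have "\<bar>f y - k y\<bar> \<le> e + 2 * B * indicator {y. R < norm y} y" for y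
  proof (cases "R < norm y")
    case False
    \<comment> \<open>Inside the ball each argument of the sine lies in [-1, 1], where
      \<open>arcsin\<close> inverts it because 1 < pi / 2.\<close>
    have "arcsin (sin (1 / R * y $ i)) = 1 / R * y $ i" for i
    proof -
      have "\<bar>y $ i\<bar> \<le> R" using component_le_norm_cart[of y i] False by simp
      then have "\<bar>1 / R * y $ i\<bar> \<le> 1" using R by (simp add: abs_mult)
      then show ?thesis unfolding abs_le_iff using pi_gt3 by (intro arcsin_sin) linarith+
    qed
    then have "F (\<chi> i. sin (1 / R * y $ i)) = f y" using R by (simp add: F_def)
    then show ?thesis using near[of y] False by simp
  next
    case True
    \<comment> \<open>Outside the ball \<open>k\<close> is still close to \<open>F\<close>, and
      \<open>F\<close> takes only values of \<open>f\<close>, which are bounded by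
      \<open>B\<close>.\<close>
    have "\<bar>f y - k y\<bar> \<le> \<bar>f y\<bar> + \<bar>F (\<chi> i. sin (1 / R * y $ i))\<bar> + \<bar>F (\<chi> i. sin (1 / R * y $ i)) - k y\<bar>" by linarith
    also have "\<dots> \<le> B + B + e" unfolding F_def using near[of y, unfolded F_def] by (intro add_mono B) simp
    finally show ?thesis using True by simp
  qed
  moreover have "trig_poly (\<lambda>y. complex_of_real (k y))"
    unfolding k_def by (rule real_polynomial_sin_trig_poly[OF g(1)])
  moreover have "k \<in> borel_measurable borel"
  proof (intro borel_measurable_continuous_onI)
    have "continuous_on UNIV g"
      by (simp add: continuous_on_eq_continuous_at continuous_real_polymonial_function[OF g(1)])
    then show "continuous_on UNIV k" unfolding k_def
      by (rule continuous_on_compose2) (use R in \<open>auto intro!: continuous_on_vec_lambda continuous_intros\<close>)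
  qed
  ultimately show ?thesis using that by blast
qed

text \<open>Trigonometric polynomials approximate \<open>f\<close> only on balls. Tightness, with
  one radius for the limit and for eventually all \<open>N n\<close>, bounds the contribution of the
  complement by 2 B times its mass.\<close>

lemma weakly_converges_char:
  fixes N :: "nat \<Rightarrow> (real^'p) measure" and L :: "(real^'p) measure"
  assumes N: "\<And>n. prob_space (N n)" "\<And>n. sets (N n) = sets borel"
    and L: "prob_space L" "sets L = sets borel"
    and tight: "\<And>e. e > 0 \<Longrightarrow> \<exists>R>0. measure L {y. R < norm y} \<le> e \<and> (\<forall>\<^sub>F n in sequentially. measure (N n) {y. R < norm y} \<le> e)"
    and char: "\<And>t. (\<lambda>n. CLINT y|N n. iexp (t \<bullet> y)) \<longlonglongrightarrow> (CLINT y|L. iexp (t \<bullet> y))"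
  shows "weakly_converges N L"
  unfolding weakly_converges_def
proof (intro allI impI)
  fix f :: "real^'p \<Rightarrow> real"
  assume f: "continuous_on UNIV f \<and> bounded (range f)"
  then obtain B where B: "\<And>y. \<bar>f y\<bar> \<le> B" "B > 0"
    by (auto simp: bounded_pos)
  have [measurable]: "f \<in> borel_measurable borel"
    using f by (intro borel_measurable_continuous_onI) auto
  have key: "\<bar>(\<integral>y. f y \<partial>K) - (\<integral>y. k y \<partial>K)\<bar> \<le> e + 2 * B * d"
    if K: "prob_space K" "sets K = sets borel" and k: "trig_poly (\<lambda>y. complex_of_real (k y))" "k \<in> borel_measurable borel"
      "\<And>y. \<bar>f y - k y\<bar> \<le> e + 2 * B * indicator {y. R < norm y} y" and d: "measure K {y. R < norm y} \<le> d"
    for K k e R d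
  proof -
    interpret prob_space K by fact
    have sp: "space K = UNIV" using sets_eq_imp_space_eq[OF K(2)] by simp
    have S: "{y. R < norm y} \<in> sets K" unfolding K(2) by measurable
    have iS: "integrable K (indicator {y. R < norm y} :: _ \<Rightarrow> real)"
      using S by (intro integrable_real_indicator) (auto simp: less_top[symmetric])
    have "integrable K f"
      by (rule integrable_const_bound[of _ B]) (use B(1) K(2) in \<open>auto cong: measurable_cong_sets\<close>)
    moreover have ik: "integrable K k"
      using integrable_trig_poly[OF K k(1)] by (metis complex_of_real_integrable_eq)
    ultimately have "\<bar>(\<integral>y. f y \<partial>K) - (\<integral>y. k y \<partial>K)\<bar> = \<bar>\<integral>y. f y - k y \<partial>K\<bar>" by simp
    also have "\<dots> \<le> (\<integral>y. \<bar>f y - k y\<bar> \<partial>K)" by (rule integral_abs_bound)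
    also have "\<dots> \<le> (\<integral>y. e + 2 * B * indicator {y. R < norm y} y \<partial>K)"
      using \<open>integrable K f\<close> ik iS by (intro integral_mono k(3)) auto
    also have "\<dots> = e + 2 * B * measure K {y. R < norm y}"
      using iS S by (simp add: sp prob_space[unfolded sp])
    also have "\<dots> \<le> e + 2 * B * d" using d B by simp
    finally show ?thesis .
  qed
  show "(\<lambda>n. \<integral>y. f y \<partial>N n) \<longlonglongrightarrow> (\<integral>y. f y \<partial>L)"
  proof (rule tendstoI)
    fix e0 :: real assume "e0 > 0"
    \<comment> \<open>Replacing \<open>f\<close> by \<open>k\<close> costs at most
      \<open>e + 2 * B * d\<close>, three eighths of \<open>e0\<close>, under each of the two
      measures, and the integrals of \<open>k\<close> differ by less than a quarter of
      \<open>e0\<close>; the total is below \<open>e0\<close>.\<close>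
    define e where "e = e0 / 4"
    define d where "d = e0 / (16 * B)"
    have ed: "e > 0" "d > 0" "e + 2 * B * d = 3 * e0 / 8"
      using \<open>e0 > 0\<close> B(2) by (auto simp: e_def d_def field_simps)
    from tight[OF ed(2)] obtain R where R: "R > 0" "measure L {y. R < norm y} \<le> d"
      "\<forall>\<^sub>F n in sequentially. measure (N n) {y. R < norm y} \<le> d" by blast
    obtain k where k: "trig_poly (\<lambda>y. complex_of_real (k y))" "k \<in> borel_measurable borel"
      "\<And>y. \<bar>f y - k y\<bar> \<le> e + 2 * B * indicator {y. R < norm y} y"
      using trig_poly_approx[OF conjunct1[OF f] B(1) R(1) ed(1)] by blast
    have "(\<lambda>n. complex_of_real (\<integral>y. k y \<partial>N n)) \<longlonglongrightarrow> complex_of_real (\<integral>y. k y \<partial>L)"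
      using trig_poly_integral_tendsto[OF N L char k(1)] by simp
    then have "(\<lambda>n. \<integral>y. k y \<partial>N n) \<longlonglongrightarrow> (\<integral>y. k y \<partial>L)"
      by (simp only: tendsto_of_real_iff)
    then have "\<forall>\<^sub>F n in sequentially. dist (\<integral>y. k y \<partial>N n) (\<integral>y. k y \<partial>L) < e0 / 4"
      using \<open>e0 > 0\<close> by (intro tendstoD) auto
    with R(3) show "\<forall>\<^sub>F n in sequentially. dist (\<integral>y. f y \<partial>N n) (\<integral>y. f y \<partial>L) < e0"
    proof eventually_elim
      case (elim n)
      from key[OF N k elim(1)] key[OF L k R(2)] elim(2) show ?case
        unfolding dist_real_def ed(3) using \<open>e0 > 0\<close> by linarith
    qed
  qed
qed

text \<open>The bound in \<open>small\<close> holds from an index that depends on \<omega>, so it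
  cannot be integrated directly. The excess of \<open>min 1 (R n \<omega>)\<close> over
  \<open>e * W n \<omega>\<close> is at most 1 and vanishes eventually on almost every path;
  dominated convergence disposes of it, and the rest costs at most \<open>e * K\<close>. The
  truncation at 1 supplies the dominating function, since \<open>R n\<close> is not assumed
  integrable.\<close>

lemma expectation_min_tendsto_0:
  fixes R W :: "nat \<Rightarrow> 'a \<Rightarrow> real"
  assumes "prob_space M"
    and [measurable]: "\<And>n. R n \<in> borel_measurable M" and R: "\<And>n \<omega>. 0 \<le> R n \<omega>"
    and W: "\<And>n. integrable M (W n)" "\<And>n \<omega>. 0 \<le> W n \<omega>" and K: "\<And>n. (\<integral>\<omega>. W n \<omega> \<partial>M) \<le> K"
    and small: "\<And>e. e > 0 \<Longrightarrow> AE \<omega> in M. \<forall>\<^sub>F n in sequentially. R n \<omega> \<le> e * W n \<omega>"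
  shows "(\<lambda>n. \<integral>\<omega>. min 1 (R n \<omega>) \<partial>M) \<longlonglongrightarrow> 0"
proof (rule tendstoI)
  interpret prob_space M by fact
  have [measurable]: "W n \<in> borel_measurable M" for n using W by auto
  have "0 \<le> K" using order_trans[OF Bochner_Integration.integral_nonneg[OF W(2)] K[of 0]] .
  fix e0 :: real assume "e0 > 0"
  define e where "e = e0 / (2 * (K + 1))"
  have e: "e > 0" "e * K \<le> e0 / 2"
    using \<open>e0 > 0\<close> \<open>0 \<le> K\<close> by (auto simp: e_def field_simps)
  let ?V = "\<lambda>n \<omega>. max 0 (min 1 (R n \<omega>) - e * W n \<omega>)"
  have V1: "\<bar>?V n \<omega>\<bar> \<le> 1" for n \<omega>
  proof -
    have "0 \<le> e * W n \<omega>" using e W(2)[of n \<omega>] by simp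
    then show ?thesis by (auto simp: min_def max_def)
  qed
  have "(\<lambda>n. \<integral>\<omega>. ?V n \<omega> \<partial>M) \<longlonglongrightarrow> (\<integral>\<omega>. 0 \<partial>M)"
  proof (rule integral_dominated_convergence[where w="\<lambda>_. 1"])
    show "AE \<omega> in M. (\<lambda>n. ?V n \<omega>) \<longlonglongrightarrow> 0"
      using small[OF e(1)]
    proof eventually_elim
      case (elim \<omega>)
      then have "\<forall>\<^sub>F n in sequentially. ?V n \<omega> = 0"
        by eventually_elim auto
      then show ?case by (simp add: tendsto_eventually)
    qed
  qed (use V1 in auto)
  then have "\<forall>\<^sub>F n in sequentially. (\<integral>\<omega>. ?V n \<omega> \<partial>M) < e0 / 2"
    using \<open>e0 > 0\<close> by (intro order_tendstoD(2)[of _ 0]) simp_all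
  then show "\<forall>\<^sub>F n in sequentially. dist (\<integral>\<omega>. min 1 (R n \<omega>) \<partial>M) 0 < e0"
  proof eventually_elim
    case (elim n)
    have iV: "integrable M (?V n)"
      by (rule integrable_const_bound[of _ 1]) (use V1 in auto)
    have iR: "integrable M (\<lambda>\<omega>. min 1 (R n \<omega>))"
      by (rule integrable_const_bound[of _ 1]) (use R in auto)
    have "(\<integral>\<omega>. min 1 (R n \<omega>) \<partial>M) \<le> (\<integral>\<omega>. ?V n \<omega> + e * W n \<omega> \<partial>M)"
      using iV iR W(1)[of n] by (intro integral_mono) auto
    also have "\<dots> = (\<integral>\<omega>. ?V n \<omega> \<partial>M) + e * (\<integral>\<omega>. W n \<omega> \<partial>M)"
      using iV W(1)[of n] by simp
    also have "e * (\<integral>\<omega>. W n \<omega> \<partial>M) \<le> e0 / 2"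
      using mult_left_mono[OF K[of n], of e] e by linarith
    finally have "(\<integral>\<omega>. min 1 (R n \<omega>) \<partial>M) < e0" using elim by linarith
    moreover have "0 \<le> (\<integral>\<omega>. min 1 (R n \<omega>) \<partial>M)" using R by (intro Bochner_Integration.integral_nonneg) auto
    ultimately show ?case by simp
  qed
qed

lemma norm_iexp_diff_le: "cmod (iexp a - iexp b) \<le> \<bar>a - b\<bar>"
proof -
  have "iexp a - iexp b = iexp b * (iexp (a - b) - 1)"
    by (simp add: exp_diff[symmetric] right_diff_distrib exp_add[symmetric])
  also have "cmod \<dots> = cmod (iexp (a - b) - 1)" by (simp add: norm_mult)
  also have "\<dots> \<le> \<bar>a - b\<bar>" using iexp_approx1[of "a - b" 0] by simp
  finally show ?thesis .
qed

text \<open>A form of Slutsky's lemma: \<open>diff\<close> expresses convergence in probability of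
  the difference. Tightness comes from the first moments of \<open>Y\<close> by Markov's inequality,
  because no moments of \<open>Y'\<close> are assumed.\<close>

lemma converges_in_distribution_perturbed:
  fixes Y Y' :: "nat \<Rightarrow> 'a \<Rightarrow> real^'p" and L :: "(real^'p) measure"
  assumes M: "prob_space M" and Y [measurable]: "\<And>n. Y n \<in> borel_measurable M"
    and Y' [measurable]: "\<And>n. Y' n \<in> borel_measurable M"
    and L: "prob_space L" "sets L = sets borel" "integrable L norm"
    and int: "\<And>n. integrable M (\<lambda>\<omega>. norm (Y n \<omega>))" and K: "\<And>n. (\<integral>\<omega>. norm (Y n \<omega>) \<partial>M) \<le> K"
    and char: "\<And>t. (\<lambda>n. CLINT \<omega>|M. iexp (t \<bullet> Y n \<omega>)) \<longlonglongrightarrow> (CLINT y|L. iexp (t \<bullet> y))"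
    and diff: "(\<lambda>n. \<integral>\<omega>. min 1 (norm (Y' n \<omega> - Y n \<omega>)) \<partial>M) \<longlonglongrightarrow> 0"
  shows "converges_in_distribution M Y' L"
  unfolding converges_in_distribution_def
proof (rule weakly_converges_char)
  interpret prob_space M by fact
  show "prob_space (distr M borel (Y' n))" for n by (rule prob_space_distr) measurable
  have iD: "integrable M (\<lambda>\<omega>. min 1 (norm (Y' n \<omega> - Y n \<omega>)))" for n
    by (rule integrable_const_bound[of _ 1]) auto
  show "(\<lambda>n. CLINT y|distr M borel (Y' n). iexp (t \<bullet> y)) \<longlonglongrightarrow> (CLINT y|L. iexp (t \<bullet> y))" for t
  proof -
    have bound: "cmod ((CLINT \<omega>|M. iexp (t \<bullet> Y' n \<omega>)) - (CLINT \<omega>|M. iexp (t \<bullet> Y n \<omega>))) \<le>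
      (2 + norm t) * (\<integral>\<omega>. min 1 (norm (Y' n \<omega> - Y n \<omega>)) \<partial>M)" for n
    proof -
      have i: "integrable M (\<lambda>\<omega>. iexp (t \<bullet> Y' n \<omega>))" "integrable M (\<lambda>\<omega>. iexp (t \<bullet> Y n \<omega>))"
        by (rule integrable_iexp; measurable)+
      then have "cmod ((CLINT \<omega>|M. iexp (t \<bullet> Y' n \<omega>)) - (CLINT \<omega>|M. iexp (t \<bullet> Y n \<omega>))) =
        cmod (CLINT \<omega>|M. iexp (t \<bullet> Y' n \<omega>) - iexp (t \<bullet> Y n \<omega>))" by simp
      also have "\<dots> \<le> (\<integral>\<omega>. cmod (iexp (t \<bullet> Y' n \<omega>) - iexp (t \<bullet> Y n \<omega>)) \<partial>M)"
        by (rule integral_norm_bound)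
      also have "\<dots> \<le> (\<integral>\<omega>. (2 + norm t) * min 1 (norm (Y' n \<omega> - Y n \<omega>)) \<partial>M)"
      proof (intro integral_mono)
        fix \<omega>
        let ?d = "norm (Y' n \<omega> - Y n \<omega>)"
        have "cmod (iexp (t \<bullet> Y' n \<omega>) - iexp (t \<bullet> Y n \<omega>)) \<le> norm t * ?d"
          using order_trans[OF norm_iexp_diff_le Cauchy_Schwarz_ineq2[of t "Y' n \<omega> - Y n \<omega>", unfolded inner_diff_right]] .
        moreover have "cmod (iexp (t \<bullet> Y' n \<omega>) - iexp (t \<bullet> Y n \<omega>)) \<le> 2"
          using norm_triangle_ineq4[of "iexp (t \<bullet> Y' n \<omega>)" "iexp (t \<bullet> Y n \<omega>)"] by simp
        moreover have "0 \<le> norm t" "0 \<le> ?d" by auto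
        \<comment> \<open>The summand 2 serves differences of norm at least 1, where two unimodular
          numbers are compared trivially; together with \<open>norm t\<close> it also covers smaller
          ones by the Lipschitz estimate.\<close>
        moreover have "c \<le> (2 + a) * min 1 d" if "c \<le> a * d" "c \<le> 2" "0 \<le> a" "0 \<le> d" for a c d :: real
        proof (cases "1 \<le> d")
          case True then show ?thesis using that by simp
        next
          case False
          have "c \<le> 2 * d + a * d" using that by (intro order_trans[OF that(1)]) simp
          then show ?thesis using False by (simp add: distrib_right)
        qed
        ultimately show "cmod (iexp (t \<bullet> Y' n \<omega>) - iexp (t \<bullet> Y n \<omega>)) \<le> (2 + norm t) * min 1 ?d"
          by blast
      qed (use i iD in auto)
      finally show ?thesis by simp
    qed
    have lim: "(\<lambda>n. (2 + norm t) * (\<integral>\<omega>. min 1 (norm (Y' n \<omega> - Y n \<omega>)) \<partial>M)) \<longlonglongrightarrow> 0"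
      using tendsto_mult_right_zero[OF diff] .
    have "(\<lambda>n. (CLINT \<omega>|M. iexp (t \<bullet> Y' n \<omega>)) - (CLINT \<omega>|M. iexp (t \<bullet> Y n \<omega>))) \<longlonglongrightarrow> 0"
      by (rule Lim_null_comparison[OF always_eventually lim]) (rule allI, rule bound)
    from tendsto_add[OF this char[of t]]
    have "(\<lambda>n. CLINT \<omega>|M. iexp (t \<bullet> Y' n \<omega>)) \<longlonglongrightarrow> (CLINT y|L. iexp (t \<bullet> y))" by simp
    also have "(\<lambda>n. CLINT \<omega>|M. iexp (t \<bullet> Y' n \<omega>)) = (\<lambda>n. CLINT y|distr M borel (Y' n). iexp (t \<bullet> y))"
      by (intro ext, subst integral_distr) auto
    finally show ?thesis .
  qed
  fix e :: real assume "e > 0"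
  \<comment> \<open>Large enough that both first moments divided by \<open>R\<close> are at most
    \<open>e / 2\<close>; in the bound for \<open>Y'\<close> the other half of \<open>e\<close> is
    left for the perturbation.\<close>
  define R where "R = 2 * (\<bar>K\<bar> + (\<integral>y. norm y \<partial>L) + 1) / e + 1"
  have L0: "0 \<le> (\<integral>y. norm y \<partial>L)" by (intro Bochner_Integration.integral_nonneg) auto
  have R: "R > 0" "K / R \<le> e / 2" "(\<integral>y. norm y \<partial>L) / R \<le> e / 2"
  proof -
    have R1: "2 * (\<bar>K\<bar> + (\<integral>y. norm y \<partial>L) + 1) / e \<le> R" by (simp add: R_def)
    show "R > 0" using L0 \<open>e > 0\<close> by (simp add: R_def add_nonneg_pos)
    have "\<bar>K\<bar> + (\<integral>y. norm y \<partial>L) + 1 \<le> R * e / 2" using R1 \<open>e > 0\<close> by (simp add: field_simps)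
    then have "K \<le> R * e / 2" "(\<integral>y. norm y \<partial>L) \<le> R * e / 2" using L0 by linarith+
    then show "K / R \<le> e / 2" "(\<integral>y. norm y \<partial>L) / R \<le> e / 2" using \<open>R > 0\<close> by (auto simp: field_simps)
  qed
  have "measure L {y. R + 1 < norm y} \<le> measure L {y. R < norm y}"
    by (intro finite_measure.finite_measure_mono prob_space.finite_measure L) (auto simp: L)
  also have "\<dots> \<le> (\<integral>y. norm y \<partial>L) / R" by (rule markov_norm[OF L order_refl R(1)])
  also have "\<dots> \<le> e" using R(3) \<open>e > 0\<close> by linarith
  finally have L1: "measure L {y. R + 1 < norm y} \<le> e" .
  have "\<forall>\<^sub>F n in sequentially. (\<integral>\<omega>. min 1 (norm (Y' n \<omega> - Y n \<omega>)) \<partial>M) < e / 2"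
    using \<open>e > 0\<close> by (intro order_tendstoD(2)[OF diff]) simp
  then have "\<forall>\<^sub>F n in sequentially. measure (distr M borel (Y' n)) {y. R + 1 < norm y} \<le> e"
  proof eventually_elim
    case (elim n)
    have iI: "integrable M (indicator {\<omega> \<in> space M. R + 1 < norm (Y' n \<omega>)} :: _ \<Rightarrow> real)"
      by (intro integrable_real_indicator) (measurable, simp add: less_top[symmetric])
    have "measure (distr M borel (Y' n)) {y. R + 1 < norm y} = measure M {\<omega> \<in> space M. R + 1 < norm (Y' n \<omega>)}"
      by (subst measure_distr) (auto intro!: arg_cong[where f="measure M"])
    also have "\<dots> = (\<integral>\<omega>. indicator {\<omega> \<in> space M. R + 1 < norm (Y' n \<omega>)} \<omega> \<partial>M)" by simp
    also have "\<dots> \<le> (\<integral>\<omega>. norm (Y n \<omega>) / R + min 1 (norm (Y' n \<omega> - Y n \<omega>)) \<partial>M)"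
    proof (intro integral_mono)
      fix \<omega>
      have n: "norm (Y' n \<omega>) \<le> norm (Y n \<omega>) + norm (Y' n \<omega> - Y n \<omega>)"
        using norm_triangle_ineq[of "Y n \<omega>" "Y' n \<omega> - Y n \<omega>"] by simp
      \<comment> \<open>Past radius \<open>R + 1\<close> either \<open>Y n\<close> has norm at least
        \<open>R\<close>, or the perturbation is at least 1 and its truncation equals 1. This is why
        the radius is enlarged by 1.\<close>
      have "1 \<le> norm (Y n \<omega>) / R + min 1 (norm (Y' n \<omega> - Y n \<omega>))" if *: "R + 1 < norm (Y' n \<omega>)"
      proof (cases "norm (Y n \<omega>) < R")
        case True
        then have "1 \<le> norm (Y' n \<omega> - Y n \<omega>)" using n * by linarith
        then show ?thesis using R(1) by simp
      next
        case False
        then have "1 \<le> norm (Y n \<omega>) / R" using R(1) by simp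
        then show ?thesis by (simp add: add_increasing2)
      qed
      then show "indicator {\<omega> \<in> space M. R + 1 < norm (Y' n \<omega>)} \<omega> \<le> norm (Y n \<omega>) / R + min 1 (norm (Y' n \<omega> - Y n \<omega>))"
        using R(1) by (auto simp: indicator_def)
    qed (use int iD iI in auto)
    also have "\<dots> \<le> K / R + (\<integral>\<omega>. min 1 (norm (Y' n \<omega> - Y n \<omega>)) \<partial>M)"
      using int iD K[of n] R(1) by (simp add: divide_right_mono)
    also have "\<dots> \<le> e" using elim R(2) by linarith
    finally show ?case .
  qed
  with L1 show "\<exists>R>0. measure L {y. R < norm y} \<le> e \<and>
      (\<forall>\<^sub>F n in sequentially. measure (distr M borel (Y' n)) {y. R < norm y} \<le> e)"
    using R(1) by (intro exI[of _ "R + 1"]) auto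
qed (use L in auto)

section \<open>Limit theorems for i.i.d. samples\<close>

context prob_space
begin

section \<open>A strong law from fourth moments\<close>

lemma integrable_power_le_4:
  fixes f :: "'a \<Rightarrow> real"
  assumes [measurable]: "f \<in> borel_measurable M" and int: "integrable M (\<lambda>x. f x ^ 4)" and j: "j \<le> 4"
  shows "integrable M (\<lambda>x. f x ^ j)"
proof (rule Bochner_Integration.integrable_bound)
  show "integrable M (\<lambda>x. 1 + f x ^ 4)" using int by simp
  show "AE x in M. norm (f x ^ j) \<le> norm (1 + f x ^ 4)"
  proof (rule AE_I2)
    fix x
    have "\<bar>f x\<bar> ^ j \<le> 1 + \<bar>f x\<bar> ^ 4"
    proof (cases "\<bar>f x\<bar> \<le> 1")
      case True
      then have "\<bar>f x\<bar> ^ j \<le> 1" by (intro power_le_one) auto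
      then show ?thesis by (simp add: add_increasing2)
    next
      case False
      then have "\<bar>f x\<bar> ^ j \<le> \<bar>f x\<bar> ^ 4" using j by (intro power_increasing) auto
      then show ?thesis by simp
    qed
    then show "norm (f x ^ j) \<le> norm (1 + f x ^ 4)" by (simp add: power_abs)
  qed
qed simp

text \<open>In the expanded fourth power independence factors every mixed term, and those with a
  first power vanish because \<open>Z\<close> and \<open>S\<close> are both centred; hence the mean
  of \<open>S\<close> is part of the induction. Each step adds \<open>6 * n * v * v + k\<close>, so
  growth is quadratic.\<close>

lemma partial_sum_moments:
  fixes Z :: "nat \<Rightarrow> 'a \<Rightarrow> real"
  assumes indep: "indep_vars (\<lambda>_. borel) Z UNIV"
    and int: "\<And>i. integrable M (\<lambda>\<omega>. Z i \<omega> ^ 4)"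
    and mean: "\<And>i. expectation (Z i) = 0"
    and v: "\<And>i. expectation (\<lambda>\<omega>. (Z i \<omega>)\<^sup>2) = v"
    and k: "\<And>i. expectation (\<lambda>\<omega>. Z i \<omega> ^ 4) = k"
  defines "S \<equiv> \<lambda>n \<omega>. \<Sum>i<n. Z i \<omega>"
  shows "integrable M (\<lambda>\<omega>. S n \<omega> ^ 4) \<and> expectation (S n) = 0 \<and> expectation (\<lambda>\<omega>. (S n \<omega>)\<^sup>2) = real n * v \<and>
    expectation (\<lambda>\<omega>. S n \<omega> ^ 4) \<le> (k + 3 * v\<^sup>2) * (real n)\<^sup>2"
proof (induction n)
  case 0
  show ?case by (simp add: S_def)
next
  case (Suc n)
  have [measurable]: "Z i \<in> borel_measurable M" for i
    using indep by (simp add: indep_vars_def2)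
  have [measurable]: "S n \<in> borel_measurable M" for n
    unfolding S_def by measurable
  have "indep_vars (\<lambda>_. borel) Z (insert n {..<n})"
    by (rule indep_vars_subset[OF indep]) auto
  then have iv: "indep_var borel (Z n) borel (S n)"
    unfolding S_def by (intro indep_vars_sum) auto
  have iv': "indep_var borel (\<lambda>\<omega>. Z n \<omega> ^ j) borel (\<lambda>\<omega>. S n \<omega> ^ l)" for j l
    using indep_var_compose[OF iv, of "\<lambda>x. x ^ j" borel "\<lambda>x. x ^ l" borel]
    by (simp add: comp_def)
  have IZ: "integrable M (\<lambda>\<omega>. Z n \<omega> ^ l)" if "l \<le> 4" for l
    by (rule integrable_power_le_4) (use int that in auto)
  have IS: "integrable M (\<lambda>\<omega>. S n \<omega> ^ l)" if "l \<le> 4" for l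
    by (rule integrable_power_le_4) (use Suc.IH that in auto)
  have I: "integrable M (\<lambda>\<omega>. Z n \<omega> ^ l * S n \<omega> ^ j)" if "j \<le> 4" "l \<le> 4" for j l
    by (rule indep_var_integrable[OF iv' IZ[OF that(2)] IS[OF that(1)]])
  have E: "expectation (\<lambda>\<omega>. Z n \<omega> ^ l * S n \<omega> ^ j) = expectation (\<lambda>\<omega>. Z n \<omega> ^ l) * expectation (\<lambda>\<omega>. S n \<omega> ^ j)"
    if "j \<le> 4" "l \<le> 4" for j l
    by (rule indep_var_lebesgue_integral[OF iv' IZ[OF that(2)] IS[OF that(1)]])
  have SS: "S (Suc n) \<omega> = S n \<omega> + Z n \<omega>" for \<omega> by (simp add: S_def)
  have S4: "S (Suc n) \<omega> ^ 4 = S n \<omega> ^ 4 + 4 * (Z n \<omega> ^ 1 * S n \<omega> ^ 3) + 6 * (Z n \<omega> ^ 2 * S n \<omega> ^ 2)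
      + 4 * (Z n \<omega> ^ 3 * S n \<omega> ^ 1) + Z n \<omega> ^ 4" for \<omega>
    unfolding SS by (simp add: eval_nat_numeral algebra_simps)
  have S2: "(S (Suc n) \<omega>)\<^sup>2 = S n \<omega> ^ 2 + 2 * (Z n \<omega> ^ 1 * S n \<omega> ^ 1) + Z n \<omega> ^ 2" for \<omega>
    unfolding SS by (simp add: eval_nat_numeral algebra_simps)
  have "integrable M (\<lambda>\<omega>. S (Suc n) \<omega> ^ 4)"
    unfolding S4 by (intro Bochner_Integration.integrable_add integrable_mult_right I IS IZ) auto
  moreover have "expectation (S (Suc n)) = 0"
    using IS[of 1] IZ[of 1] Suc.IH mean[of n] by (simp add: SS[abs_def])
  moreover have "expectation (\<lambda>\<omega>. (S (Suc n) \<omega>)\<^sup>2) = real (Suc n) * v"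
    unfolding S2 using IS[of 2] IZ[of 2] I[of 1 1] E[of 1 1] Suc.IH mean[of n] v[of n]
    by (simp add: algebra_simps)
  moreover have "expectation (\<lambda>\<omega>. S (Suc n) \<omega> ^ 4) \<le> (k + 3 * v\<^sup>2) * (real (Suc n))\<^sup>2"
  proof -
    have "expectation (\<lambda>\<omega>. S (Suc n) \<omega> ^ 4) = expectation (\<lambda>\<omega>. S n \<omega> ^ 4) + 6 * (real n * v * v) + k"
      unfolding S4 using IS[of 4] IZ[of 4] I[of 3 1] I[of 2 2] I[of 1 3] E[of 3 1] E[of 2 2] E[of 1 3] Suc.IH mean[of n] v[of n] k[of n]
      by simp
    also have "\<dots> \<le> (k + 3 * v\<^sup>2) * (real n)\<^sup>2 + 6 * (real n * v * v) + k" using Suc.IH by simp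
    \<comment> \<open>The bound grows by \<open>(k + 3 * v\<^sup>2) * (2 * n + 1)\<close>, which
      covers \<open>6 * n * v\<^sup>2 + k\<close> because \<open>k\<close> is nonnegative.\<close>
    also have "\<dots> \<le> (k + 3 * v\<^sup>2) * (real (Suc n))\<^sup>2"
    proof -
      have "0 \<le> k" unfolding k[of 0, symmetric] by (intro Bochner_Integration.integral_nonneg) simp
      then have "0 \<le> 2 * (k * real n) + 3 * v\<^sup>2" by simp
      then show ?thesis by (simp add: power2_eq_square algebra_simps)
    qed
    finally show ?thesis .
  qed
  ultimately show ?case by blast
qed

text \<open>By the quadratic growth the fourth moment of the average is of order 1 / n^2, which is
  summable. So the fourth powers of the averages have an almost surely finite sum and tend to 0;
  second moments would give only the divergent 1 / n.\<close>

lemma strong_law_fourth_moment: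
  fixes Z :: "nat \<Rightarrow> 'a \<Rightarrow> real"
  assumes indep: "indep_vars (\<lambda>_. borel) Z UNIV"
    and int: "\<And>i. integrable M (\<lambda>\<omega>. Z i \<omega> ^ 4)"
    and mean: "\<And>i. expectation (Z i) = 0"
    and v: "\<And>i. expectation (\<lambda>\<omega>. (Z i \<omega>)\<^sup>2) = v"
    and k: "\<And>i. expectation (\<lambda>\<omega>. Z i \<omega> ^ 4) = k"
  shows "AE \<omega> in M. (\<lambda>n. (1 / real n) * (\<Sum>i<n. Z i \<omega>)) \<longlonglongrightarrow> 0"
proof -
  have [measurable]: "Z i \<in> borel_measurable M" for i
    using indep by (simp add: indep_vars_def2)
  let ?A = "\<lambda>n \<omega>. (1 / real n) * (\<Sum>i<n. Z i \<omega>)"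
  let ?C = "k + 3 * v\<^sup>2"
  note m = partial_sum_moments[OF assms]
  have iA: "integrable M (\<lambda>\<omega>. ?A n \<omega> ^ 4)" for n
    unfolding power_mult_distrib using m[of n] by (intro integrable_mult_right) simp
  have EA: "expectation (\<lambda>\<omega>. ?A n \<omega> ^ 4) \<le> ?C * inverse (real n ^ 2)" for n
  proof (cases "n = 0")
    case False
    have "expectation (\<lambda>\<omega>. ?A n \<omega> ^ 4) = (1 / real n) ^ 4 * expectation (\<lambda>\<omega>. (\<Sum>i<n. Z i \<omega>) ^ 4)"
      by (simp only: power_mult_distrib integral_mult_right_zero)
    also have "\<dots> \<le> (1 / real n) ^ 4 * (?C * (real n)\<^sup>2)"
      using m[of n] by (intro mult_left_mono) auto
    also have "\<dots> = ?C * inverse (real n ^ 2)" using False by (simp add: field_simps power2_eq_square eval_nat_numeral)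
    finally show ?thesis .
  qed simp
  have summ: "summable (\<lambda>n. ?C * inverse (real n ^ 2))"
    by (intro summable_mult inverse_power_summable) auto
  have E0: "0 \<le> expectation (\<lambda>\<omega>. ?A n \<omega> ^ 4)" for n
    by (intro Bochner_Integration.integral_nonneg) simp
  have "(\<integral>\<^sup>+\<omega>. (\<Sum>n. ennreal (?A n \<omega> ^ 4)) \<partial>M) = (\<Sum>n. \<integral>\<^sup>+\<omega>. ennreal (?A n \<omega> ^ 4) \<partial>M)"
    by (intro nn_integral_suminf) measurable
  also have "\<dots> = (\<Sum>n. ennreal (expectation (\<lambda>\<omega>. ?A n \<omega> ^ 4)))"
    by (intro suminf_cong nn_integral_eq_integral iA AE_I2) simp
  also have "\<dots> \<le> (\<Sum>n. ennreal (?C * inverse (real n ^ 2)))"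
    by (intro suminf_le ennreal_leI EA) auto
  also have "\<dots> < top"
    using summ order_trans[OF E0 EA] by (subst suminf_ennreal2) auto
  finally have "(\<integral>\<^sup>+\<omega>. (\<Sum>n. ennreal (?A n \<omega> ^ 4)) \<partial>M) \<noteq> \<infinity>" by simp
  then have "AE \<omega> in M. (\<Sum>n. ennreal (?A n \<omega> ^ 4)) \<noteq> \<infinity>"
    by (intro nn_integral_PInf_AE) measurable
  then show ?thesis
  proof eventually_elim
    case (elim \<omega>)
    then have "summable (\<lambda>n. ?A n \<omega> ^ 4)"
      by (intro summable_suminf_not_top) auto
    then have "(\<lambda>n. ?A n \<omega> ^ 4) \<longlonglongrightarrow> 0" by (rule summable_LIMSEQ_zero)
    then have "(\<lambda>n. \<bar>?A n \<omega>\<bar> ^ 4) \<longlonglongrightarrow> 0" by (simp only: power_even_abs_numeral even_numeral)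
    then have "(\<lambda>n. root 4 (\<bar>?A n \<omega>\<bar> ^ 4)) \<longlonglongrightarrow> root 4 0" by (rule tendsto_real_root)
    then have "(\<lambda>n. \<bar>?A n \<omega>\<bar>) \<longlonglongrightarrow> 0" by (simp only: real_root_power_cancel abs_ge_zero zero_less_numeral) simp
    then show ?case by (rule tendsto_rabs_zero_cancel)
  qed
qed

end

section \<open>Sums of functions of an i.i.d. sequence\<close>

locale iid_sample = prob_space M for M :: "'a measure" +
  fixes X :: "nat \<Rightarrow> 'a \<Rightarrow> 'b::euclidean_space" and L :: "'b measure"
  assumes indep: "indep_vars (\<lambda>_. borel) X UNIV"
    and law: "\<And>i. distr M borel (X i) = L"
    and moments: "has_all_moments L"
begin

lemma X_measurable [measurable]: "X i \<in> borel_measurable M"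
  using indep by (simp add: indep_vars_def2)

lemma prob_space_L: "prob_space L"
  unfolding law[of 0, symmetric] by (rule prob_space_distr) measurable

lemma integrable_L: "poly_bounded h \<Longrightarrow> integrable L h"
  by (rule integrable_poly_bounded[OF moments])

lemma integral_X: "h \<in> borel_measurable borel \<Longrightarrow> expectation (\<lambda>\<omega>. h (X i \<omega>) :: real) = (\<integral>x. h x \<partial>L)"
  unfolding law[of i, symmetric] by (subst integral_distr) auto

lemma integrable_X: "poly_bounded h \<Longrightarrow> integrable M (\<lambda>\<omega>. h (X i \<omega>))"
  using integrable_L[of h] unfolding law[of i, symmetric]
  by (simp add: integrable_distr_eq poly_bounded_measurable)

lemma indep_h: "h \<in> borel_measurable borel \<Longrightarrow> indep_vars (\<lambda>_. borel) (\<lambda>i \<omega>. h (X i \<omega>) :: real) UNIV"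
  by (rule indep_vars_compose2[OF indep])

lemma strong_law:
  assumes h: "poly_bounded h"
  shows "AE \<omega> in M. (\<lambda>n. (1 / real n) * (\<Sum>i<n. h (X i \<omega>))) \<longlonglongrightarrow> (\<integral>x. h x \<partial>L)"
proof -
  let ?m = "\<integral>x. h x \<partial>L"
  define g where "g x = h x - ?m" for x
  have g: "poly_bounded (\<lambda>x. g x ^ j)" for j
    unfolding g_def by (intro poly_bounded_intros h)
  have g1: "poly_bounded g" using g[of 1] by simp
  have "AE \<omega> in M. (\<lambda>n. (1 / real n) * (\<Sum>i<n. g (X i \<omega>))) \<longlonglongrightarrow> 0"
  proof (rule strong_law_fourth_moment)
    show "indep_vars (\<lambda>_. borel) (\<lambda>i \<omega>. g (X i \<omega>)) UNIV"
      by (rule indep_h) (rule poly_bounded_measurable[OF g1])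
    show "integrable M (\<lambda>\<omega>. g (X i \<omega>) ^ 4)" for i by (rule integrable_X[OF g])
    show "expectation (\<lambda>\<omega>. g (X i \<omega>)) = 0" for i
      unfolding integral_X[OF poly_bounded_measurable[OF g1]] unfolding g_def
      using integrable_L[OF h] prob_space.prob_space[OF prob_space_L] by (simp add: finite_measure.integrable_const prob_space.finite_measure prob_space_L)
    show "expectation (\<lambda>\<omega>. (g (X i \<omega>))\<^sup>2) = (\<integral>x. g x ^ 2 \<partial>L)" for i
      by (rule integral_X) (rule poly_bounded_measurable[OF g])
    show "expectation (\<lambda>\<omega>. g (X i \<omega>) ^ 4) = (\<integral>x. g x ^ 4 \<partial>L)" for i
      by (rule integral_X) (rule poly_bounded_measurable[OF g])
  qed
  then show ?thesis
  proof eventually_elim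
    case (elim \<omega>)
    have "\<forall>\<^sub>F n in sequentially. (1 / real n) * (\<Sum>i<n. g (X i \<omega>)) + ?m = (1 / real n) * (\<Sum>i<n. h (X i \<omega>))"
      using eventually_gt_at_top[of 0]
      by eventually_elim (simp add: g_def sum_subtractf field_simps)
    moreover have "(\<lambda>n. (1 / real n) * (\<Sum>i<n. g (X i \<omega>)) + ?m) \<longlonglongrightarrow> 0 + ?m"
      by (intro tendsto_intros elim)
    ultimately show ?case using tendsto_cong by fastforce
  qed
qed

lemma scaled_sum_second_moment:
  assumes h: "poly_bounded h" and mean: "(\<integral>x. h x \<partial>L) = 0"
  shows "integrable M (\<lambda>\<omega>. ((1 / sqrt (real n)) * (\<Sum>i<n. h (X i \<omega>)))\<^sup>2)"
    and "expectation (\<lambda>\<omega>. ((1 / sqrt (real n)) * (\<Sum>i<n. h (X i \<omega>)))\<^sup>2) = (if n = 0 then 0 else (\<integral>x. (h x)\<^sup>2 \<partial>L))"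
proof -
  have hj: "poly_bounded (\<lambda>x. h x ^ j)" for j by (rule poly_bounded_power[OF h])
  note hm [measurable] = poly_bounded_measurable[OF h]
  have S: "integrable M (\<lambda>\<omega>. (\<Sum>i<n. h (X i \<omega>)) ^ 4)" "expectation (\<lambda>\<omega>. (\<Sum>i<n. h (X i \<omega>))\<^sup>2) = real n * (\<integral>x. (h x)\<^sup>2 \<partial>L)" for n
    using partial_sum_moments[of "\<lambda>i \<omega>. h (X i \<omega>)" "\<integral>x. (h x)\<^sup>2 \<partial>L" "\<integral>x. h x ^ 4 \<partial>L" n,
      OF indep_h[OF hm] integrable_X[OF hj] _ integral_X[OF poly_bounded_measurable[OF hj]] integral_X[OF poly_bounded_measurable[OF hj]]]
    integral_X[OF hm] mean by auto
  have "integrable M (\<lambda>\<omega>. (\<Sum>i<n. h (X i \<omega>))\<^sup>2)"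
    by (rule integrable_power_le_4[OF _ S(1)]) auto
  then show "integrable M (\<lambda>\<omega>. ((1 / sqrt (real n)) * (\<Sum>i<n. h (X i \<omega>)))\<^sup>2)"
    by (simp only: power_mult_distrib integrable_mult_right)
  show "expectation (\<lambda>\<omega>. ((1 / sqrt (real n)) * (\<Sum>i<n. h (X i \<omega>)))\<^sup>2) = (if n = 0 then 0 else (\<integral>x. (h x)\<^sup>2 \<partial>L))"
    by (simp only: power_mult_distrib integral_mult_right_zero S(2)) (simp add: power_divide)
qed

text \<open>The bound is uniform in \<open>n\<close>, as tightness and the later majorant
  \<open>gauge\<close> require; it comes from \<open>\<bar>s\<bar> \<le> 1 + s\<^sup>2\<close> and
  the exact second moment.\<close>

lemma scaled_sum_abs:
  assumes h: "poly_bounded h" and mean: "(\<integral>x. h x \<partial>L) = 0"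
  shows "integrable M (\<lambda>\<omega>. \<bar>(1 / sqrt (real n)) * (\<Sum>i<n. h (X i \<omega>))\<bar>)"
    and "expectation (\<lambda>\<omega>. \<bar>(1 / sqrt (real n)) * (\<Sum>i<n. h (X i \<omega>))\<bar>) \<le> 1 + (\<integral>x. (h x)\<^sup>2 \<partial>L)"
proof -
  note hm [measurable] = poly_bounded_measurable[OF h]
  let ?s = "\<lambda>\<omega>. (1 / sqrt (real n)) * (\<Sum>i<n. h (X i \<omega>))"
  have le: "\<bar>s\<bar> \<le> 1 + s\<^sup>2" for s :: real
  proof -
    have "0 \<le> (\<bar>s\<bar> - 1)\<^sup>2 + 1 + s\<^sup>2" by simp
    then show ?thesis by (simp add: power2_eq_square algebra_simps)
  qed
  have i: "integrable M (\<lambda>\<omega>. 1 + (?s \<omega>)\<^sup>2)" using scaled_sum_second_moment(1)[OF assms] by simp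
  then show a: "integrable M (\<lambda>\<omega>. \<bar>?s \<omega>\<bar>)"
    by (rule Bochner_Integration.integrable_bound) (use le[of "?s _"] in \<open>auto simp del: abs_mult\<close>)
  have "expectation (\<lambda>\<omega>. \<bar>?s \<omega>\<bar>) \<le> expectation (\<lambda>\<omega>. 1 + (?s \<omega>)\<^sup>2)"
    by (intro integral_mono a i le)
  also have "\<dots> = 1 + expectation (\<lambda>\<omega>. (?s \<omega>)\<^sup>2)"
    using scaled_sum_second_moment(1)[OF assms] by (simp add: prob_space)
  also have "\<dots> \<le> 1 + (\<integral>x. (h x)\<^sup>2 \<partial>L)"
    unfolding scaled_sum_second_moment(2)[OF assms] by (auto intro: Bochner_Integration.integral_nonneg)
  finally show "expectation (\<lambda>\<omega>. \<bar>?s \<omega>\<bar>) \<le> 1 + (\<integral>x. (h x)\<^sup>2 \<partial>L)" .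
qed

text \<open>Zero variance is split off because the central limit theorem asks for a positive one.
  The case does occur: the influence function \<open>\<psi>\<close> takes tangential values, so its
  component along \<open>e\<close> is identically zero.\<close>

lemma clt_char:
  assumes h: "poly_bounded h" and mean: "(\<integral>x. h x \<partial>L) = 0"
  shows "(\<lambda>n. CLINT \<omega>|M. iexp ((1 / sqrt (real n)) * (\<Sum>i<n. h (X i \<omega>)))) \<longlonglongrightarrow>
    complex_of_real (exp (- (\<integral>x. (h x)\<^sup>2 \<partial>L) / 2))"
proof (cases "(\<integral>x. (h x)\<^sup>2 \<partial>L) = 0")
  case True
  note hm [measurable] = poly_bounded_measurable[OF h]
  have "(CLINT \<omega>|M. iexp ((1 / sqrt (real n)) * (\<Sum>i<n. h (X i \<omega>)))) = 1" for n
  proof -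
    let ?s = "\<lambda>\<omega>. (1 / sqrt (real n)) * (\<Sum>i<n. h (X i \<omega>))"
    have "expectation (\<lambda>\<omega>. (?s \<omega>)\<^sup>2) = 0"
      using scaled_sum_second_moment(2)[OF assms] True by simp
    then have "AE \<omega> in M. (?s \<omega>)\<^sup>2 = 0"
      using scaled_sum_second_moment(1)[OF assms] by (subst (asm) integral_nonneg_eq_0_iff_AE) auto
    then have "AE \<omega> in M. iexp (?s \<omega>) = 1"
    proof eventually_elim
      case (elim \<omega>)
      then have "?s \<omega> = 0" by (simp only: zero_eq_power2)
      then show ?case by (simp only: of_real_0 mult_zero_right exp_zero)
    qed
    then have "(CLINT \<omega>|M. iexp (?s \<omega>)) = (CLINT \<omega>|M. 1)" by (intro integral_cong_AE) auto
    then show ?thesis by (simp add: prob_space)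
  qed
  then show ?thesis by (simp add: True)
next
  case False
  note hm [measurable] = poly_bounded_measurable[OF h]
  define \<sigma> where "\<sigma> = sqrt (\<integral>x. (h x)\<^sup>2 \<partial>L)"
  have "0 \<le> (\<integral>x. (h x)\<^sup>2 \<partial>L)" by (intro Bochner_Integration.integral_nonneg) simp
  with False have "0 < (\<integral>x. (h x)\<^sup>2 \<partial>L)" by linarith
  then have \<sigma>: "\<sigma> > 0" "\<sigma>\<^sup>2 = (\<integral>x. (h x)\<^sup>2 \<partial>L)" by (simp_all add: \<sigma>_def)
  have h2: "poly_bounded (\<lambda>x. (h x)\<^sup>2)" by (intro poly_bounded_power h)
  have mean': "expectation (\<lambda>\<omega>. h (X n \<omega>)) = 0" for n using integral_X[OF hm] mean by simp
  have "weak_conv_m (\<lambda>n. distr M borel (\<lambda>\<omega>. (\<Sum>i<n. h (X i \<omega>)) / sqrt (n * \<sigma>\<^sup>2))) std_normal_distribution"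
  proof (rule central_limit_theorem_zero_mean)
    show "indep_vars (\<lambda>i. borel) (\<lambda>i \<omega>. h (X i \<omega>)) UNIV" by (rule indep_h[OF hm])
    show "integrable M (\<lambda>\<omega>. (h (X n \<omega>))\<^sup>2)" for n by (rule integrable_X[OF h2])
    show "variance (\<lambda>\<omega>. h (X n \<omega>)) = \<sigma>\<^sup>2" for n
      using integral_X[OF poly_bounded_measurable[OF h2]] by (simp add: mean' \<sigma>(2))
    show "distr M borel (\<lambda>\<omega>. h (X n \<omega>)) = distr L borel h" for n
      unfolding law[of n, symmetric] by (subst distr_distr) (auto simp: comp_def)
  qed (use \<sigma> mean' in auto)
  \<comment> \<open>Evaluating the characteristic function at \<sigma> undoes the division by
    \<sigma> in the normalised sum.\<close>
  then have "(\<lambda>n. char (distr M borel (\<lambda>\<omega>. (\<Sum>i<n. h (X i \<omega>)) / sqrt (n * \<sigma>\<^sup>2))) \<sigma>) \<longlonglongrightarrow> char std_normal_distribution \<sigma>"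
    by (intro levy_continuity1 real_dist_normal_dist real_distribution_distr) measurable
  also have "(\<lambda>n. char (distr M borel (\<lambda>\<omega>. (\<Sum>i<n. h (X i \<omega>)) / sqrt (n * \<sigma>\<^sup>2))) \<sigma>) =
    (\<lambda>n. CLINT \<omega>|M. iexp ((1 / sqrt (real n)) * (\<Sum>i<n. h (X i \<omega>))))"
    unfolding char_def using \<sigma>(1)
    by (intro ext, subst integral_distr) (auto simp: real_sqrt_mult intro!: Bochner_Integration.integral_cong)
  also have "char std_normal_distribution \<sigma> = complex_of_real (exp (- (\<integral>x. (h x)\<^sup>2 \<partial>L) / 2))"
    unfolding char_std_normal_distribution \<sigma>(2) ..
  finally show ?thesis .
qed

end

section \<open>Critical points of the sample kurtosis\<close>

lemma linear_expand:
  fixes f :: "'b::euclidean_space \<Rightarrow> real"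
  assumes "linear f"
  shows "f a = (\<Sum>i\<in>Basis. (a \<bullet> i) * f i)"
proof -
  have "f a = f (\<Sum>i\<in>Basis. (a \<bullet> i) *\<^sub>R i)" by (simp add: euclidean_representation)
  also have "\<dots> = (\<Sum>i\<in>Basis. (a \<bullet> i) * f i)"
    using assms by (simp add: linear_sum linear_scale)
  finally show ?thesis .
qed

text \<open>A bound through the values on the basis, so that finitely many scalar limits make a
  sequence of functionals small relative to \<open>norm a\<close>.\<close>

lemma linear_abs_le:
  fixes f :: "'b::euclidean_space \<Rightarrow> real"
  assumes "linear f"
  shows "\<bar>f a\<bar> \<le> norm a * (\<Sum>i\<in>Basis. \<bar>f i\<bar>)"
proof -
  have "\<bar>f a\<bar> \<le> (\<Sum>i\<in>Basis. \<bar>(a \<bullet> i) * f i\<bar>)"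
    unfolding linear_expand[OF assms, of a] by (rule sum_abs)
  also have "\<dots> \<le> (\<Sum>i\<in>Basis. norm a * \<bar>f i\<bar>)"
    by (intro sum_mono) (simp add: abs_mult Basis_le_norm mult_right_mono)
  finally show ?thesis by (simp add: sum_distrib_left)
qed

text \<open>Multilinearity takes the place of differential calculus: differences telescope argument
  by argument, and a form is determined by finitely many numbers.\<close>

definition quadlinear :: "('b::real_vector \<Rightarrow> 'b \<Rightarrow> 'b \<Rightarrow> 'b \<Rightarrow> real) \<Rightarrow> bool" where
  "quadlinear Q \<longleftrightarrow> (\<forall>b c d. linear (\<lambda>a. Q a b c d)) \<and> (\<forall>a c d. linear (\<lambda>b. Q a b c d)) \<and>
     (\<forall>a b d. linear (\<lambda>c. Q a b c d)) \<and> (\<forall>a b c. linear (\<lambda>d. Q a b c d))"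

lemma quadlinearD:
  assumes "quadlinear Q"
  shows "linear (\<lambda>a. Q a b c d)" "linear (\<lambda>b. Q a b c d)" "linear (\<lambda>c. Q a b c d)" "linear (\<lambda>d. Q a b c d)"
  using assms by (simp_all add: quadlinear_def)

lemma bilinearD:
  assumes "bilinear A"
  shows "linear (\<lambda>a. A a b)" "linear (\<lambda>b. A a b)"
  using assms by (simp_all add: bilinear_def)

lemma quadlinear_expand:
  fixes Q :: "'b::euclidean_space \<Rightarrow> 'b \<Rightarrow> 'b \<Rightarrow> 'b \<Rightarrow> real"
  assumes "quadlinear Q"
  shows "Q a b c d = (\<Sum>i\<in>Basis. (a \<bullet> i) * (\<Sum>j\<in>Basis. (b \<bullet> j) * (\<Sum>k\<in>Basis. (c \<bullet> k) * (\<Sum>l\<in>Basis. (d \<bullet> l) * Q i j k l))))"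
  by (subst linear_expand[OF quadlinearD(1)[OF assms]], subst linear_expand[OF quadlinearD(2)[OF assms]],
      subst linear_expand[OF quadlinearD(3)[OF assms]], subst linear_expand[OF quadlinearD(4)[OF assms]]) simp

text \<open>In coordinates the value is a finite sum of products of convergent sequences.
  Convergence along moving arguments then takes the place of uniform convergence on the
  sphere.\<close>

lemma quadlinear_tendsto:
  fixes Q :: "'n \<Rightarrow> 'b::euclidean_space \<Rightarrow> 'b \<Rightarrow> 'b \<Rightarrow> 'b \<Rightarrow> real"
  assumes Q: "\<And>n. quadlinear (Q n)" and Q0: "quadlinear Q0"
    and lim: "\<And>i j k l. i \<in> Basis \<Longrightarrow> j \<in> Basis \<Longrightarrow> k \<in> Basis \<Longrightarrow> l \<in> Basis \<Longrightarrow> ((\<lambda>n. Q n i j k l) \<longlongrightarrow> Q0 i j k l) F"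
    and "(a \<longlongrightarrow> a0) F" "(b \<longlongrightarrow> b0) F" "(c \<longlongrightarrow> c0) F" "(d \<longlongrightarrow> d0) F"
  shows "((\<lambda>n. Q n (a n) (b n) (c n) (d n)) \<longlongrightarrow> Q0 a0 b0 c0 d0) F"
  unfolding quadlinear_expand[OF Q0, of a0] quadlinear_expand[OF Q, of _ "a _"]
  by (intro tendsto_intros assms)

lemma bilinear_tendsto:
  fixes A :: "'n \<Rightarrow> 'b::euclidean_space \<Rightarrow> 'b \<Rightarrow> real"
  assumes A: "\<And>n. bilinear (A n)" and A0: "bilinear A0"
    and lim: "\<And>i j. i \<in> Basis \<Longrightarrow> j \<in> Basis \<Longrightarrow> ((\<lambda>n. A n i j) \<longlongrightarrow> A0 i j) F"
    and "(a \<longlongrightarrow> a0) F" "(b \<longlongrightarrow> b0) F"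
  shows "((\<lambda>n. A n (a n) (b n)) \<longlongrightarrow> A0 a0 b0) F"
proof -
  have e: "B x y = (\<Sum>i\<in>Basis. (x \<bullet> i) * (\<Sum>j\<in>Basis. (y \<bullet> j) * B i j))" if "bilinear B" for B :: "'b \<Rightarrow> 'b \<Rightarrow> real" and x y
    by (subst linear_expand[OF bilinearD(1)[OF that]], subst linear_expand[OF bilinearD(2)[OF that]]) simp
  show ?thesis
    unfolding e[OF A0, of a0] e[OF A, of _ "a _"] by (intro tendsto_intros assms)
qed

text \<open>A subsequence staying away from \<open>e\<close> would, by compactness, have a further
  limit \<open>l\<close> with \<open>K0 e \<le> K0 l\<close>, against \<open>uniq\<close>;
  \<open>conv\<close> is stated along subsequences and moving arguments for this purpose. The sign
  makes the inner product with \<open>e\<close> nonnegative, which excludes \<open>- e\<close> as a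
  limit.\<close>

lemma argmax_consistency:
  fixes K :: "nat \<Rightarrow> 'b::euclidean_space \<Rightarrow> real"
  assumes conv: "\<And>r v l. strict_mono r \<Longrightarrow> (\<And>n. norm (v n) = 1) \<Longrightarrow> v \<longlonglongrightarrow> l \<Longrightarrow> (\<lambda>n. K (r n) (v n)) \<longlonglongrightarrow> K0 l"
    and even: "\<And>n v. K n (- v) = K n v"
    and max: "\<forall>\<^sub>F n in sequentially. K n e \<le> K n (u n)"
    and unit: "\<And>n. norm (u n) = 1" "norm e = 1"
    and uniq: "\<And>v. norm v = 1 \<Longrightarrow> v \<noteq> e \<Longrightarrow> v \<noteq> - e \<Longrightarrow> K0 v < K0 e"
  shows "(\<lambda>n. (if 0 \<le> u n \<bullet> e then 1 else - 1) *\<^sub>R u n) \<longlonglongrightarrow> e"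
proof (rule ccontr)
  define v where "v n = (if 0 \<le> u n \<bullet> e then 1 else - 1) *\<^sub>R u n" for n
  have v: "norm (v n) = 1" "0 \<le> v n \<bullet> e" "K m (v n) = K m (u n)" for n m
    using unit even by (auto simp: v_def)
  assume "\<not> ?thesis"
  then have "\<not> v \<longlonglongrightarrow> e" by (simp add: v_def[abs_def])
  then obtain \<epsilon> where \<epsilon>: "\<epsilon> > 0" "\<not> (\<forall>\<^sub>F n in sequentially. dist (v n) e < \<epsilon>)"
    unfolding tendsto_iff by blast
  then have "\<exists>\<^sub>F n in sequentially. \<epsilon> \<le> dist (v n) e"
    by (simp add: not_eventually not_less)
  then have "infinite {n. \<epsilon> \<le> dist (v n) e}" by (simp add: frequently_sequentially infinite_nat_iff_unbounded_le)
  then obtain r :: "nat \<Rightarrow> nat" where r: "strict_mono r" "\<And>n. \<epsilon> \<le> dist (v (r n)) e"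
    using infinite_enumerate by blast
  have "\<forall>n. (v \<circ> r) n \<in> sphere 0 1" using v by simp
  then obtain l q where l: "l \<in> sphere 0 1" "strict_mono q" "((v \<circ> r) \<circ> q) \<longlonglongrightarrow> l"
    using compact_sphere[of 0 1] unfolding compact_def by (metis (no_types, lifting))
  let ?r = "r \<circ> q"
  have sr: "strict_mono ?r" using r(1) l(2) by (rule strict_mono_o)
  have vl: "(\<lambda>n. v (?r n)) \<longlonglongrightarrow> l" using l(3) by (simp add: comp_def)
  have "\<epsilon> \<le> dist l e"
    by (rule tendsto_lowerbound[OF tendsto_dist[OF vl tendsto_const]]) (use r in auto)
  then have "l \<noteq> e" using \<epsilon> by auto
  have "0 \<le> l \<bullet> e"
    by (rule tendsto_lowerbound[OF tendsto_inner[OF vl tendsto_const]]) (use v in auto)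
  then have "l \<noteq> - e" using unit(2) by (auto simp: norm_eq_1)
  have "K0 e \<le> K0 l"
  proof (rule tendsto_le)
    show "(\<lambda>n. K (?r n) (v (?r n))) \<longlonglongrightarrow> K0 l" by (rule conv[OF sr v(1) vl])
    show "(\<lambda>n. K (?r n) e) \<longlonglongrightarrow> K0 e" by (rule conv[OF sr unit(2) tendsto_const])
    have "filterlim ?r sequentially sequentially" by (rule filterlim_subseq[OF sr])
    from eventually_compose_filterlim[OF max this]
    show "\<forall>\<^sub>F n in sequentially. K (?r n) e \<le> K (?r n) (v (?r n))" by (simp add: v(3))
  qed simp
  moreover have "K0 l < K0 e" using uniq[of l] l(1) \<open>l \<noteq> e\<close> \<open>l \<noteq> - e\<close> by simp
  ultimately show False by simp
qed

text \<open>
  Up to the factor \<open>4 / (A v v)\<^sup>3\<close>, the derivative of \<open>Q v v v v / (A v v)\<^sup>2\<close> at \<open>v\<close> in direction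
  \<open>w\<close> is \<open>G v w = A v v * Q v v v w - Q v v v v * A v w\<close>. The proof telescopes \<open>G v w - G e w\<close> into
  a linear functional of \<open>v - e\<close> whose coefficients converge. The normal component of
  \<open>v - e\<close> is of second order because \<open>v\<close> and \<open>e\<close> are unit vectors.
\<close>

lemma critical_point_expansion:
  fixes A :: "nat \<Rightarrow> 'b::euclidean_space \<Rightarrow> 'b \<Rightarrow> real" and Q :: "nat \<Rightarrow> 'b \<Rightarrow> 'b \<Rightarrow> 'b \<Rightarrow> 'b \<Rightarrow> real"
  assumes A: "\<And>n. bilinear (A n)" "bilinear A0"
    and Q: "\<And>n. quadlinear (Q n)" "quadlinear Q0"
    and limA: "\<And>i j. i \<in> Basis \<Longrightarrow> j \<in> Basis \<Longrightarrow> (\<lambda>n. A n i j) \<longlonglongrightarrow> A0 i j"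
    and limQ: "\<And>i j k l. i \<in> Basis \<Longrightarrow> j \<in> Basis \<Longrightarrow> k \<in> Basis \<Longrightarrow> l \<in> Basis \<Longrightarrow> (\<lambda>n. Q n i j k l) \<longlonglongrightarrow> Q0 i j k l"
    and v: "v \<longlonglongrightarrow> e" "\<And>n. norm (v n) = 1" "norm e = 1"
    and crit: "\<forall>\<^sub>F n in sequentially. \<forall>t\<in>Basis.
      A n (v n) (v n) * Q n (v n) (v n) (v n) (B t) - Q n (v n) (v n) (v n) (v n) * A n (v n) (B t) = 0"
    and c: "c \<noteq> 0"
    and deriv: "\<And>\<eta> t. t \<in> Basis \<Longrightarrow>
      (A0 \<eta> e + A0 e \<eta>) * Q0 e e e (B t) + A0 e e * (Q0 \<eta> e e (B t) + Q0 e \<eta> e (B t) + Q0 e e \<eta> (B t))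
      - (Q0 \<eta> e e e + Q0 e \<eta> e e + Q0 e e \<eta> e + Q0 e e e \<eta>) * A0 e (B t) - Q0 e e e e * A0 \<eta> (B t)
      = - c * ((\<eta> - (\<eta> \<bullet> e) *\<^sub>R e) \<bullet> t)"
    and \<epsilon>: "\<epsilon> > 0"
  defines "g \<equiv> \<lambda>n. \<Sum>t\<in>Basis. (A n e e * Q n e e e (B t) - Q n e e e e * A n e (B t)) *\<^sub>R t"
  shows "\<forall>\<^sub>F n in sequentially. norm (v n - e - (1 / c) *\<^sub>R g n) \<le> \<epsilon> * norm (g n)"
proof -
  \<comment> \<open>The difference between the first-order conditions at \<open>v n\<close> and at
    \<open>e\<close>, telescoped: in each term one slot holds \<eta>, the slots before it hold
    \<open>e\<close> and those after it \<open>v n\<close>.\<close>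
  define L where "L n t \<eta> = (A n \<eta> (v n) + A n e \<eta>) * Q n (v n) (v n) (v n) (B t)
      + A n e e * (Q n \<eta> (v n) (v n) (B t) + Q n e \<eta> (v n) (B t) + Q n e e \<eta> (B t))
      - (Q n \<eta> (v n) (v n) (v n) + Q n e \<eta> (v n) (v n) + Q n e e \<eta> (v n) + Q n e e e \<eta>) * A n (v n) (B t)
      - Q n e e e e * A n \<eta> (B t)" for n t \<eta>
  define \<Lambda> where "\<Lambda> t \<eta> = - c * ((\<eta> - (\<eta> \<bullet> e) *\<^sub>R e) \<bullet> t)" for t \<eta>
  define d where "d n = v n - e" for n
  define \<delta> where "\<delta> n = (\<Sum>t\<in>Basis. \<Sum>b\<in>Basis. \<bar>L n t b - \<Lambda> t b\<bar>)" for n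
  \<comment> \<open>Relative error from two sources: the distance of \<open>L n\<close> from its
    limit on the basis, and the normal component of \<open>d n\<close>, which is quadratic in
    \<open>norm (d n)\<close>.\<close>
  define \<gamma> where "\<gamma> n = (\<delta> n + \<bar>c\<bar> * norm (d n)) / \<bar>c\<bar>" for n
  note tA = bilinear_tendsto[OF A limA] and tQ = quadlinear_tendsto[OF Q limQ]
  have lin: "linear (\<lambda>\<eta>. L n t \<eta> - \<Lambda> t \<eta>)" for n t
    unfolding L_def \<Lambda>_def
    by (rule linearI)
      (simp_all add: linear_add[OF bilinearD(1)[OF A(1)]] linear_add[OF bilinearD(2)[OF A(1)]] linear_scale[OF bilinearD(1)[OF A(1)]] linear_scale[OF bilinearD(2)[OF A(1)]]
        linear_add[OF quadlinearD(1)[OF Q(1)]] linear_add[OF quadlinearD(2)[OF Q(1)]] linear_add[OF quadlinearD(3)[OF Q(1)]] linear_add[OF quadlinearD(4)[OF Q(1)]]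
        linear_scale[OF quadlinearD(1)[OF Q(1)]] linear_scale[OF quadlinearD(2)[OF Q(1)]] linear_scale[OF quadlinearD(3)[OF Q(1)]] linear_scale[OF quadlinearD(4)[OF Q(1)]]
        inner_add_left inner_diff_left algebra_simps)
  have L_lim: "(\<lambda>n. L n t \<eta>) \<longlonglongrightarrow> \<Lambda> t \<eta>" if "t \<in> Basis" for t \<eta>
    unfolding L_def \<Lambda>_def deriv[OF that, symmetric]
    by (intro tendsto_intros tA tQ v(1))
  have "\<delta> \<longlonglongrightarrow> (\<Sum>t\<in>(Basis::'b set). \<Sum>b\<in>(Basis::'b set). \<bar>\<Lambda> t b - \<Lambda> t b\<bar>)"
    unfolding \<delta>_def[abs_def] by (intro tendsto_intros L_lim)
  moreover have "(\<lambda>n. norm (d n)) \<longlonglongrightarrow> norm (e - e)"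
    unfolding d_def by (intro tendsto_intros v(1))
  ultimately have "\<gamma> \<longlonglongrightarrow> (0 + \<bar>c\<bar> * 0) / \<bar>c\<bar>"
    unfolding \<gamma>_def[abs_def] using c by (intro tendsto_intros) auto
  then have \<gamma>0: "\<gamma> \<longlonglongrightarrow> 0" by simp
  have main: "norm (d n - (1 / c) *\<^sub>R g n) \<le> \<gamma> n * norm (d n)"
    if cr: "\<forall>t\<in>Basis. A n (v n) (v n) * Q n (v n) (v n) (v n) (B t) - Q n (v n) (v n) (v n) (v n) * A n (v n) (B t) = 0" for n
  proof -
    have gt: "g n \<bullet> t + L n t (d n) = 0" if t: "t \<in> Basis" for t
    proof -
      have vd: "v n = e + d n" by (simp add: d_def)
      have gn: "g n \<bullet> t = A n e e * Q n e e e (B t) - Q n e e e e * A n e (B t)"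
        unfolding g_def using t by (simp add: inner_sum_left inner_Basis if_distrib cong: if_cong)
      define a b c' d' where "a = A n (v n) (v n)" and "b = Q n (v n) (v n) (v n) (B t)"
        and "c' = Q n (v n) (v n) (v n) (v n)" and "d' = A n (v n) (B t)"
      have e1: "A n (d n) (v n) + A n e (d n) = a - A n e e"
        unfolding d_def a_def by (simp add: linear_diff[OF bilinearD(1)[OF A(1)]] linear_diff[OF bilinearD(2)[OF A(1)]])
      have e2: "Q n (d n) (v n) (v n) (B t) + Q n e (d n) (v n) (B t) + Q n e e (d n) (B t) = b - Q n e e e (B t)"
        unfolding d_def b_def by (simp add: linear_diff[OF quadlinearD(1)[OF Q(1)]] linear_diff[OF quadlinearD(2)[OF Q(1)]] linear_diff[OF quadlinearD(3)[OF Q(1)]])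
      have e3: "Q n (d n) (v n) (v n) (v n) + Q n e (d n) (v n) (v n) + Q n e e (d n) (v n) + Q n e e e (d n) = c' - Q n e e e e"
        unfolding d_def c'_def by (simp add: linear_diff[OF quadlinearD(1)[OF Q(1)]] linear_diff[OF quadlinearD(2)[OF Q(1)]] linear_diff[OF quadlinearD(3)[OF Q(1)]] linear_diff[OF quadlinearD(4)[OF Q(1)]])
      have e4: "A n (d n) (B t) = d' - A n e (B t)"
        unfolding d_def d'_def by (simp add: linear_diff[OF bilinearD(1)[OF A(1)]])
      have "a * b - c' * d' = 0" using cr t by (simp add: a_def b_def c'_def d'_def)
      then show ?thesis
        unfolding gn L_def e1 e2 e3 e4 a_def[symmetric] b_def[symmetric] c'_def[symmetric] d'_def[symmetric]
        by (simp add: algebra_simps)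
    qed
    have de: "2 * (d n \<bullet> e) = - (norm (d n))\<^sup>2"
    proof -
      have "(norm (e + d n))\<^sup>2 = 1" using v(2)[of n] by (simp add: d_def)
      moreover have "(norm e)\<^sup>2 = 1" using v(3) by simp
      ultimately show ?thesis
        unfolding power2_norm_eq_inner by (simp add: inner_add_left inner_add_right inner_commute)
    qed
    have "norm (g n - c *\<^sub>R (d n - (d n \<bullet> e) *\<^sub>R e)) \<le> (\<Sum>t\<in>Basis. \<bar>(g n - c *\<^sub>R (d n - (d n \<bullet> e) *\<^sub>R e)) \<bullet> t\<bar>)"
      by (rule norm_le_l1)
    also have "\<dots> \<le> (\<Sum>t\<in>Basis. norm (d n) * (\<Sum>b\<in>Basis. \<bar>L n t b - \<Lambda> t b\<bar>))"
    proof (intro sum_mono)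
      fix t :: 'b assume t: "t \<in> Basis"
      have "(g n - c *\<^sub>R (d n - (d n \<bullet> e) *\<^sub>R e)) \<bullet> t = - (L n t (d n) - \<Lambda> t (d n))"
        using gt[OF t] by (simp add: \<Lambda>_def inner_diff_left)
      then show "\<bar>(g n - c *\<^sub>R (d n - (d n \<bullet> e) *\<^sub>R e)) \<bullet> t\<bar> \<le> norm (d n) * (\<Sum>b\<in>Basis. \<bar>L n t b - \<Lambda> t b\<bar>)"
        using linear_abs_le[OF lin[of n t], of "d n"] by simp
    qed
    also have "\<dots> = \<delta> n * norm (d n)" by (simp add: \<delta>_def sum_distrib_left mult.commute)
    finally have 1: "norm (g n - c *\<^sub>R (d n - (d n \<bullet> e) *\<^sub>R e)) \<le> \<delta> n * norm (d n)" .
    have 2: "norm (c *\<^sub>R ((d n \<bullet> e) *\<^sub>R e)) \<le> \<bar>c\<bar> * norm (d n) * norm (d n)"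
    proof -
      have "\<bar>d n \<bullet> e\<bar> = (norm (d n))\<^sup>2 / 2"
      proof -
        have "d n \<bullet> e = - ((norm (d n))\<^sup>2 / 2)" using de by linarith
        then show ?thesis by (simp only: abs_minus_cancel) simp
      qed
      then have "\<bar>d n \<bullet> e\<bar> \<le> norm (d n) * norm (d n)" by (simp add: power2_eq_square)
      then show ?thesis using v(3) by (simp add: abs_mult mult.assoc mult_left_mono)
    qed
    have "norm (c *\<^sub>R (d n - (1 / c) *\<^sub>R g n)) = norm ((g n - c *\<^sub>R (d n - (d n \<bullet> e) *\<^sub>R e)) - c *\<^sub>R ((d n \<bullet> e) *\<^sub>R e))"
      using c by (subst norm_minus_cancel[symmetric]) (simp add: algebra_simps)
    also have "\<dots> \<le> \<delta> n * norm (d n) + \<bar>c\<bar> * norm (d n) * norm (d n)"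
      using norm_triangle_ineq4 1 2 by (rule order_trans[OF _ add_mono])
    finally have "\<bar>c\<bar> * norm (d n - (1 / c) *\<^sub>R g n) \<le> (\<delta> n + \<bar>c\<bar> * norm (d n)) * norm (d n)"
      unfolding norm_scaleR by (simp only: distrib_right)
    then show ?thesis unfolding \<gamma>_def using c by (simp add: field_simps)
  qed
  \<comment> \<open>The bound 1/2 lets the error be absorbed, giving
    \<open>norm (d n) \<le> 2 / \<bar>c\<bar> * norm (g n)\<close>; the other bound turns \<rho>
    times this into at most \<epsilon> times \<open>norm (g n)\<close>.\<close>
  define \<rho> where "\<rho> = min (1 / 2) (\<epsilon> * \<bar>c\<bar> / 2)"
  have "\<rho> > 0" using \<epsilon> c by (simp add: \<rho>_def)
  have "\<forall>\<^sub>F n in sequentially. \<gamma> n < \<rho>" by (rule order_tendstoD(2)[OF \<gamma>0 \<open>\<rho> > 0\<close>])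
  with crit show ?thesis
  proof eventually_elim
    case (elim n)
    note m = main[OF elim(1)]
    have n0: "0 \<le> norm (d n)" by simp
    have "\<gamma> n * norm (d n) \<le> 1 / 2 * norm (d n)" using elim(2) by (intro mult_right_mono) (auto simp: \<rho>_def)
    moreover have "norm (d n) \<le> norm (d n - (1 / c) *\<^sub>R g n) + norm ((1 / c) *\<^sub>R g n)"
      using norm_triangle_ineq[of "d n - (1 / c) *\<^sub>R g n" "(1 / c) *\<^sub>R g n"] by simp
    ultimately have "norm (d n) \<le> 2 * norm ((1 / c) *\<^sub>R g n)" using m by linarith
    then have dg: "norm (d n) \<le> 2 / \<bar>c\<bar> * norm (g n)" by simp
    have "norm (d n - (1 / c) *\<^sub>R g n) \<le> \<rho> * norm (d n)"
      using m mult_right_mono[OF less_imp_le[OF elim(2)] n0] by (rule order_trans)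
    also have "\<dots> \<le> (\<epsilon> * \<bar>c\<bar> / 2) * (2 / \<bar>c\<bar> * norm (g n))"
      using dg \<open>\<rho> > 0\<close> by (intro mult_mono) (auto simp: \<rho>_def)
    also have "\<dots> = \<epsilon> * norm (g n)" using c by simp
    finally show ?case by (simp add: d_def)
  qed
qed

section \<open>Sample moments as multilinear forms\<close>

definition avg :: "nat \<Rightarrow> (nat \<Rightarrow> real) \<Rightarrow> real" where
  "avg n f = (1 / real n) * (\<Sum>i<n. f i)"

lemma avg_add: "avg n (\<lambda>i. f i + g i) = avg n f + avg n g"
  by (simp add: avg_def sum.distrib distrib_left add_divide_distrib)

lemma avg_diff: "avg n (\<lambda>i. f i - g i) = avg n f - avg n g"
  by (simp add: avg_def sum_subtractf diff_divide_distrib)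

lemma avg_cmult: "avg n (\<lambda>i. c * f i) = c * avg n f"
  by (simp add: avg_def sum_distrib_left)

lemma avg_const: "n > 0 \<Longrightarrow> avg n (\<lambda>i. c) = c"
  by (simp add: avg_def)

lemma sqrt_times_avg: "sqrt (real n) * avg n f = (1 / sqrt (real n)) * (\<Sum>i<n. f i)"
proof (cases "n = 0")
  case False
  then have "sqrt (real n) / real n = 1 / sqrt (real n)" by (simp add: real_div_sqrt field_simps)
  then have "sqrt (real n) * (1 / real n) = 1 / sqrt (real n)" by simp
  then show ?thesis by (simp only: avg_def mult.assoc[symmetric])
qed (simp add: avg_def)

lemma avg_centred2:
  assumes "n > 0"
  shows "avg n (\<lambda>i. (p i - \<alpha>) * (q i - \<beta>)) = avg n (\<lambda>i. p i * q i) - \<alpha> * avg n q - \<beta> * avg n p + \<alpha> * \<beta>"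
proof -
  have "avg n (\<lambda>i. (p i - \<alpha>) * (q i - \<beta>)) = avg n (\<lambda>i. p i * q i - \<alpha> * q i - \<beta> * p i + \<alpha> * \<beta>)"
    by (intro arg_cong[where f="avg n"]) (simp add: fun_eq_iff algebra_simps)
  then show ?thesis using assms by (simp add: avg_add avg_diff avg_cmult avg_const)
qed

lemma avg_centred4:
  assumes "n > 0"
  shows "avg n (\<lambda>i. (p i - \<alpha>) * (q i - \<beta>) * (r i - \<gamma>) * (s i - \<delta>)) =
    avg n (\<lambda>i. p i * q i * r i * s i)
    - \<alpha> * avg n (\<lambda>i. q i * r i * s i) - \<beta> * avg n (\<lambda>i. p i * r i * s i)
    - \<gamma> * avg n (\<lambda>i. p i * q i * s i) - \<delta> * avg n (\<lambda>i. p i * q i * r i)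
    + \<alpha> * \<beta> * avg n (\<lambda>i. r i * s i) + \<alpha> * \<gamma> * avg n (\<lambda>i. q i * s i) + \<alpha> * \<delta> * avg n (\<lambda>i. q i * r i)
    + \<beta> * \<gamma> * avg n (\<lambda>i. p i * s i) + \<beta> * \<delta> * avg n (\<lambda>i. p i * r i) + \<gamma> * \<delta> * avg n (\<lambda>i. p i * q i)
    - \<alpha> * \<beta> * \<gamma> * avg n s - \<alpha> * \<beta> * \<delta> * avg n r - \<alpha> * \<gamma> * \<delta> * avg n q - \<beta> * \<gamma> * \<delta> * avg n p
    + \<alpha> * \<beta> * \<gamma> * \<delta>"
proof -
  have "avg n (\<lambda>i. (p i - \<alpha>) * (q i - \<beta>) * (r i - \<gamma>) * (s i - \<delta>)) = avg n (\<lambda>i. p i * q i * r i * s i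
    - \<alpha> * (q i * r i * s i) - \<beta> * (p i * r i * s i) - \<gamma> * (p i * q i * s i) - \<delta> * (p i * q i * r i)
    + \<alpha> * \<beta> * (r i * s i) + \<alpha> * \<gamma> * (q i * s i) + \<alpha> * \<delta> * (q i * r i)
    + \<beta> * \<gamma> * (p i * s i) + \<beta> * \<delta> * (p i * r i) + \<gamma> * \<delta> * (p i * q i)
    - \<alpha> * \<beta> * \<gamma> * s i - \<alpha> * \<beta> * \<delta> * r i - \<alpha> * \<gamma> * \<delta> * q i - \<beta> * \<gamma> * \<delta> * p i
    + \<alpha> * \<beta> * \<gamma> * \<delta>)"
    by (intro arg_cong[where f="avg n"]) (simp add: fun_eq_iff algebra_simps)
  then show ?thesis using assms by (simp add: avg_add avg_diff avg_cmult avg_const)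
qed

text \<open>\<open>sample_form2\<close> and \<open>sample_form4\<close> are the polarised sample
  moments behind \<open>sample_kurtosis\<close>: the first-order condition involves their mixed
  values, with one argument equal to the direction of differentiation.\<close>

definition sample_form2 :: "(nat \<Rightarrow> real^'p) \<Rightarrow> nat \<Rightarrow> real^'p \<Rightarrow> real^'p \<Rightarrow> real" where
  "sample_form2 x n v w = avg n (\<lambda>i. (v \<bullet> (x i - sample_mean x n)) * (w \<bullet> (x i - sample_mean x n)))"

definition sample_form4 :: "(nat \<Rightarrow> real^'p) \<Rightarrow> nat \<Rightarrow> real^'p \<Rightarrow> real^'p \<Rightarrow> real^'p \<Rightarrow> real^'p \<Rightarrow> real" where
  "sample_form4 x n a b c d = avg n (\<lambda>i. (a \<bullet> (x i - sample_mean x n)) * (b \<bullet> (x i - sample_mean x n)) *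
     (c \<bullet> (x i - sample_mean x n)) * (d \<bullet> (x i - sample_mean x n)))"

lemma linear_avg:
  fixes z :: "nat \<Rightarrow> 'b::real_inner"
  shows "linear (\<lambda>a. avg n (\<lambda>i. (a \<bullet> z i) * c i))"
proof (rule linearI)
  show "avg n (\<lambda>i. ((a + b) \<bullet> z i) * c i) = avg n (\<lambda>i. (a \<bullet> z i) * c i) + avg n (\<lambda>i. (b \<bullet> z i) * c i)" for a b
    by (simp only: inner_add_left distrib_right avg_add)
  show "avg n (\<lambda>i. ((r *\<^sub>R a) \<bullet> z i) * c i) = r *\<^sub>R avg n (\<lambda>i. (a \<bullet> z i) * c i)" for r a
    by (simp only: inner_scaleR_left mult.assoc avg_cmult real_scaleR_def)
qed

lemma bilinear_sample_form2: "bilinear (sample_form2 x n)"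
  unfolding bilinear_def sample_form2_def
proof (intro conjI allI)
  let ?p = "\<lambda>v i. v \<bullet> (x i - sample_mean x n)"
  fix a b
  show "linear (\<lambda>b. avg n (\<lambda>i. ?p a i * ?p b i))"
    using linear_avg[of n _ "?p a"] by (simp only: mult.commute)
  show "linear (\<lambda>a. avg n (\<lambda>i. ?p a i * ?p b i))" by (rule linear_avg)
qed

lemma quadlinear_sample_form4: "quadlinear (sample_form4 x n)"
  unfolding quadlinear_def sample_form4_def
proof (intro conjI allI)
  let ?p = "\<lambda>v i. v \<bullet> (x i - sample_mean x n)"
  fix a b c d
  show "linear (\<lambda>a. avg n (\<lambda>i. ?p a i * ?p b i * ?p c i * ?p d i))"
    using linear_avg[of n _ "\<lambda>i. ?p b i * ?p c i * ?p d i"] by (simp only: mult.assoc)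
  show "linear (\<lambda>b. avg n (\<lambda>i. ?p a i * ?p b i * ?p c i * ?p d i))"
    using linear_avg[of n _ "\<lambda>i. ?p a i * ?p c i * ?p d i"] by (simp only: mult_ac)
  show "linear (\<lambda>c. avg n (\<lambda>i. ?p a i * ?p b i * ?p c i * ?p d i))"
    using linear_avg[of n _ "\<lambda>i. ?p a i * ?p b i * ?p d i"] by (simp only: mult_ac)
  show "linear (\<lambda>d. avg n (\<lambda>i. ?p a i * ?p b i * ?p c i * ?p d i))"
    using linear_avg[of n _ "\<lambda>i. ?p a i * ?p b i * ?p c i"] by (simp only: mult_ac)
qed

lemma sample_kurtosis_form: "sample_kurtosis x n v = sample_form4 x n v v v v / (sample_form2 x n v v)\<^sup>2"
  by (simp add: sample_kurtosis_def sample_form4_def sample_form2_def avg_def power2_eq_square eval_nat_numeral mult_ac)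

text \<open>Recentring at a fixed \<open>m\<close> makes the sample mean enter only through averages
  of \<open>v \<bullet> (x i - m)\<close>, which tend to 0 on a typical sample when \<open>m\<close>
  is the mean.\<close>

lemma inner_centred:
  assumes "n > 0"
  shows "v \<bullet> (x i - sample_mean x n) = v \<bullet> (x i - m) - avg n (\<lambda>i. v \<bullet> (x i - m))"
proof -
  have "avg n (\<lambda>i. v \<bullet> (x i - m)) = avg n (\<lambda>i. v \<bullet> x i) - v \<bullet> m"
    using assms by (simp add: inner_diff_right avg_diff avg_const)
  moreover have "v \<bullet> sample_mean x n = avg n (\<lambda>i. v \<bullet> x i)"
    by (simp add: sample_mean_def avg_def inner_sum_right)
  ultimately show ?thesis by (simp add: inner_diff_right)
qed

lemma sample_form2_tendsto:
  assumes 1: "\<And>v. v \<in> {a, b} \<Longrightarrow> (\<lambda>n. avg n (\<lambda>i. v \<bullet> (x i - m))) \<longlonglongrightarrow> 0"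
    and 2: "(\<lambda>n. avg n (\<lambda>i. (a \<bullet> (x i - m)) * (b \<bullet> (x i - m)))) \<longlonglongrightarrow> l"
  shows "(\<lambda>n. sample_form2 x n a b) \<longlonglongrightarrow> l"
proof -
  let ?p = "\<lambda>v i. v \<bullet> (x i - m)"
  have "(\<lambda>n. avg n (\<lambda>i. ?p a i * ?p b i) - avg n (?p a) * avg n (?p b) - avg n (?p b) * avg n (?p a) + avg n (?p a) * avg n (?p b))
     \<longlonglongrightarrow> l - 0 * 0 - 0 * 0 + 0 * 0"
    by (intro tendsto_intros 1 2) auto
  moreover have "\<forall>\<^sub>F n in sequentially. avg n (\<lambda>i. ?p a i * ?p b i) - avg n (?p a) * avg n (?p b) - avg n (?p b) * avg n (?p a) + avg n (?p a) * avg n (?p b)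
     = sample_form2 x n a b"
    using eventually_gt_at_top[of 0]
    by eventually_elim (simp only: sample_form2_def inner_centred[of _ _ x _ m] avg_centred2)
  ultimately show ?thesis by (simp add: tendsto_cong)
qed

text \<open>After recentring, every correction term carries a factor that tends to 0, so for the
  averages of order two and three bare convergence is enough, whatever the limit.\<close>

lemma sample_form4_tendsto:
  assumes 1: "\<And>v. v \<in> {a, b, c, d} \<Longrightarrow> (\<lambda>n. avg n (\<lambda>i. v \<bullet> (x i - m))) \<longlonglongrightarrow> 0"
    and 2: "\<And>v w. v \<in> {a, b, c, d} \<Longrightarrow> w \<in> {a, b, c, d} \<Longrightarrow> convergent (\<lambda>n. avg n (\<lambda>i. (v \<bullet> (x i - m)) * (w \<bullet> (x i - m))))"
    and 3: "\<And>v w z. v \<in> {a, b, c, d} \<Longrightarrow> w \<in> {a, b, c, d} \<Longrightarrow> z \<in> {a, b, c, d} \<Longrightarrow>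
      convergent (\<lambda>n. avg n (\<lambda>i. (v \<bullet> (x i - m)) * (w \<bullet> (x i - m)) * (z \<bullet> (x i - m))))"
    and 4: "(\<lambda>n. avg n (\<lambda>i. (a \<bullet> (x i - m)) * (b \<bullet> (x i - m)) * (c \<bullet> (x i - m)) * (d \<bullet> (x i - m)))) \<longlonglongrightarrow> l"
  shows "(\<lambda>n. sample_form4 x n a b c d) \<longlonglongrightarrow> l"
proof -
  let ?p = "\<lambda>v i. v \<bullet> (x i - m)"
  define l2 where "l2 v w = lim (\<lambda>n. avg n (\<lambda>i. ?p v i * ?p w i))" for v w
  define l3 where "l3 v w z = lim (\<lambda>n. avg n (\<lambda>i. ?p v i * ?p w i * ?p z i))" for v w z
  have l2: "(\<lambda>n. avg n (\<lambda>i. ?p v i * ?p w i)) \<longlonglongrightarrow> l2 v w" if "v \<in> {a, b, c, d}" "w \<in> {a, b, c, d}" for v w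
    unfolding l2_def using 2[OF that] by (simp only: convergent_LIMSEQ_iff)
  have l3: "(\<lambda>n. avg n (\<lambda>i. ?p v i * ?p w i * ?p z i)) \<longlonglongrightarrow> l3 v w z"
    if "v \<in> {a, b, c, d}" "w \<in> {a, b, c, d}" "z \<in> {a, b, c, d}" for v w z
    unfolding l3_def using 3[OF that] by (simp only: convergent_LIMSEQ_iff)
  let ?A = "\<lambda>n. avg n (?p a)" and ?B = "\<lambda>n. avg n (?p b)" and ?C = "\<lambda>n. avg n (?p c)" and ?D = "\<lambda>n. avg n (?p d)"
  let ?E = "\<lambda>n. avg n (\<lambda>i. ?p a i * ?p b i * ?p c i * ?p d i)
    - ?A n * avg n (\<lambda>i. ?p b i * ?p c i * ?p d i) - ?B n * avg n (\<lambda>i. ?p a i * ?p c i * ?p d i)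
    - ?C n * avg n (\<lambda>i. ?p a i * ?p b i * ?p d i) - ?D n * avg n (\<lambda>i. ?p a i * ?p b i * ?p c i)
    + ?A n * ?B n * avg n (\<lambda>i. ?p c i * ?p d i) + ?A n * ?C n * avg n (\<lambda>i. ?p b i * ?p d i) + ?A n * ?D n * avg n (\<lambda>i. ?p b i * ?p c i)
    + ?B n * ?C n * avg n (\<lambda>i. ?p a i * ?p d i) + ?B n * ?D n * avg n (\<lambda>i. ?p a i * ?p c i) + ?C n * ?D n * avg n (\<lambda>i. ?p a i * ?p b i)
    - ?A n * ?B n * ?C n * ?D n - ?A n * ?B n * ?D n * ?C n - ?A n * ?C n * ?D n * ?B n - ?B n * ?C n * ?D n * ?A n
    + ?A n * ?B n * ?C n * ?D n"
  have "?E \<longlonglongrightarrow> l - 0 * l3 b c d - 0 * l3 a c d - 0 * l3 a b d - 0 * l3 a b c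
     + 0 * 0 * l2 c d + 0 * 0 * l2 b d + 0 * 0 * l2 b c + 0 * 0 * l2 a d + 0 * 0 * l2 a c + 0 * 0 * l2 a b
     - 0 * 0 * 0 * 0 - 0 * 0 * 0 * 0 - 0 * 0 * 0 * 0 - 0 * 0 * 0 * 0 + 0 * 0 * 0 * 0"
    by (intro tendsto_intros 1 4 l2 l3; blast)
  moreover have "\<forall>\<^sub>F n in sequentially. ?E n = sample_form4 x n a b c d"
    using eventually_gt_at_top[of 0]
    by eventually_elim (simp only: sample_form4_def inner_centred[of _ _ x _ m] avg_centred4)
  ultimately show ?thesis by (simp add: tendsto_cong)
qed

lemma sample_kurtosis_scale:
  assumes "c \<noteq> 0"
  shows "sample_kurtosis x n (c *\<^sub>R v) = sample_kurtosis x n v"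
proof -
  have 2: "sample_form2 x n (c *\<^sub>R v) (c *\<^sub>R v) = c\<^sup>2 * sample_form2 x n v v"
    by (simp add: sample_form2_def avg_cmult[symmetric] power2_eq_square mult_ac)
  have 4: "sample_form4 x n (c *\<^sub>R v) (c *\<^sub>R v) (c *\<^sub>R v) (c *\<^sub>R v) = (c\<^sup>2)\<^sup>2 * sample_form4 x n v v v v"
    by (simp add: sample_form4_def avg_cmult[symmetric] power2_eq_square mult_ac)
  show ?thesis
    unfolding sample_kurtosis_form 2 4 using assms by (simp add: power_mult_distrib)
qed

text \<open>By scale invariance a maximiser on the sphere is a local maximiser along every line
  \<open>u + t *\<^sub>R w\<close>, and no Lagrange multiplier appears. Since the kurtosis differs
  from 3, the outer factor in the derivative of the square cancels.\<close>

lemma sample_kurtosis_critical: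
  fixes u w :: "real^'p"
  assumes u: "norm u = 1"
    and max: "\<And>v. norm v = 1 \<Longrightarrow> (sample_kurtosis x n v - 3)\<^sup>2 \<le> (sample_kurtosis x n u - 3)\<^sup>2"
    and pos: "sample_form2 x n u u \<noteq> 0" and ne: "sample_kurtosis x n u \<noteq> 3"
  shows "sample_form2 x n u u * sample_form4 x n u u u w - sample_form4 x n u u u u * sample_form2 x n u w = 0"
proof -
  let ?p = "\<lambda>i. u \<bullet> (x i - sample_mean x n)" and ?q = "\<lambda>i. w \<bullet> (x i - sample_mean x n)"
  define S where "S t = (1 / real n) * (\<Sum>i<n. (?p i + t * ?q i)\<^sup>2)" for t
  define R where "R t = (1 / real n) * (\<Sum>i<n. (?p i + t * ?q i) ^ 4)" for t
  let ?S = "sample_form2 x n u u" and ?T = "sample_form2 x n u w"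
    and ?Q = "sample_form4 x n u u u u" and ?P = "sample_form4 x n u u u w"
  have k: "sample_kurtosis x n (u + t *\<^sub>R w) = R t / (S t)\<^sup>2" for t
    by (simp add: sample_kurtosis_def R_def S_def inner_add_left)
  have S0: "S 0 = ?S" by (simp add: S_def sample_form2_def avg_def power2_eq_square)
  have R0: "R 0 = ?Q" by (simp add: R_def sample_form4_def avg_def eval_nat_numeral mult_ac)
  have dS: "(S has_real_derivative (2 * ?T)) (at 0)"
    unfolding S_def[abs_def] sample_form2_def avg_def
    by (auto intro!: derivative_eq_intros simp: sum_distrib_left mult_ac)
  have dR: "(R has_real_derivative (4 * ?P)) (at 0)"
    unfolding R_def[abs_def] sample_form4_def avg_def
    by (auto intro!: derivative_eq_intros simp: sum_distrib_left mult_ac eval_nat_numeral)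
  define \<phi> where "\<phi> t = (R t / (S t)\<^sup>2 - 3)\<^sup>2" for t
  let ?D = "2 * (?Q / ?S\<^sup>2 - 3) * ((4 * ?P * ?S\<^sup>2 - ?Q * (2 * ?S * (2 * ?T))) / (?S\<^sup>2 * ?S\<^sup>2))"
  have d\<phi>: "(\<phi> has_real_derivative ?D) (at 0)"
    unfolding \<phi>_def[abs_def]
    by (rule derivative_eq_intros dS dR refl | simp add: S0 R0 pos)+ (simp add: field_simps pos)
  have "u \<noteq> 0" using u by auto
  \<comment> \<open>Near t = 0 the line avoids the origin, so its points can be normalised and
    compared with \<open>u\<close>.\<close>
  have "((\<lambda>t. u + t *\<^sub>R w) \<longlongrightarrow> u + 0 *\<^sub>R w) (nhds 0)"
    by (intro tendsto_intros filterlim_ident)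
  then have "\<forall>\<^sub>F t in nhds 0. u + t *\<^sub>R w \<noteq> 0"
    using \<open>u \<noteq> 0\<close> tendsto_imp_eventually_ne[of "\<lambda>t. u + t *\<^sub>R w" "u + 0 *\<^sub>R w" "nhds 0" 0] by simp
  then obtain \<epsilon> where \<epsilon>: "\<epsilon> > 0" "\<And>t. \<bar>t\<bar> < \<epsilon> \<Longrightarrow> u + t *\<^sub>R w \<noteq> 0"
    by (auto simp: eventually_nhds_metric)
  have "?D = 0"
  proof (rule DERIV_local_max[OF d\<phi> \<epsilon>(1)], intro allI impI)
    fix t assume "\<bar>0 - t\<bar> < \<epsilon>"
    then have nz: "u + t *\<^sub>R w \<noteq> 0" using \<epsilon>(2) by simp
    let ?c = "1 / norm (u + t *\<^sub>R w)"
    have "\<phi> t = (sample_kurtosis x n (?c *\<^sub>R (u + t *\<^sub>R w)) - 3)\<^sup>2"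
      unfolding \<phi>_def k[symmetric] using nz by (subst sample_kurtosis_scale) auto
    also have "\<dots> \<le> (sample_kurtosis x n u - 3)\<^sup>2" by (rule max) (use nz in simp)
    also have "\<dots> = \<phi> 0" using k[of 0] by (simp add: \<phi>_def)
    finally show "\<phi> t \<le> \<phi> 0" .
  qed
  moreover have "?Q / ?S\<^sup>2 - 3 \<noteq> 0" using ne by (simp add: sample_kurtosis_form)
  ultimately have "4 * ?P * ?S\<^sup>2 - ?Q * (2 * ?S * (2 * ?T)) = 0" using pos by simp
  then have "4 * ?S * (?S * ?P - ?Q * ?T) = 0" by (simp add: algebra_simps power2_eq_square)
  then show ?thesis using pos by simp
qed

section \<open>The two-component normal mixture\<close>

lemma linear_integral_inner:
  fixes L :: "'b::euclidean_space measure"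
  assumes L: "has_all_moments L" and h: "poly_bounded h"
  shows "linear (\<lambda>a. \<integral>x. (a \<bullet> (x - m)) * h x \<partial>L)"
proof (rule linearI)
  have i: "integrable L (\<lambda>x. (a \<bullet> (x - m)) * h x)" for a
    by (intro integrable_poly_bounded[OF L] poly_bounded_mult h poly_bounded_shift poly_bounded_inner)
  show "(\<integral>x. ((a + b) \<bullet> (x - m)) * h x \<partial>L) = (\<integral>x. (a \<bullet> (x - m)) * h x \<partial>L) + (\<integral>x. (b \<bullet> (x - m)) * h x \<partial>L)" for a b
    using i by (simp add: inner_add_left distrib_right)
  show "(\<integral>x. ((r *\<^sub>R a) \<bullet> (x - m)) * h x \<partial>L) = r *\<^sub>R (\<integral>x. (a \<bullet> (x - m)) * h x \<partial>L)" for r a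
    by (simp add: mult.assoc)
qed

lemma gauss_moments:
  "gauss_moment 0 = 1" "gauss_moment (Suc 0) = 0" "gauss_moment 2 = 1" "gauss_moment 3 = 0"
  "gauss_moment 4 = 3" "gauss_moment 5 = 0" "gauss_moment 6 = 15"
proof -
  show 0: "gauss_moment 0 = 1" using gauss_moment_even[of 0] by simp
  show 2: "gauss_moment 2 = 1" using gauss_moment_step[of 0] 0 by (simp add: numeral_2_eq_2)
  show 4: "gauss_moment 4 = 3" using gauss_moment_step[of 2] 2 by simp
  show "gauss_moment 6 = 15" using gauss_moment_step[of 4] 4 by simp
qed (simp_all add: gauss_moment_odd)

section \<open>The model and its linear algebra\<close>

locale normal_mixture =
  fixes \<mu>\<^sub>1 \<mu>\<^sub>2 :: "real^'p" and \<Sigma> :: "real^'p^'p" and \<alpha> :: real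
  assumes \<alpha>: "0 < \<alpha>" "\<alpha> < 1"
    and \<mu>: "\<mu>\<^sub>1 \<noteq> \<mu>\<^sub>2"
    and cov: "covariance_matrix \<Sigma>" and full_rank: "rank \<Sigma> = CARD('p)"
begin

definition \<delta> :: "real^'p" where "\<delta> = \<mu>\<^sub>2 - \<mu>\<^sub>1"
definition m :: "real^'p" where "m = \<alpha> *\<^sub>R \<mu>\<^sub>1 + (1 - \<alpha>) *\<^sub>R \<mu>\<^sub>2"
definition L :: "(real^'p) measure" where "L = mixture \<alpha> (mvnormal \<mu>\<^sub>1 \<Sigma>) (mvnormal \<mu>\<^sub>2 \<Sigma>)"
definition \<beta> :: real where "\<beta> = \<alpha> * (1 - \<alpha>)"
definition \<theta> :: "real^'p" where "\<theta> = matrix_inv \<Sigma> *v \<delta>"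
definition \<tau> :: real where "\<tau> = \<delta> \<bullet> \<theta>"
definition e :: "real^'p" where "e = (1 / norm \<theta>) *\<^sub>R \<theta>"

lemma \<Sigma>_inv: "\<Sigma> ** matrix_inv \<Sigma> = mat 1" "matrix_inv \<Sigma> ** \<Sigma> = mat 1"
proof -
  have "invertible \<Sigma>"
    using full_rank by (simp add: invertible_det_nz det_eq_0_rank)
  then have "\<exists>A'. \<Sigma> ** A' = mat 1 \<and> A' ** \<Sigma> = mat 1" by (simp add: invertible_def)
  then have "\<Sigma> ** matrix_inv \<Sigma> = mat 1 \<and> matrix_inv \<Sigma> ** \<Sigma> = mat 1"
    unfolding matrix_inv_def by (rule someI_ex)
  then show "\<Sigma> ** matrix_inv \<Sigma> = mat 1" "matrix_inv \<Sigma> ** \<Sigma> = mat 1" by auto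
qed

lemma \<Sigma>_mult_inv: "\<Sigma> *v (matrix_inv \<Sigma> *v v) = v" "matrix_inv \<Sigma> *v (\<Sigma> *v v) = v"
  by (simp_all only: matrix_vector_mul_assoc \<Sigma>_inv matrix_vector_mul_lid)

lemma \<Sigma>_sym: "v \<bullet> (\<Sigma> *v w) = w \<bullet> (\<Sigma> *v v)"
proof -
  have "transpose \<Sigma> = \<Sigma>" using cov by (simp add: covariance_matrix_def)
  then have "v \<bullet> (\<Sigma> *v w) = (\<Sigma> *v v) \<bullet> w" using inner_matrix_mult[of v \<Sigma> w] by simp
  then show ?thesis by (simp add: inner_commute)
qed

lemma inv_sym: "v \<bullet> (matrix_inv \<Sigma> *v w) = w \<bullet> (matrix_inv \<Sigma> *v v)"
  using \<Sigma>_sym[of "matrix_inv \<Sigma> *v v" "matrix_inv \<Sigma> *v w"] by (simp add: \<Sigma>_mult_inv inner_commute)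

text \<open>\<open>covariance_matrix\<close> gives only semidefiniteness. Through a factor
  \<open>A\<close> the form is the squared norm of \<open>transpose A *v v\<close>, and if that
  vector were zero, \<Sigma> would annihilate \<open>v\<close>.\<close>

lemma \<Sigma>_pos: "v \<noteq> 0 \<Longrightarrow> 0 < v \<bullet> (\<Sigma> *v v)"
proof -
  assume v: "v \<noteq> 0"
  from covariance_matrix_factorization[OF cov] obtain A :: "real^'p^'p" where A: "A ** transpose A = \<Sigma>" by blast
  have "v \<bullet> (\<Sigma> *v v) = (norm (transpose A *v v))\<^sup>2"
    unfolding power2_norm_eq_inner by (rule transpose_factor_inner[OF A, symmetric])
  moreover have "transpose A *v v \<noteq> 0"
  proof
    assume "transpose A *v v = 0"
    then have "A *v (transpose A *v v) = 0" by (simp only: matrix_vector_mult_0_right)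
    then have "\<Sigma> *v v = 0" by (simp only: matrix_vector_mul_assoc A)
    then have "matrix_inv \<Sigma> *v (\<Sigma> *v v) = 0" by (simp only: matrix_vector_mult_0_right)
    then show False using v by (simp only: \<Sigma>_mult_inv)
  qed
  ultimately show ?thesis by (simp only: zero_less_power2 norm_eq_zero) blast
qed

lemma \<Sigma>_\<theta>: "\<Sigma> *v \<theta> = \<delta>"
  by (simp add: \<theta>_def \<Sigma>_mult_inv)

lemma \<theta>_nonzero: "\<theta> \<noteq> 0"
  using \<Sigma>_\<theta> \<mu> by (auto simp: \<delta>_def)

lemma \<tau>_pos: "\<tau> > 0"
  using \<Sigma>_pos[OF \<theta>_nonzero] by (simp add: \<Sigma>_\<theta> \<tau>_def inner_commute)

lemma \<beta>_pos: "\<beta> > 0"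
  using \<alpha> by (simp add: \<beta>_def)

lemma norm_e: "norm e = 1"
  using \<theta>_nonzero by (simp add: e_def)

lemma inner_\<Sigma>_e: "v \<bullet> (\<Sigma> *v e) = (v \<bullet> \<delta>) / norm \<theta>"
  by (simp add: e_def matrix_vector_mult_scaleR \<Sigma>_\<theta>)

lemma e_\<delta>: "e \<bullet> \<delta> = \<tau> / norm \<theta>"
  by (simp add: e_def \<tau>_def inner_commute)

lemma e_\<Sigma>_e: "e \<bullet> (\<Sigma> *v e) = \<tau> / (norm \<theta>)\<^sup>2"
  by (simp add: inner_\<Sigma>_e e_\<delta> power2_eq_square)

section \<open>Moments of projections under the mixture law\<close>

lemma
  shows prob_space_L: "prob_space L" and sets_L [simp, measurable_cong]: "sets L = sets borel"
    and moments_L: "has_all_moments L"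
proof -
  show s: "sets L = sets borel" unfolding L_def
    by (subst sets_mixture) (simp_all add: prob_space_mvnormal)
  show "has_all_moments L" unfolding L_def
    using \<alpha> by (intro has_all_moments_mixture prob_space_mvnormal has_all_moments_mvnormal cov) auto
  have sp: "space L = UNIV" using sets_eq_imp_space_eq[OF s] by simp
  have "emeasure L (space L) = 1"
    unfolding sp unfolding L_def
    using \<alpha> prob_space.emeasure_space_1[OF prob_space_mvnormal[of \<mu>\<^sub>1 \<Sigma>]] prob_space.emeasure_space_1[OF prob_space_mvnormal[of \<mu>\<^sub>2 \<Sigma>]]
      sets_eq_imp_space_eq[OF sets_mvnormal[of \<mu>\<^sub>1 \<Sigma>]] sets_eq_imp_space_eq[OF sets_mvnormal[of \<mu>\<^sub>2 \<Sigma>]]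
    by (subst emeasure_mixture) (simp_all add: prob_space_mvnormal ennreal_plus[symmetric] del: ennreal_plus)
  then show "prob_space L" by (rule prob_spaceI)
qed

lemma integrable_L: "poly_bounded h \<Longrightarrow> integrable L h"
  by (rule integrable_poly_bounded[OF moments_L])

lemma integral_L:
  assumes "poly_bounded h"
  shows "(\<integral>x. h x \<partial>L) = \<alpha> * (\<integral>x. h x \<partial>mvnormal \<mu>\<^sub>1 \<Sigma>) + (1 - \<alpha>) * (\<integral>x. h x \<partial>mvnormal \<mu>\<^sub>2 \<Sigma>)"
  unfolding L_def using \<alpha>
  by (intro integral_mixture prob_space_mvnormal integrable_poly_bounded[OF has_all_moments_mvnormal[OF cov] assms]) auto

lemma poly_bounded_centred: "poly_bounded (\<lambda>x. v \<bullet> (x - m))"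
  by (intro poly_bounded_shift poly_bounded_inner)

lemmas pb = poly_bounded_centred poly_bounded_const poly_bounded_mult poly_bounded_add
  poly_bounded_power poly_bounded_uminus poly_bounded_diff

lemma \<mu>_m: "\<mu>\<^sub>1 - m = (- (1 - \<alpha>)) *\<^sub>R \<delta>" "\<mu>\<^sub>2 - m = \<alpha> *\<^sub>R \<delta>"
  by (simp_all add: m_def \<delta>_def algebra_simps)

lemma moment_L:
  "(\<integral>x. (v \<bullet> (x - m)) ^ k \<partial>L) = (\<Sum>i\<le>k. real (k choose i) * (\<alpha> * (- (1 - \<alpha>) * (v \<bullet> \<delta>)) ^ (k - i)
     + (1 - \<alpha>) * (\<alpha> * (v \<bullet> \<delta>)) ^ (k - i)) * (sqrt (v \<bullet> (\<Sigma> *v v)) ^ i * gauss_moment i))"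
proof -
  have "(\<integral>x. (v \<bullet> (x - m)) ^ k \<partial>L) = \<alpha> * (\<integral>x. (v \<bullet> (x - m)) ^ k \<partial>mvnormal \<mu>\<^sub>1 \<Sigma>) + (1 - \<alpha>) * (\<integral>x. (v \<bullet> (x - m)) ^ k \<partial>mvnormal \<mu>\<^sub>2 \<Sigma>)"
    by (intro integral_L pb)
  then show ?thesis
    by (simp add: moment_mvnormal[OF cov] \<mu>_m sum_distrib_left sum.distrib[symmetric] distrib_left distrib_right mult_ac)
qed

text \<open>A centred projection is distributed as a Gaussian of variance \<open>s\<close> plus an
  independent two-point variable with values \<open>- (1 - \<alpha>) * D\<close> and
  \<open>\<alpha> * D\<close>. The even moments of the latter are polynomials in \<beta>, whereas
  the third keeps the asymmetry 2 \<alpha> - 1.\<close>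

lemma moments_L_explicit:
  fixes v :: "real^'p"
  defines "s \<equiv> v \<bullet> (\<Sigma> *v v)" and "D \<equiv> v \<bullet> \<delta>"
  shows "(\<integral>x. v \<bullet> (x - m) \<partial>L) = 0"
    and "(\<integral>x. (v \<bullet> (x - m)) ^ 2 \<partial>L) = s + \<beta> * D\<^sup>2"
    and "(\<integral>x. (v \<bullet> (x - m)) ^ 3 \<partial>L) = \<beta> * (2 * \<alpha> - 1) * D ^ 3"
    and "(\<integral>x. (v \<bullet> (x - m)) ^ 4 \<partial>L) = 3 * s\<^sup>2 + 6 * s * \<beta> * D\<^sup>2 + \<beta> * (1 - 3 * \<beta>) * D ^ 4"
    and "(\<integral>x. (v \<bullet> (x - m)) ^ 6 \<partial>L) = 15 * s ^ 3 + 45 * s\<^sup>2 * \<beta> * D\<^sup>2 + 15 * s * \<beta> * (1 - 3 * \<beta>) * D ^ 4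
       + \<beta> * (1 - 5 * \<beta> + 5 * \<beta>\<^sup>2) * D ^ 6"
proof -
  have "0 \<le> s" unfolding s_def using \<Sigma>_pos[of v] by (cases "v = 0") auto
  then have r: "sqrt s * sqrt s = s" by simp
  have r2: "sqrt s ^ 2 = s" "sqrt s ^ 4 = s ^ 2" "sqrt s ^ 6 = s ^ 3"
    using r by (simp_all add: eval_nat_numeral mult_ac)
  note M = moment_L[of v, folded s_def D_def]
  have b0: "{..2::nat} = {0, 1, 2}" "{..3::nat} = {0, 1, 2, 3}" "{..4::nat} = {0, 1, 2, 3, 4}" "{..6::nat} = {0, 1, 2, 3, 4, 5, 6}" by auto
  have c: "6 choose 2 = (15::nat)" "6 choose 4 = (15::nat)" "4 choose 2 = (6::nat)" "3 choose 2 = (3::nat)"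
    by (simp_all add: eval_nat_numeral)
  show "(\<integral>x. v \<bullet> (x - m) \<partial>L) = 0"
    using M[of 1] by (simp add: gauss_moments algebra_simps)
  show "(\<integral>x. (v \<bullet> (x - m)) ^ 2 \<partial>L) = s + \<beta> * D\<^sup>2"
    unfolding M b0 by (simp add: gauss_moments c r2) (simp add: \<beta>_def algebra_simps power2_eq_square)
  show "(\<integral>x. (v \<bullet> (x - m)) ^ 3 \<partial>L) = \<beta> * (2 * \<alpha> - 1) * D ^ 3"
    unfolding M b0 by (simp add: gauss_moments c r2) (simp add: \<beta>_def algebra_simps eval_nat_numeral)
  show "(\<integral>x. (v \<bullet> (x - m)) ^ 4 \<partial>L) = 3 * s\<^sup>2 + 6 * s * \<beta> * D\<^sup>2 + \<beta> * (1 - 3 * \<beta>) * D ^ 4"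
    unfolding M b0 by (simp add: gauss_moments c r2) (simp add: \<beta>_def algebra_simps eval_nat_numeral)
  show "(\<integral>x. (v \<bullet> (x - m)) ^ 6 \<partial>L) = 15 * s ^ 3 + 45 * s\<^sup>2 * \<beta> * D\<^sup>2 + 15 * s * \<beta> * (1 - 3 * \<beta>) * D ^ 4
       + \<beta> * (1 - 5 * \<beta> + 5 * \<beta>\<^sup>2) * D ^ 6"
    unfolding M b0 by (simp add: gauss_moments c r2) (simp add: \<beta>_def algebra_simps eval_nat_numeral)
qed

text \<open>The condition \<open>q \<bullet> \<delta> = 0\<close> gives both components the same
  mean in direction \<open>q\<close>, and they share \<Sigma>; so the factorisation in each
  component has a common factor and passes to the mixture.\<close>

lemma mixed_moment_L:
  assumes orth: "p \<bullet> (\<Sigma> *v q) = 0" and q: "q \<bullet> \<delta> = 0"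
  shows "(\<integral>x. (p \<bullet> (x - m)) ^ k * (q \<bullet> (x - m)) \<partial>L) = 0"
    and "(\<integral>x. (p \<bullet> (x - m)) ^ k * (q \<bullet> (x - m))\<^sup>2 \<partial>L) = (\<integral>x. (p \<bullet> (x - m)) ^ k \<partial>L) * (q \<bullet> (\<Sigma> *v q))"
proof -
  have q': "q \<bullet> (\<mu>\<^sub>1 - m) = 0" "q \<bullet> (\<mu>\<^sub>2 - m) = 0" unfolding \<mu>_m using q by simp_all
  have 1: "(\<integral>x. (p \<bullet> (x - m)) ^ k * (q \<bullet> (x - m)) \<partial>L) = \<alpha> * (\<integral>x. (p \<bullet> (x - m)) ^ k * (q \<bullet> (x - m)) \<partial>mvnormal \<mu>\<^sub>1 \<Sigma>)
     + (1 - \<alpha>) * (\<integral>x. (p \<bullet> (x - m)) ^ k * (q \<bullet> (x - m)) \<partial>mvnormal \<mu>\<^sub>2 \<Sigma>)"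
    by (intro integral_L pb)
  show "(\<integral>x. (p \<bullet> (x - m)) ^ k * (q \<bullet> (x - m)) \<partial>L) = 0"
    unfolding 1 mixed_moment_mvnormal(1)[OF cov orth q'(1)] mixed_moment_mvnormal(1)[OF cov orth q'(2)] by simp
  have 2: "(\<integral>x. (p \<bullet> (x - m)) ^ k * (q \<bullet> (x - m))\<^sup>2 \<partial>L) = \<alpha> * (\<integral>x. (p \<bullet> (x - m)) ^ k * (q \<bullet> (x - m))\<^sup>2 \<partial>mvnormal \<mu>\<^sub>1 \<Sigma>)
     + (1 - \<alpha>) * (\<integral>x. (p \<bullet> (x - m)) ^ k * (q \<bullet> (x - m))\<^sup>2 \<partial>mvnormal \<mu>\<^sub>2 \<Sigma>)"
    by (intro integral_L pb)
  have 3: "(\<integral>x. (p \<bullet> (x - m)) ^ k \<partial>L) = \<alpha> * (\<integral>x. (p \<bullet> (x - m)) ^ k \<partial>mvnormal \<mu>\<^sub>1 \<Sigma>)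
     + (1 - \<alpha>) * (\<integral>x. (p \<bullet> (x - m)) ^ k \<partial>mvnormal \<mu>\<^sub>2 \<Sigma>)"
    by (intro integral_L pb)
  show "(\<integral>x. (p \<bullet> (x - m)) ^ k * (q \<bullet> (x - m))\<^sup>2 \<partial>L) = (\<integral>x. (p \<bullet> (x - m)) ^ k \<partial>L) * (q \<bullet> (\<Sigma> *v q))"
    unfolding 2 3 mixed_moment_mvnormal(2)[OF cov orth q'(1)] mixed_moment_mvnormal(2)[OF cov orth q'(2)] by (simp add: algebra_simps)
qed

definition M2 :: "real^'p \<Rightarrow> real^'p \<Rightarrow> real" where
  "M2 v w = (\<integral>x. (v \<bullet> (x - m)) * (w \<bullet> (x - m)) \<partial>L)"

definition M4 :: "real^'p \<Rightarrow> real^'p \<Rightarrow> real^'p \<Rightarrow> real^'p \<Rightarrow> real" where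
  "M4 a b c d = (\<integral>x. (a \<bullet> (x - m)) * (b \<bullet> (x - m)) * (c \<bullet> (x - m)) * (d \<bullet> (x - m)) \<partial>L)"

lemma bilinear_M2: "bilinear M2"
  unfolding bilinear_def M2_def
proof (intro conjI allI)
  fix a b
  show "linear (\<lambda>a. \<integral>x. (a \<bullet> (x - m)) * (b \<bullet> (x - m)) \<partial>L)"
    by (intro linear_integral_inner moments_L pb)
  then show "linear (\<lambda>b. \<integral>x. (a \<bullet> (x - m)) * (b \<bullet> (x - m)) \<partial>L)"
    using linear_integral_inner[OF moments_L, of "\<lambda>x. a \<bullet> (x - m)" m] by (simp only: mult.commute pb)
qed

lemma quadlinear_M4: "quadlinear M4"
  unfolding quadlinear_def M4_def
proof (intro conjI allI)
  fix a b c d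
  note l = linear_integral_inner[OF moments_L poly_bounded_mult[OF poly_bounded_mult], OF poly_bounded_centred poly_bounded_centred poly_bounded_centred, of m]
  show "linear (\<lambda>a. \<integral>x. (a \<bullet> (x - m)) * (b \<bullet> (x - m)) * (c \<bullet> (x - m)) * (d \<bullet> (x - m)) \<partial>L)"
    using l[of b c d] by (simp only: mult_ac)
  show "linear (\<lambda>b. \<integral>x. (a \<bullet> (x - m)) * (b \<bullet> (x - m)) * (c \<bullet> (x - m)) * (d \<bullet> (x - m)) \<partial>L)"
    using l[of a c d] by (simp only: mult_ac)
  show "linear (\<lambda>c. \<integral>x. (a \<bullet> (x - m)) * (b \<bullet> (x - m)) * (c \<bullet> (x - m)) * (d \<bullet> (x - m)) \<partial>L)"
    using l[of a b d] by (simp only: mult_ac)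
  show "linear (\<lambda>d. \<integral>x. (a \<bullet> (x - m)) * (b \<bullet> (x - m)) * (c \<bullet> (x - m)) * (d \<bullet> (x - m)) \<partial>L)"
    using l[of a b c] by (simp only: mult_ac)
qed

lemma M2_diag: "M2 v v = v \<bullet> (\<Sigma> *v v) + \<beta> * (v \<bullet> \<delta>)\<^sup>2"
  unfolding M2_def moments_L_explicit(2)[symmetric] by (simp add: power2_eq_square)

lemma M4_diag: "M4 v v v v = 3 * (v \<bullet> (\<Sigma> *v v))\<^sup>2 + 6 * (v \<bullet> (\<Sigma> *v v)) * \<beta> * (v \<bullet> \<delta>)\<^sup>2 + \<beta> * (1 - 3 * \<beta>) * (v \<bullet> \<delta>) ^ 4"
  unfolding M4_def moments_L_explicit(4)[symmetric] by (simp add: eval_nat_numeral mult_ac)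

lemma M2_pos: "v \<noteq> 0 \<Longrightarrow> 0 < M2 v v"
  unfolding M2_diag using \<Sigma>_pos[of v] \<beta>_pos by (simp add: add_pos_nonneg)

text \<open>Split \<eta> into a multiple of \<open>w\<close> and a part orthogonal to
  \<open>w\<close> for \<Sigma>; \<open>mixed_moment_L\<close> annihilates the second part.\<close>

lemma M2_orth:
  assumes "w \<bullet> \<delta> = 0"
  shows "M2 \<eta> w = \<eta> \<bullet> (\<Sigma> *v w)"
proof (cases "w = 0")
  case False
  define r where "r = (\<eta> \<bullet> (\<Sigma> *v w)) / (w \<bullet> (\<Sigma> *v w))"
  define \<eta>' where "\<eta>' = \<eta> - r *\<^sub>R w"
  have r: "r * (w \<bullet> (\<Sigma> *v w)) = \<eta> \<bullet> (\<Sigma> *v w)" using \<Sigma>_pos[OF False] by (simp add: r_def)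
  then have o: "\<eta>' \<bullet> (\<Sigma> *v w) = 0" by (simp add: \<eta>'_def inner_diff_left)
  have "M2 \<eta> w = M2 \<eta>' w + r * M2 w w"
    unfolding \<eta>'_def by (simp add: linear_diff[OF bilinearD(1)[OF bilinear_M2]] linear_scale[OF bilinearD(1)[OF bilinear_M2]])
  moreover have "M2 \<eta>' w = 0" using mixed_moment_L(1)[OF o assms, of 1] by (simp add: M2_def)
  moreover have "M2 w w = w \<bullet> (\<Sigma> *v w)" using assms by (simp add: M2_diag)
  ultimately show ?thesis using r by simp
qed (simp add: M2_def)

text \<open>The splitting of \<open>M2_orth\<close> again: the multiple of \<open>w\<close> gives
  the product by \<open>mixed_moment_L(2)\<close>. The orthogonal part vanishes, but only after
  polarisation, since \<open>mixed_moment_L\<close> speaks of powers of a single linear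
  form.\<close>

lemma M4_orth:
  assumes w: "w \<bullet> \<delta> = 0" and e: "e \<bullet> (\<Sigma> *v w) = 0"
  shows "M4 \<eta> e e w = M2 e e * (\<eta> \<bullet> (\<Sigma> *v w))"
proof (cases "w = 0")
  case False
  define r where "r = (\<eta> \<bullet> (\<Sigma> *v w)) / (w \<bullet> (\<Sigma> *v w))"
  define \<eta>' where "\<eta>' = \<eta> - r *\<^sub>R w"
  have r: "r * (w \<bullet> (\<Sigma> *v w)) = \<eta> \<bullet> (\<Sigma> *v w)" using \<Sigma>_pos[OF False] by (simp add: r_def)
  then have o: "\<eta>' \<bullet> (\<Sigma> *v w) = 0" by (simp add: \<eta>'_def inner_diff_left)
  have "M4 \<eta> e e w = M4 \<eta>' e e w + r * M4 w e e w"
    unfolding \<eta>'_def by (simp add: linear_diff[OF quadlinearD(1)[OF quadlinear_M4]] linear_scale[OF quadlinearD(1)[OF quadlinear_M4]])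
  moreover have "M4 \<eta>' e e w = 0"
  proof -
    let ?I = "\<lambda>v x. (v \<bullet> (x - m)) ^ 3 * (w \<bullet> (x - m))"
    have 0: "(\<integral>x. ?I v x \<partial>L) = 0" if "v \<bullet> (\<Sigma> *v w) = 0" for v
      by (rule mixed_moment_L(1)[OF that w])
    have i: "integrable L (?I v)" for v by (intro integrable_L pb)
    \<comment> \<open>With a and b the values of \<open>e\<close> and \<open>\<eta>'\<close> on the
      centred observation, 6 a^2 b = (a + b)^3 - (a - b)^3 - 2 b^3.\<close>
    have "6 * M4 \<eta>' e e w = (\<integral>x. 6 * ((\<eta>' \<bullet> (x - m)) * (e \<bullet> (x - m)) * (e \<bullet> (x - m)) * (w \<bullet> (x - m))) \<partial>L)"
      by (simp add: M4_def)
    also have "\<dots> = (\<integral>x. ?I (e + \<eta>') x - ?I (e - \<eta>') x - 2 * ?I \<eta>' x \<partial>L)"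
      by (intro Bochner_Integration.integral_cong refl) (simp add: inner_add_left inner_diff_left eval_nat_numeral algebra_simps)
    also have "\<dots> = (\<integral>x. ?I (e + \<eta>') x \<partial>L) - (\<integral>x. ?I (e - \<eta>') x \<partial>L) - 2 * (\<integral>x. ?I \<eta>' x \<partial>L)"
      using i by simp
    also have "\<dots> = 0"
    proof -
      have "(e + \<eta>') \<bullet> (\<Sigma> *v w) = 0" "(e - \<eta>') \<bullet> (\<Sigma> *v w) = 0"
        using e o by (simp_all only: inner_add_left inner_diff_left)
      then show ?thesis by (simp only: 0 o)
    qed
    finally show ?thesis by simp
  qed
  moreover have "M4 w e e w = M2 e e * (w \<bullet> (\<Sigma> *v w))"
    using mixed_moment_L(2)[OF e w, of 2] by (simp add: M4_def M2_def power2_eq_square mult_ac)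
  ultimately show ?thesis using r by (simp add: mult_ac)
qed (simp add: M4_def)

text \<open>\<open>r\<close> is the residual of projecting \<open>v\<close> onto \<theta> in the
  inner product given by \<Sigma>, and \<tau> times its squared length is the gap. It is nonzero
  because the only unit multiples of \<theta> are \<open>e\<close> and \<open>- e\<close>.\<close>

lemma cauchy_schwarz_strict:
  assumes v: "norm v = 1" "v \<noteq> e" "v \<noteq> - e"
  shows "(v \<bullet> \<delta>)\<^sup>2 < \<tau> * (v \<bullet> (\<Sigma> *v v))"
proof -
  define r where "r = v - ((v \<bullet> \<delta>) / \<tau>) *\<^sub>R \<theta>"
  have "r \<noteq> 0"
  proof
    assume "r = 0"
    then have "v = ((v \<bullet> \<delta>) / \<tau>) *\<^sub>R \<theta>" by (simp add: r_def)
    also have "\<dots> = ((v \<bullet> \<delta>) / \<tau> * norm \<theta>) *\<^sub>R e" using \<theta>_nonzero by (simp add: e_def)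
    finally obtain k where k: "v = k *\<^sub>R e" by blast
    then have "\<bar>k\<bar> = 1" using v(1) norm_e by simp
    then have "k = 1 \<or> k = -1" by linarith
    then show False using k v by auto
  qed
  have "\<tau> * (r \<bullet> (\<Sigma> *v r)) = \<tau> * (v \<bullet> (\<Sigma> *v v)) - (v \<bullet> \<delta>)\<^sup>2"
  proof -
    have "\<Sigma> *v r = \<Sigma> *v v - ((v \<bullet> \<delta>) / \<tau>) *\<^sub>R \<delta>"
      by (simp add: r_def matrix_vector_mult_diff_distrib matrix_vector_mult_scaleR \<Sigma>_\<theta>)
    then have "r \<bullet> (\<Sigma> *v r) = v \<bullet> (\<Sigma> *v v) - 2 * ((v \<bullet> \<delta>) / \<tau>) * (v \<bullet> \<delta>) + ((v \<bullet> \<delta>) / \<tau>) * ((v \<bullet> \<delta>) / \<tau>) * \<tau>"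
      using \<Sigma>_sym[of \<theta> v]
      by (simp add: r_def inner_diff_left inner_diff_right \<Sigma>_\<theta> \<tau>_def inner_commute algebra_simps)
    then show ?thesis using \<tau>_pos by (simp add: field_simps power2_eq_square)
  qed
  moreover have "0 < \<tau> * (r \<bullet> (\<Sigma> *v r))" using \<tau>_pos \<Sigma>_pos[OF \<open>r \<noteq> 0\<close>] by simp
  ultimately show ?thesis by simp
qed

definition K0 :: "real^'p \<Rightarrow> real" where
  "K0 v = (M4 v v v v / (M2 v v)\<^sup>2 - 3)\<^sup>2"

text \<open>Subtracting three times the squared variance cancels every term with the Gaussian
  variance and leaves the fourth cumulant of the two-point part; 1 - 6 \<beta> arises as (1 - 3
  \<beta>) - 3 \<beta>.\<close>

lemma K0_eq:
  assumes "v \<noteq> 0"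
  shows "K0 v = (\<beta> * (1 - 6 * \<beta>))\<^sup>2 * ((v \<bullet> \<delta>)\<^sup>2 / M2 v v) ^ 4"
proof -
  have "M2 v v \<noteq> 0" using M2_pos[OF assms] by simp
  moreover have "M4 v v v v - 3 * (M2 v v)\<^sup>2 = \<beta> * (1 - 6 * \<beta>) * (v \<bullet> \<delta>) ^ 4"
    unfolding M4_diag M2_diag by (simp add: power2_eq_square eval_nat_numeral algebra_simps)
  ultimately have "M4 v v v v / (M2 v v)\<^sup>2 - 3 = \<beta> * (1 - 6 * \<beta>) * ((v \<bullet> \<delta>)\<^sup>2 / M2 v v)\<^sup>2"
    by (simp add: field_simps)
  then show ?thesis by (simp add: K0_def power_mult_distrib)
qed

lemma K0_less:
  assumes b: "1 - 6 * \<beta> \<noteq> 0" and v: "norm v = 1" "v \<noteq> e" "v \<noteq> - e"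
  shows "K0 v < K0 e"
proof -
  have "v \<noteq> 0" "e \<noteq> 0" using v norm_e by auto
  note p = M2_pos[OF \<open>v \<noteq> 0\<close>] M2_pos[OF \<open>e \<noteq> 0\<close>]
  have e: "(e \<bullet> \<delta>)\<^sup>2 / M2 e e = \<tau> / (1 + \<beta> * \<tau>)"
  proof -
    have "M2 e e = \<tau> * (1 + \<beta> * \<tau>) / (norm \<theta>)\<^sup>2"
      unfolding M2_diag e_\<Sigma>_e e_\<delta> power_divide by (simp add: add_divide_distrib distrib_left power2_eq_square mult_ac)
    then have "(e \<bullet> \<delta>)\<^sup>2 / M2 e e = \<tau>\<^sup>2 / (\<tau> * (1 + \<beta> * \<tau>))" using \<theta>_nonzero by (simp add: e_\<delta> power_divide)
    then show ?thesis using \<tau>_pos by (simp add: power2_eq_square)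
  qed
  \<comment> \<open>Adding \<open>\<beta> * \<tau> * (v \<bullet> \<delta>)\<^sup>2\<close> to both
    sides of the strict inequality replaces the Gaussian variance by \<open>M2 v v\<close> and
    produces the ratio that \<open>e\<close> attains.\<close>
  have "(v \<bullet> \<delta>)\<^sup>2 * (1 + \<beta> * \<tau>) < \<tau> * M2 v v"
    using cauchy_schwarz_strict[OF v] by (simp add: M2_diag algebra_simps)
  then have "(v \<bullet> \<delta>)\<^sup>2 / M2 v v < (e \<bullet> \<delta>)\<^sup>2 / M2 e e"
  proof -
    have "0 < 1 + \<beta> * \<tau>" using \<tau>_pos \<beta>_pos by (simp add: add_pos_pos)
    with \<open>(v \<bullet> \<delta>)\<^sup>2 * (1 + \<beta> * \<tau>) < \<tau> * M2 v v\<close> show ?thesis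
      unfolding e using p(1) by (simp only: pos_divide_less_eq times_divide_eq_left pos_less_divide_eq)
  qed
  then have "((v \<bullet> \<delta>)\<^sup>2 / M2 v v) ^ 4 < ((e \<bullet> \<delta>)\<^sup>2 / M2 e e) ^ 4"
    using p by (intro power_strict_mono) auto
  then show ?thesis
    unfolding K0_eq[OF \<open>v \<noteq> 0\<close>] K0_eq[OF \<open>e \<noteq> 0\<close>]
    using b \<beta>_pos by (intro mult_strict_left_mono) auto
qed

section \<open>Tangent directions and the influence function\<close>

definition proj :: "real^'p \<Rightarrow> real^'p" where "proj T = T - (T \<bullet> e) *\<^sub>R e"
text \<open>Chosen so that \<open>\<Sigma> *v dual T = proj T\<close>: the pairing
  \<open>\<eta> \<bullet> (\<Sigma> *v dual T)\<close> reads off the tangential component of \<eta>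
  along \<open>T\<close>. Both conditions of \<open>M4_orth\<close> hold because \<theta> and
  \<open>e\<close> have no tangential part.\<close>

definition dual :: "real^'p \<Rightarrow> real^'p" where "dual T = matrix_inv \<Sigma> *v proj T"

lemma e_e: "e \<bullet> e = 1"
  using norm_e by (simp add: norm_eq_1)

lemma proj_self_adjoint: "proj v \<bullet> w = v \<bullet> proj w"
  by (simp add: proj_def inner_diff_left inner_diff_right inner_commute)

lemma \<Sigma>_dual: "\<Sigma> *v dual T = proj T"
  by (simp add: dual_def \<Sigma>_mult_inv)

lemma dual_inner: "dual T \<bullet> y = T \<bullet> proj (matrix_inv \<Sigma> *v y)"
  unfolding dual_def proj_self_adjoint[symmetric] by (subst inner_commute) (rule inv_sym)

lemma proj_e: "proj e = 0"
  by (simp add: proj_def e_e)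

lemma proj_\<theta>: "proj \<theta> = 0"
proof -
  have "\<theta> = norm \<theta> *\<^sub>R e" using \<theta>_nonzero by (simp add: e_def)
  then show ?thesis using e_e by (metis inner_scaleR_left mult.right_neutral proj_def cancel_comm_monoid_add_class.diff_cancel)
qed

lemma dual_\<delta>: "dual T \<bullet> \<delta> = 0"
  unfolding dual_inner \<theta>_def[symmetric] proj_\<theta> by simp

lemma e_\<Sigma>_dual: "e \<bullet> (\<Sigma> *v dual T) = 0"
  by (simp add: \<Sigma>_dual proj_self_adjoint[symmetric] proj_e)

text \<open>
  In tangent directions, the derivative at \<open>e\<close> of the limiting first-order condition tested against
  \<open>dual T\<close> is \<open>- c0\<close> times the component along \<open>T\<close>, and \<open>\<psi>\<close> is the resulting influence function.
\<close>

definition c0 :: real where "c0 = M4 e e e e - 3 * (M2 e e)\<^sup>2"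
text \<open>Enters through centring at the sample mean: the recentred fourth-order form contains
  minus the average cube times the average of \<open>dual T \<bullet> (x i - m)\<close>, and this
  has the same order as the leading terms.\<close>

definition \<mu>3 :: real where "\<mu>3 = (\<integral>x. (e \<bullet> (x - m)) ^ 3 \<partial>L)"

lemma c0_eq: "c0 = \<beta> * (1 - 6 * \<beta>) * (e \<bullet> \<delta>) ^ 4"
  unfolding c0_def M4_diag M2_diag by (simp add: power2_eq_square eval_nat_numeral algebra_simps)

lemma c0_nonzero: "1 - 6 * \<beta> \<noteq> 0 \<Longrightarrow> c0 \<noteq> 0"
  using \<beta>_pos \<tau>_pos \<theta>_nonzero by (simp add: c0_eq e_\<delta>)

definition \<psi> :: "real^'p \<Rightarrow> real^'p" where
  "\<psi> x = ((M2 e e * (e \<bullet> (x - m)) ^ 3 - M4 e e e e * (e \<bullet> (x - m)) - M2 e e * \<mu>3) / c0) *\<^sub>R proj (matrix_inv \<Sigma> *v (x - m))"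

lemma inner_\<psi>: "T \<bullet> \<psi> x = (M2 e e * (e \<bullet> (x - m)) ^ 3 - M4 e e e e * (e \<bullet> (x - m)) - M2 e e * \<mu>3) / c0 * (dual T \<bullet> (x - m))"
  by (simp add: \<psi>_def dual_inner)

lemma poly_bounded_\<psi>: "poly_bounded (\<lambda>x. T \<bullet> \<psi> x)"
  unfolding inner_\<psi> divide_inverse by (intro pb)

lemma integral_powers_dual: "(\<integral>x. (e \<bullet> (x - m)) ^ k * (dual T \<bullet> (x - m)) \<partial>L) = 0"
  by (rule mixed_moment_L(1)[OF e_\<Sigma>_dual dual_\<delta>])

lemma integral_\<psi>: "(\<integral>x. T \<bullet> \<psi> x \<partial>L) = 0"
proof -
  have i: "integrable L (\<lambda>x. (e \<bullet> (x - m)) ^ k * (dual T \<bullet> (x - m)))" for k by (intro integrable_L pb)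
  have "(\<integral>x. T \<bullet> \<psi> x \<partial>L) = (\<integral>x. (M2 e e / c0) * ((e \<bullet> (x - m)) ^ 3 * (dual T \<bullet> (x - m)))
     - (M4 e e e e / c0) * ((e \<bullet> (x - m)) ^ 1 * (dual T \<bullet> (x - m)))
     - (M2 e e * \<mu>3 / c0) * ((e \<bullet> (x - m)) ^ 0 * (dual T \<bullet> (x - m))) \<partial>L)"
    unfolding inner_\<psi> by (intro Bochner_Integration.integral_cong refl) (simp add: diff_divide_distrib left_diff_distrib)
  also have "\<dots> = 0"
    by (simp only: Bochner_Integration.integral_diff Bochner_Integration.integrable_diff integrable_mult_right i integral_mult_right_zero integral_powers_dual mult_zero_right diff_self)
  finally show ?thesis .
qed

text \<open>The factor \<open>dual T \<bullet> (x - m)\<close> splits off with its variance, which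
  leaves the second moment of a cubic in \<open>e \<bullet> (x - m)\<close>. Because the fourth
  moment is \<open>Q\<close> and the third is \<mu>3, the cross terms reduce it to
  \<open>S\<^sup>2\<close> times the sixth moment minus \<open>Q\<^sup>2 * S\<close> and
  \<open>S\<^sup>2 * \<mu>3\<^sup>2\<close>.\<close>

lemma variance_\<psi>:
  assumes b: "1 - 6 * \<beta> \<noteq> 0"
  shows "(\<integral>x. (T \<bullet> \<psi> x)\<^sup>2 \<partial>L) =
    (6 + 24 * \<beta> * \<tau> + 9 * \<beta> * (1 - 2 * \<beta>) * \<tau>\<^sup>2 + \<beta> * (1 - 3 * \<beta>) * \<tau> ^ 3) / (\<beta> * \<tau> ^ 3 * (1 - 6 * \<beta>)\<^sup>2)
      * ((1 + \<beta> * \<tau>) / ((norm \<theta>)\<^sup>2 * \<beta>)) * (proj T \<bullet> (matrix_inv \<Sigma> *v proj T))"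
proof -
  define S Q where "S = M2 e e" and "Q = M4 e e e e"
  let ?V = "dual T \<bullet> (\<Sigma> *v dual T)"
  define E where "E k = (\<integral>x. (e \<bullet> (x - m)) ^ k * (dual T \<bullet> (x - m))\<^sup>2 \<partial>L)" for k
  have i: "integrable L (\<lambda>x. (e \<bullet> (x - m)) ^ k * (dual T \<bullet> (x - m))\<^sup>2)" for k by (intro integrable_L pb)
  have E: "E k = (\<integral>x. (e \<bullet> (x - m)) ^ k \<partial>L) * ?V" for k
    unfolding E_def by (rule mixed_moment_L(2)[OF e_\<Sigma>_dual dual_\<delta>])
  have V: "?V = proj T \<bullet> (matrix_inv \<Sigma> *v proj T)"
    unfolding \<Sigma>_dual unfolding dual_def by (rule inner_commute)
  \<comment> \<open>With \<open>h\<close> the Gaussian variance along \<open>e\<close>, the squared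
    mean shift is \<open>h * \<tau>\<close>. So the moment of order 2 k is \<open>h ^ k\<close>
    times a polynomial in \<beta> and \<tau>, and \<open>h ^ 5\<close> factors out of the
    variance.\<close>
  define h where "h = \<tau> / (norm \<theta>)\<^sup>2"
  have h: "h > 0" using \<tau>_pos \<theta>_nonzero by (simp add: h_def)
  have s: "e \<bullet> (\<Sigma> *v e) = h" and D: "(e \<bullet> \<delta>)\<^sup>2 = h * \<tau>"
    by (simp_all add: h_def e_\<Sigma>_e e_\<delta> power_divide power2_eq_square)
  have D4: "(e \<bullet> \<delta>) ^ 4 = (h * \<tau>)\<^sup>2" and D6: "(e \<bullet> \<delta>) ^ 6 = (h * \<tau>) ^ 3"
    unfolding D[symmetric] by (simp_all flip: power_mult)
  have S: "S = h * (1 + \<beta> * \<tau>)"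
    unfolding S_def M2_diag s D by (simp add: algebra_simps)
  have Q: "Q = h\<^sup>2 * (3 + 6 * \<beta> * \<tau> + \<beta> * (1 - 3 * \<beta>) * \<tau>\<^sup>2)"
    unfolding Q_def M4_diag s D D4 by (simp add: algebra_simps power2_eq_square)
  have m6: "(\<integral>x. (e \<bullet> (x - m)) ^ 6 \<partial>L) = h ^ 3 * (15 + 45 * \<beta> * \<tau> + 15 * \<beta> * (1 - 3 * \<beta>) * \<tau>\<^sup>2 + \<beta> * (1 - 5 * \<beta> + 5 * \<beta>\<^sup>2) * \<tau> ^ 3)"
    unfolding moments_L_explicit s D D4 D6 by (simp add: algebra_simps eval_nat_numeral)
  \<comment> \<open>The third moment has the sign of 2 \<alpha> - 1, which \<beta> does not
    determine; its square is expressible because (2 \<alpha> - 1)^2 = 1 - 4 \<beta>.\<close>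
  have m3: "\<mu>3\<^sup>2 = \<beta>\<^sup>2 * (1 - 4 * \<beta>) * (h * \<tau>) ^ 3"
  proof -
    have "\<mu>3\<^sup>2 = \<beta>\<^sup>2 * (2 * \<alpha> - 1)\<^sup>2 * (e \<bullet> \<delta>) ^ 6"
      unfolding \<mu>3_def moments_L_explicit by (simp add: power_mult_distrib flip: power_mult)
    also have "(2 * \<alpha> - 1)\<^sup>2 = 1 - 4 * \<beta>" by (simp add: \<beta>_def power2_eq_square algebra_simps)
    finally show ?thesis unfolding D6 .
  qed
  have c: "c0 = \<beta> * (1 - 6 * \<beta>) * (h * \<tau>)\<^sup>2" unfolding c0_eq D4 ..
  have square: "((S * a ^ 3 - Q * a - S * \<mu>3) / c0 * w)\<^sup>2 = (1 / c0\<^sup>2) * (S\<^sup>2 * (a ^ 6 * w\<^sup>2)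
     - 2 * S * Q * (a ^ 4 * w\<^sup>2) - 2 * S\<^sup>2 * \<mu>3 * (a ^ 3 * w\<^sup>2)
     + Q\<^sup>2 * (a ^ 2 * w\<^sup>2) + 2 * Q * S * \<mu>3 * (a ^ 1 * w\<^sup>2) + S\<^sup>2 * \<mu>3\<^sup>2 * (a ^ 0 * w\<^sup>2))" for a w
  proof -
    have "(S * a ^ 3 - Q * a - S * \<mu>3)\<^sup>2 * w\<^sup>2 = S\<^sup>2 * (a ^ 6 * w\<^sup>2)
     - 2 * S * Q * (a ^ 4 * w\<^sup>2) - 2 * S\<^sup>2 * \<mu>3 * (a ^ 3 * w\<^sup>2)
     + Q\<^sup>2 * (a ^ 2 * w\<^sup>2) + 2 * Q * S * \<mu>3 * (a ^ 1 * w\<^sup>2) + S\<^sup>2 * \<mu>3\<^sup>2 * (a ^ 0 * w\<^sup>2)"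
      by (simp add: eval_nat_numeral algebra_simps)
    then show ?thesis by (simp only: power_mult_distrib power_divide times_divide_eq_left mult_1)
  qed
  have "(\<integral>x. (T \<bullet> \<psi> x)\<^sup>2 \<partial>L) = (\<integral>x. (1 / c0\<^sup>2) * (S\<^sup>2 * ((e \<bullet> (x - m)) ^ 6 * (dual T \<bullet> (x - m))\<^sup>2)
     - 2 * S * Q * ((e \<bullet> (x - m)) ^ 4 * (dual T \<bullet> (x - m))\<^sup>2) - 2 * S\<^sup>2 * \<mu>3 * ((e \<bullet> (x - m)) ^ 3 * (dual T \<bullet> (x - m))\<^sup>2)
     + Q\<^sup>2 * ((e \<bullet> (x - m)) ^ 2 * (dual T \<bullet> (x - m))\<^sup>2) + 2 * Q * S * \<mu>3 * ((e \<bullet> (x - m)) ^ 1 * (dual T \<bullet> (x - m))\<^sup>2)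
     + S\<^sup>2 * \<mu>3\<^sup>2 * ((e \<bullet> (x - m)) ^ 0 * (dual T \<bullet> (x - m))\<^sup>2)) \<partial>L)"
    unfolding inner_\<psi> S_def[symmetric] Q_def[symmetric]
    by (intro Bochner_Integration.integral_cong refl square)
  also have "\<dots> = (1 / c0\<^sup>2) * (S\<^sup>2 * E 6 - 2 * S * Q * E 4 - 2 * S\<^sup>2 * \<mu>3 * E 3 + Q\<^sup>2 * E 2 + 2 * Q * S * \<mu>3 * E 1 + S\<^sup>2 * \<mu>3\<^sup>2 * E 0)"
    by (simp only: Bochner_Integration.integral_diff Bochner_Integration.integral_add Bochner_Integration.integrable_diff
        Bochner_Integration.integrable_add integrable_mult_right i integral_mult_right_zero E_def)
  also have "\<dots> = (1 / c0\<^sup>2) * ((S\<^sup>2 * (\<integral>x. (e \<bullet> (x - m)) ^ 6 \<partial>L) - Q\<^sup>2 * S - S\<^sup>2 * \<mu>3\<^sup>2) * ?V)"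
  proof -
    have "(\<integral>x. (e \<bullet> (x - m)) ^ 0 \<partial>L) = 1" using prob_space.prob_space[OF prob_space_L] by simp
    moreover have "(\<integral>x. (e \<bullet> (x - m)) ^ 1 \<partial>L) = 0" using moments_L_explicit(1)[of e] by simp
    moreover have "(\<integral>x. (e \<bullet> (x - m)) ^ 2 \<partial>L) = S" unfolding S_def M2_def by (simp add: power2_eq_square)
    moreover have "(\<integral>x. (e \<bullet> (x - m)) ^ 3 \<partial>L) = \<mu>3" by (simp add: \<mu>3_def)
    moreover have "(\<integral>x. (e \<bullet> (x - m)) ^ 4 \<partial>L) = Q" unfolding Q_def M4_def by (simp add: eval_nat_numeral mult_ac)
    ultimately show ?thesis unfolding E by (simp add: algebra_simps power2_eq_square)
  qed
  finally have var: "(\<integral>x. (T \<bullet> \<psi> x)\<^sup>2 \<partial>L) = (1 / c0\<^sup>2) * ((S\<^sup>2 * (\<integral>x. (e \<bullet> (x - m)) ^ 6 \<partial>L) - Q\<^sup>2 * S - S\<^sup>2 * \<mu>3\<^sup>2) * ?V)" .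
  define p where "p = 6 + 24 * \<beta> * \<tau> + 9 * \<beta> * (1 - 2 * \<beta>) * \<tau>\<^sup>2 + \<beta> * (1 - 3 * \<beta>) * \<tau> ^ 3"
  have N: "S\<^sup>2 * (\<integral>x. (e \<bullet> (x - m)) ^ 6 \<partial>L) - Q\<^sup>2 * S - S\<^sup>2 * \<mu>3\<^sup>2 = h ^ 5 * (1 + \<beta> * \<tau>) * p"
    unfolding m6 m3 S Q p_def by (simp add: algebra_simps eval_nat_numeral)
  \<comment> \<open>Of the scale only \<open>h / \<tau>\<close> survives, and this is
    \<open>1 / (norm \<theta>)\<^sup>2\<close>.\<close>
  have ratio: "h ^ 5 / c0\<^sup>2 = 1 / (\<beta> * \<tau> ^ 3 * (1 - 6 * \<beta>)\<^sup>2) * (1 / ((norm \<theta>)\<^sup>2 * \<beta>))"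
  proof -
    have n: "(norm \<theta>)\<^sup>2 = \<tau> / h" using \<theta>_nonzero \<tau>_pos by (simp add: h_def)
    define q where "q = (1 - 6 * \<beta>)\<^sup>2"
    have "q \<noteq> 0" using b by (simp add: q_def)
    have "c0\<^sup>2 = \<beta>\<^sup>2 * q * (h * \<tau>) ^ 4" by (simp add: c q_def power_mult_distrib flip: power_mult)
    then show ?thesis unfolding n q_def[symmetric] using h \<beta>_pos \<tau>_pos \<open>q \<noteq> 0\<close>
      by (simp add: divide_simps) (simp add: eval_nat_numeral mult_ac)
  qed
  have rearrange: "(1 / c) * ((k * f * q) * w) = q / y * (f / z) * w" if "k / c = 1 / y * (1 / z)" for c k f q w y z :: real
  proof -
    have "(1 / c) * ((k * f * q) * w) = (k / c) * (f * q * w)" by simp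
    also have "\<dots> = q / y * (f / z) * w" unfolding that by simp
    finally show ?thesis .
  qed
  show ?thesis
    unfolding var N V p_def by (rule rearrange[OF ratio])
qed

text \<open>Only finitely many averages have to converge, so this holds almost surely.\<close>

definition good :: "(nat \<Rightarrow> real^'p) \<Rightarrow> bool" where
  "good x \<longleftrightarrow> (\<forall>a\<in>insert e Basis. \<forall>b\<in>insert e Basis. \<forall>c\<in>insert e Basis. \<forall>d\<in>insert e Basis.
     (\<lambda>n. avg n (\<lambda>i. a \<bullet> (x i - m))) \<longlonglongrightarrow> 0 \<and>
     (\<lambda>n. avg n (\<lambda>i. (a \<bullet> (x i - m)) * (b \<bullet> (x i - m)))) \<longlonglongrightarrow> M2 a b \<and>
     (\<lambda>n. avg n (\<lambda>i. (a \<bullet> (x i - m)) * (b \<bullet> (x i - m)) * (c \<bullet> (x i - m)))) \<longlonglongrightarrow>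
       (\<integral>x. (a \<bullet> (x - m)) * (b \<bullet> (x - m)) * (c \<bullet> (x - m)) \<partial>L) \<and>
     (\<lambda>n. avg n (\<lambda>i. (a \<bullet> (x i - m)) * (b \<bullet> (x i - m)) * (c \<bullet> (x i - m)) * (d \<bullet> (x i - m)))) \<longlonglongrightarrow> M4 a b c d)"

lemma AE_good:
  assumes "iid_sample M X L"
  shows "AE \<omega> in M. good (\<lambda>i. X i \<omega>)"
proof -
  interpret iid_sample M X L by fact
  have c: "countable (insert e Basis :: (real^'p) set)" by (simp add: countable_finite)
  have lln: "AE \<omega> in M. (\<lambda>n. avg n (\<lambda>i. h (X i \<omega>))) \<longlonglongrightarrow> (\<integral>x. h x \<partial>L)" if "poly_bounded h" for h
    using strong_law[OF that] by (simp add: avg_def)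
  have 1: "AE \<omega> in M. (\<lambda>n. avg n (\<lambda>i. a \<bullet> (X i \<omega> - m))) \<longlonglongrightarrow> 0" for a
    using lln[of "\<lambda>x. a \<bullet> (x - m)", OF poly_bounded_centred] by (simp only: moments_L_explicit(1))
  have 2: "AE \<omega> in M. (\<lambda>n. avg n (\<lambda>i. (a \<bullet> (X i \<omega> - m)) * (b \<bullet> (X i \<omega> - m)))) \<longlonglongrightarrow> M2 a b" for a b
    unfolding M2_def by (rule lln) (intro pb)
  have 3: "AE \<omega> in M. (\<lambda>n. avg n (\<lambda>i. (a \<bullet> (X i \<omega> - m)) * (b \<bullet> (X i \<omega> - m)) * (c \<bullet> (X i \<omega> - m)))) \<longlonglongrightarrow>
      (\<integral>x. (a \<bullet> (x - m)) * (b \<bullet> (x - m)) * (c \<bullet> (x - m)) \<partial>L)" for a b c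
    by (rule lln) (intro pb)
  have 4: "AE \<omega> in M. (\<lambda>n. avg n (\<lambda>i. (a \<bullet> (X i \<omega> - m)) * (b \<bullet> (X i \<omega> - m)) * (c \<bullet> (X i \<omega> - m)) * (d \<bullet> (X i \<omega> - m)))) \<longlonglongrightarrow> M4 a b c d" for a b c d
    unfolding M4_def by (rule lln) (intro pb)
  show ?thesis
    unfolding good_def AE_ball_countable[OF c] AE_conj_iff by (intro ballI conjI 1 2 3 4)
qed

lemma goodD:
  assumes "good x" and a: "a \<in> insert e Basis"
  shows "(\<lambda>n. avg n (\<lambda>i. a \<bullet> (x i - m))) \<longlonglongrightarrow> 0"
    and "b \<in> insert e Basis \<Longrightarrow> (\<lambda>n. avg n (\<lambda>i. (a \<bullet> (x i - m)) * (b \<bullet> (x i - m)))) \<longlonglongrightarrow> M2 a b"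
    and "b \<in> insert e Basis \<Longrightarrow> c \<in> insert e Basis \<Longrightarrow>
      (\<lambda>n. avg n (\<lambda>i. (a \<bullet> (x i - m)) * (b \<bullet> (x i - m)) * (c \<bullet> (x i - m)))) \<longlonglongrightarrow>
       (\<integral>x. (a \<bullet> (x - m)) * (b \<bullet> (x - m)) * (c \<bullet> (x - m)) \<partial>L)"
    and "b \<in> insert e Basis \<Longrightarrow> c \<in> insert e Basis \<Longrightarrow> d \<in> insert e Basis \<Longrightarrow>
      (\<lambda>n. avg n (\<lambda>i. (a \<bullet> (x i - m)) * (b \<bullet> (x i - m)) * (c \<bullet> (x i - m)) * (d \<bullet> (x i - m)))) \<longlonglongrightarrow> M4 a b c d"
  using assms(1) a unfolding good_def by blast+

lemma good_form2:
  assumes "good x" "i \<in> Basis" "j \<in> Basis"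
  shows "(\<lambda>n. sample_form2 x n i j) \<longlonglongrightarrow> M2 i j"
  by (rule sample_form2_tendsto[where m=m]) (use assms in \<open>blast intro: goodD\<close>)+

lemma good_form4:
  assumes "good x" "i \<in> Basis" "j \<in> Basis" "k \<in> Basis" "l \<in> Basis"
  shows "(\<lambda>n. sample_form4 x n i j k l) \<longlonglongrightarrow> M4 i j k l"
proof -
  have s: "v \<in> insert e Basis" if "v \<in> {i, j, k, l}" for v using assms that by auto
  show ?thesis
  proof (rule sample_form4_tendsto[where m=m])
    fix v w z assume v: "v \<in> {i, j, k, l}"
    show "(\<lambda>n. avg n (\<lambda>i. v \<bullet> (x i - m))) \<longlonglongrightarrow> 0" by (rule goodD(1)[OF assms(1) s[OF v]])
    assume w: "w \<in> {i, j, k, l}"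
    show "convergent (\<lambda>n. avg n (\<lambda>i. (v \<bullet> (x i - m)) * (w \<bullet> (x i - m))))"
      by (rule convergentI) (rule goodD(2)[OF assms(1) s[OF v] s[OF w]])
    assume z: "z \<in> {i, j, k, l}"
    show "convergent (\<lambda>n. avg n (\<lambda>i. (v \<bullet> (x i - m)) * (w \<bullet> (x i - m)) * (z \<bullet> (x i - m))))"
      by (rule convergentI) (rule goodD(3)[OF assms(1) s[OF v] s[OF w] s[OF z]])
  qed (intro goodD(4) assms(1) insertI2 assms(2-5))
qed

text \<open>Subsequences and moving arguments are what \<open>argmax_consistency\<close> asks for;
  with the identity as \<open>r\<close> the same limits keep the denominator and the excess kurtosis
  nonzero in \<open>critical\<close>.\<close>

lemma good_kurtosis_tendsto:
  assumes x: "good x" and r: "strict_mono r" and v: "v \<longlonglongrightarrow> l" "l \<noteq> 0"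
  shows "(\<lambda>n. sample_form2 x (r n) (v n) (v n)) \<longlonglongrightarrow> M2 l l"
    and "(\<lambda>n. (sample_kurtosis x (r n) (v n) - 3)\<^sup>2) \<longlonglongrightarrow> K0 l"
proof -
  have rr: "filterlim r sequentially sequentially" by (rule filterlim_subseq[OF r])
  show 2: "(\<lambda>n. sample_form2 x (r n) (v n) (v n)) \<longlonglongrightarrow> M2 l l"
    by (rule bilinear_tendsto[of "\<lambda>n. sample_form2 x (r n)", OF bilinear_sample_form2 bilinear_M2 _ v(1) v(1)])
      (rule filterlim_compose[OF good_form2[OF x] rr])
  have 4: "(\<lambda>n. sample_form4 x (r n) (v n) (v n) (v n) (v n)) \<longlonglongrightarrow> M4 l l l l"
    by (rule quadlinear_tendsto[of "\<lambda>n. sample_form4 x (r n)", OF quadlinear_sample_form4 quadlinear_M4 _ v(1) v(1) v(1) v(1)])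
      (rule filterlim_compose[OF good_form4[OF x] rr])
  show "(\<lambda>n. (sample_kurtosis x (r n) (v n) - 3)\<^sup>2) \<longlonglongrightarrow> K0 l"
    unfolding sample_kurtosis_form K0_def using M2_pos[OF v(2)] by (intro tendsto_intros 2 4) auto
qed

definition scaled_mean :: "(nat \<Rightarrow> real^'p) \<Rightarrow> nat \<Rightarrow> real^'p" where
  "scaled_mean x n = (1 / sqrt (real n)) *\<^sub>R (\<Sum>i<n. \<psi> (x i))"

text \<open>A majorant for the error of the linearisation. The exponents up to 3 are those that
  appear when a cubic in \<open>e \<bullet> (x i - m)\<close> is recentred at the sample mean; every
  summand is centred, so its expected absolute value stays bounded in \<open>n\<close>.\<close>

definition gauge :: "(nat \<Rightarrow> real^'p) \<Rightarrow> nat \<Rightarrow> real" where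
  "gauge x n = (\<Sum>t\<in>Basis. \<Sum>k\<le>3. \<bar>(1 / sqrt (real n)) * (\<Sum>i<n. (e \<bullet> (x i - m)) ^ k * (dual t \<bullet> (x i - m)))\<bar>)"

section \<open>Deterministic analysis along one sample path\<close>

context
  fixes x :: "nat \<Rightarrow> real^'p" and u v :: "nat \<Rightarrow> real^'p"
  assumes b: "1 - 6 * \<beta> \<noteq> 0" and x: "good x" and u: "\<And>n. norm (u n) = 1"
    and max: "\<forall>\<^sub>F n in sequentially. \<forall>v. norm v = 1 \<longrightarrow> (sample_kurtosis x n v - 3)\<^sup>2 \<le> (sample_kurtosis x n (u n) - 3)\<^sup>2"
    and v_def: "\<And>n. v n = (if 0 \<le> u n \<bullet> e then 1 else - 1) *\<^sub>R u n"
begin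

lemma norm_v: "norm (v n) = 1"
  using u by (simp add: v_def)

lemma kurtosis_v: "sample_kurtosis x n (v n) = sample_kurtosis x n (u n)"
  unfolding v_def by (rule sample_kurtosis_scale) simp

lemma v_tendsto: "v \<longlonglongrightarrow> e"
proof -
  have "(\<lambda>n. (if 0 \<le> u n \<bullet> e then 1 else - 1) *\<^sub>R u n) \<longlonglongrightarrow> e"
  proof (rule argmax_consistency[where K = "\<lambda>n v. (sample_kurtosis x n v - 3)\<^sup>2" and ?K0.0 = K0])
    fix r :: "nat \<Rightarrow> nat" and v :: "nat \<Rightarrow> real^'p" and l
    assume r: "strict_mono r" and v: "\<And>n. norm (v n) = 1" "v \<longlonglongrightarrow> l"
    have "norm l = 1" using LIMSEQ_unique[OF tendsto_norm[OF v(2)]] v(1) by simp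
    then have "l \<noteq> 0" by auto
    then show "(\<lambda>n. (sample_kurtosis x (r n) (v n) - 3)\<^sup>2) \<longlonglongrightarrow> K0 l"
      by (rule good_kurtosis_tendsto(2)[OF x r v(2)])
  next
    show "(sample_kurtosis x n (- v) - 3)\<^sup>2 = (sample_kurtosis x n v - 3)\<^sup>2" for n v
      using sample_kurtosis_scale[of "-1" x n v] by simp
    show "\<forall>\<^sub>F n in sequentially. (sample_kurtosis x n e - 3)\<^sup>2 \<le> (sample_kurtosis x n (u n) - 3)\<^sup>2"
      using max by eventually_elim (simp add: norm_e)
  qed (use u norm_e K0_less[OF b] in auto)
  then show ?thesis by (simp only: v_def[symmetric])
qed

text \<open>At \<open>e\<close> the limits of the second-order form and of the squared excess
  kurtosis are positive, the latter because 1 - 6 \<beta> is nonzero. Hence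
  \<open>sample_kurtosis_critical\<close> applies eventually; the kurtosis does not see the change
  of sign.\<close>

lemma critical:
  "\<forall>\<^sub>F n in sequentially. \<forall>t\<in>Basis. sample_form2 x n (v n) (v n) * sample_form4 x n (v n) (v n) (v n) (dual t)
     - sample_form4 x n (v n) (v n) (v n) (v n) * sample_form2 x n (v n) (dual t) = 0"
proof -
  have e0: "e \<noteq> 0" using norm_e by auto
  have K0e: "0 < K0 e"
    unfolding K0_eq[OF e0] using b \<beta>_pos M2_pos[OF e0] \<tau>_pos \<theta>_nonzero by (simp add: e_\<delta>)
  note k = good_kurtosis_tendsto[OF x strict_mono_id v_tendsto e0, simplified]
  have "\<forall>\<^sub>F n in sequentially. 0 < sample_form2 x n (v n) (v n)"
    by (rule order_tendstoD(1)[OF k(1) M2_pos[OF e0]])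
  moreover have "\<forall>\<^sub>F n in sequentially. 0 < (sample_kurtosis x n (v n) - 3)\<^sup>2"
    by (rule order_tendstoD(1)[OF k(2) K0e])
  ultimately show ?thesis using max
  proof eventually_elim
    case (elim n)
    show ?case
      by (intro ballI sample_kurtosis_critical[OF norm_v]) (use elim kurtosis_v in auto)
  qed
qed

text \<open>Two replacements, each costing at most \<open>\<epsilon> / 2 * V n\<close>: first
  \<open>v n - e\<close> by \<open>g n / c0\<close>, from the expansion at the critical point, then
  \<open>g n / c0\<close> by the average \<open>y n\<close> of \<psi>, where sample coefficients
  give way to their limits. Multiplication by \<open>sqrt (real n)\<close> turns \<open>V n\<close>
  into \<open>gauge x n\<close>.\<close>

lemma gauge_remainder:
  assumes \<epsilon>: "\<epsilon> > 0"
  shows "\<forall>\<^sub>F n in sequentially. norm (sqrt (real n) *\<^sub>R (v n - e) - scaled_mean x n) \<le> \<epsilon> * gauge x n"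
proof -
  note c0 = c0_nonzero[OF b]
  define S Q where "S = M2 e e" and "Q = M4 e e e e"
  define Sn Qn where "Sn n = sample_form2 x n e e" and "Qn n = sample_form4 x n e e e e" for n
  define a where "a i = e \<bullet> (x i - m)" for i
  define bb where "bb t i = dual t \<bullet> (x i - m)" for t i
  define B where "B t k n = avg n (\<lambda>i. a i ^ k * bb t i)" for t k n
  define V where "V n = (\<Sum>t\<in>(Basis::(real^'p) set). \<Sum>k\<le>3. \<bar>B t k n\<bar>)" for n
  define g where "g n = (\<Sum>t\<in>Basis. (Sn n * sample_form4 x n e e e (dual t) - Qn n * sample_form2 x n e (dual t)) *\<^sub>R t)" for n
  define y where "y n = (1 / real n) *\<^sub>R (\<Sum>i<n. \<psi> (x i))" for n
  define A1 A2 A3 where "A1 n = avg n a" and "A2 n = avg n (\<lambda>i. a i ^ 2)" and "A3 n = avg n (\<lambda>i. a i ^ 3)" for n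
  \<comment> \<open>The coefficients of \<open>B t 3 n\<close>, \<open>B t 2 n\<close>,
    \<open>B t 1 n\<close> and \<open>B t 0 n\<close> in
    \<open>g n \<bullet> t - c0 * (y n \<bullet> t)\<close>. All tend to 0; for \<open>k4\<close>
    this holds because \<open>A3\<close> tends to \<mu>3, so that \<open>S * \<mu>3\<close> cancels
    in the limit.\<close>
  define k1 k2 k3 k4 where "k1 n = Sn n - S" and "k2 n = - 3 * Sn n * A1 n" and "k3 n = 3 * Sn n * (A1 n)\<^sup>2 - (Qn n - Q)"
    and "k4 n = Sn n * (- A3 n + 3 * A1 n * A2 n - 3 * A1 n ^ 3) + S * \<mu>3 + Qn n * A1 n" for n
  define \<kappa> where "\<kappa> n = \<bar>k1 n\<bar> + \<bar>k2 n\<bar> + \<bar>k3 n\<bar> + \<bar>k4 n\<bar>" for n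
  define K where "K = \<bar>S\<bar> + \<bar>Q\<bar> + \<bar>S * \<mu>3\<bar>"
  have Slim: "Sn \<longlonglongrightarrow> S" unfolding Sn_def[abs_def] S_def
    by (rule bilinear_tendsto[OF bilinear_sample_form2 bilinear_M2 good_form2[OF x] tendsto_const tendsto_const])
  have Qlim: "Qn \<longlonglongrightarrow> Q" unfolding Qn_def[abs_def] Q_def
    by (rule quadlinear_tendsto[OF quadlinear_sample_form4 quadlinear_M4 good_form4[OF x] tendsto_const tendsto_const tendsto_const tendsto_const])
  have Alim: "A1 \<longlonglongrightarrow> 0" "A2 \<longlonglongrightarrow> S" "A3 \<longlonglongrightarrow> \<mu>3"
    using goodD(1)[OF x insertI1] goodD(2)[OF x insertI1 insertI1] goodD(3)[OF x insertI1 insertI1 insertI1] unfolding A1_def[abs_def] A2_def[abs_def] A3_def[abs_def] a_def[abs_def] S_def \<mu>3_def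
    by (simp_all only: power2_eq_square power3_eq_cube)
  have "\<kappa> \<longlonglongrightarrow> \<bar>S - S\<bar> + \<bar>- 3 * S * 0\<bar> + \<bar>3 * S * 0\<^sup>2 - (Q - Q)\<bar> + \<bar>S * (- \<mu>3 + 3 * 0 * S - 3 * 0 ^ 3) + S * \<mu>3 + Q * 0\<bar>"
    unfolding \<kappa>_def[abs_def] k1_def k2_def k3_def k4_def by (intro tendsto_intros Slim Qlim Alim)
  then have \<kappa>lim: "\<kappa> \<longlonglongrightarrow> 0" by simp
  have four: "{..3::nat} = {0, 1, 2, 3}" by auto
  have yt: "c0 * (y n \<bullet> t) = S * B t 3 n - Q * B t 1 n - S * \<mu>3 * B t 0 n" for n t
  proof -
    have "y n \<bullet> t = avg n (\<lambda>i. t \<bullet> \<psi> (x i))"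
      by (simp add: y_def avg_def inner_commute[of _ t] inner_sum_right)
    also have "\<dots> = avg n (\<lambda>i. (1 / c0) * (S * (a i ^ 3 * bb t i) - Q * (a i ^ 1 * bb t i) - S * \<mu>3 * (a i ^ 0 * bb t i)))"
      unfolding inner_\<psi> a_def bb_def S_def Q_def by (intro arg_cong[where f="avg n"]) (simp add: fun_eq_iff diff_divide_distrib left_diff_distrib)
    also have "\<dots> = (1 / c0) * (S * B t 3 n - Q * B t 1 n - S * \<mu>3 * B t 0 n)"
      unfolding B_def by (simp only: avg_diff avg_cmult)
    finally show ?thesis using c0 by simp
  qed
  have gt: "g n \<bullet> t - c0 * (y n \<bullet> t) = k1 n * B t 3 n + k2 n * B t 2 n + k3 n * B t 1 n + k4 n * B t 0 n"
    if n: "n > 0" and t: "t \<in> Basis" for n t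
  proof -
    have f2: "sample_form2 x n e (dual t) = B t 1 n - A1 n * B t 0 n"
      unfolding sample_form2_def inner_centred[OF n, of _ x _ m] avg_centred2[OF n]
      by (simp add: B_def A1_def a_def[abs_def] bb_def[abs_def])
    have f4: "sample_form4 x n e e e (dual t) = B t 3 n - 3 * A1 n * B t 2 n - B t 0 n * A3 n + 3 * (A1 n)\<^sup>2 * B t 1 n
       + 3 * A1 n * B t 0 n * A2 n - A1 n ^ 3 * B t 0 n - 3 * (A1 n)\<^sup>2 * B t 0 n * A1 n + A1 n ^ 3 * B t 0 n"
      unfolding sample_form4_def inner_centred[OF n, of _ x _ m] avg_centred4[OF n] a_def[symmetric] bb_def[symmetric]
      by (simp add: B_def A1_def A2_def A3_def power2_eq_square power3_eq_cube mult_ac)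
    have gn: "g n \<bullet> t = Sn n * sample_form4 x n e e e (dual t) - Qn n * sample_form2 x n e (dual t)"
      unfolding g_def using t by (simp add: inner_sum_left inner_Basis if_distrib cong: if_cong)
    show ?thesis
      unfolding gn f4 yt f2 k1_def k2_def k3_def k4_def by (simp add: algebra_simps power2_eq_square power3_eq_cube)
  qed
  have Bs: "\<bar>B t 0 n\<bar> + \<bar>B t 1 n\<bar> + \<bar>B t 2 n\<bar> + \<bar>B t 3 n\<bar> = (\<Sum>k\<le>3. \<bar>B t k n\<bar>)" for t n
    unfolding four by simp
  have lin4: "\<bar>p * q0 + q * q1 + r * q2 + s * q3\<bar> \<le> (\<bar>p\<bar> + \<bar>q\<bar> + \<bar>r\<bar> + \<bar>s\<bar>) * (\<bar>q3\<bar> + \<bar>q2\<bar> + \<bar>q1\<bar> + \<bar>q0\<bar>)" for p q r s q0 q1 q2 q3 :: real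
  proof -
    let ?t = "\<bar>q3\<bar> + \<bar>q2\<bar> + \<bar>q1\<bar> + \<bar>q0\<bar>"
    have "\<bar>p * q0 + q * q1 + r * q2 + s * q3\<bar> \<le> \<bar>p\<bar> * \<bar>q0\<bar> + \<bar>q\<bar> * \<bar>q1\<bar> + \<bar>r\<bar> * \<bar>q2\<bar> + \<bar>s\<bar> * \<bar>q3\<bar>"
      unfolding abs_mult[symmetric] by linarith
    also have "\<dots> \<le> \<bar>p\<bar> * ?t + \<bar>q\<bar> * ?t + \<bar>r\<bar> * ?t + \<bar>s\<bar> * ?t"
      by (intro add_mono mult_left_mono) auto
    finally show ?thesis by (simp add: distrib_right)
  qed
  have gy: "norm (g n - c0 *\<^sub>R y n) \<le> \<kappa> n * V n" if n: "n > 0" for n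
  proof -
    have "norm (g n - c0 *\<^sub>R y n) \<le> (\<Sum>t\<in>Basis. \<bar>(g n - c0 *\<^sub>R y n) \<bullet> t\<bar>)" by (rule norm_le_l1)
    also have "\<dots> \<le> (\<Sum>t\<in>Basis. \<kappa> n * (\<Sum>k\<le>3. \<bar>B t k n\<bar>))"
    proof (intro sum_mono)
      fix t :: "real^'p" assume t: "t \<in> Basis"
      have "(g n - c0 *\<^sub>R y n) \<bullet> t = k1 n * B t 3 n + k2 n * B t 2 n + k3 n * B t 1 n + k4 n * B t 0 n"
        using gt[OF n t] by (simp add: inner_diff_left)
      then show "\<bar>(g n - c0 *\<^sub>R y n) \<bullet> t\<bar> \<le> \<kappa> n * (\<Sum>k\<le>3. \<bar>B t k n\<bar>)"
        unfolding Bs[symmetric] \<kappa>_def by (simp only: lin4)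
    qed
    finally show ?thesis by (simp add: V_def sum_distrib_left)
  qed
  have cy: "norm (c0 *\<^sub>R y n) \<le> K * V n" for n
  proof -
    have "norm (c0 *\<^sub>R y n) \<le> (\<Sum>t\<in>Basis. \<bar>(c0 *\<^sub>R y n) \<bullet> t\<bar>)" by (rule norm_le_l1)
    also have "\<dots> \<le> (\<Sum>t\<in>Basis. K * (\<Sum>k\<le>3. \<bar>B t k n\<bar>))"
    proof (intro sum_mono)
      fix t :: "real^'p"
      have "(c0 *\<^sub>R y n) \<bullet> t = S * B t 3 n + 0 * B t 2 n + (- Q) * B t 1 n + (- (S * \<mu>3)) * B t 0 n"
        using yt[of n t] by simp
      then show "\<bar>(c0 *\<^sub>R y n) \<bullet> t\<bar> \<le> K * (\<Sum>k\<le>3. \<bar>B t k n\<bar>)"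
        unfolding Bs[symmetric] K_def using lin4[of S "B t 3 n" 0 "B t 2 n" "- Q" "B t 1 n" "- (S * \<mu>3)" "B t 0 n"] by simp
    qed
    finally show ?thesis by (simp add: V_def sum_distrib_left)
  qed
  have K0: "0 \<le> K" by (simp add: K_def)
  \<comment> \<open>Matched to \<open>norm (g n) \<le> (K + 1) * V n\<close>, where \<open>K\<close>
    bounds the coefficients of \<open>c0 *\<^sub>R y n\<close> and 1 the error \<kappa>; so
    \<epsilon>1 times \<open>norm (g n)\<close> is at most
    \<open>\<epsilon> / 2 * V n\<close>.\<close>
  define \<epsilon>1 where "\<epsilon>1 = \<epsilon> / (2 * (K + 1))"
  have \<epsilon>1: "\<epsilon>1 > 0" "\<epsilon>1 * (K + 1) = \<epsilon> / 2"
  proof -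
    have "\<epsilon> / (2 * k) * k = \<epsilon> / 2" if "k > 0" for k :: real using that by simp
    from this[of "K + 1"] show "\<epsilon>1 > 0" "\<epsilon>1 * (K + 1) = \<epsilon> / 2" using \<epsilon> K0 by (simp_all add: \<epsilon>1_def)
  qed
  \<comment> \<open>Terms with a factor \<open>M2 e (dual t)\<close> or
    \<open>M4 e e e (dual t)\<close> vanish. The others are multiples of
    \<open>\<eta> \<bullet> (\<Sigma> *v dual t)\<close>: three times
    \<open>(M2 e e)\<^sup>2\<close> minus the fourth moment, which is minus
    \<open>c0\<close>.\<close>
  have deriv: "(M2 \<eta> e + M2 e \<eta>) * M4 e e e (dual t) +
         M2 e e * (M4 \<eta> e e (dual t) + M4 e \<eta> e (dual t) + M4 e e \<eta> (dual t)) -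
         (M4 \<eta> e e e + M4 e \<eta> e e + M4 e e \<eta> e + M4 e e e \<eta>) * M2 e (dual t) -
         M4 e e e e * M2 \<eta> (dual t) = - c0 * ((\<eta> - (\<eta> \<bullet> e) *\<^sub>R e) \<bullet> t)" for \<eta> t :: "real^'p"
  proof -
    have s4: "M4 e \<eta> e (dual t) = M4 \<eta> e e (dual t)" "M4 e e \<eta> (dual t) = M4 \<eta> e e (dual t)"
      unfolding M4_def by (simp_all add: mult_ac)
    have z: "M2 e (dual t) = 0" "M4 e e e (dual t) = 0"
      using M2_orth[OF dual_\<delta>, of e] M4_orth[OF dual_\<delta> e_\<Sigma>_dual, of e] by (simp_all add: e_\<Sigma>_dual)
    have p: "\<eta> \<bullet> (\<Sigma> *v dual t) = (\<eta> - (\<eta> \<bullet> e) *\<^sub>R e) \<bullet> t"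
      unfolding \<Sigma>_dual proj_self_adjoint[symmetric] unfolding proj_def ..
    show ?thesis
      unfolding s4 z M2_orth[OF dual_\<delta>, of \<eta>] M4_orth[OF dual_\<delta> e_\<Sigma>_dual] p c0_def
      by (simp add: e_\<Sigma>_dual algebra_simps power2_eq_square)
  qed
  have ex: "\<forall>\<^sub>F n in sequentially. norm (v n - e - (1 / c0) *\<^sub>R g n) \<le> \<epsilon>1 * norm (g n)"
    unfolding g_def Sn_def Qn_def
    by (rule critical_point_expansion[where A = "sample_form2 x" and Q = "sample_form4 x" and ?A0.0 = M2 and ?Q0.0 = M4
        and v = v and e = e and B = dual and c = c0 and \<epsilon> = \<epsilon>1,
        OF bilinear_sample_form2 bilinear_M2 quadlinear_sample_form4 quadlinear_M4
          good_form2[OF x] good_form4[OF x] v_tendsto norm_v norm_e critical c0 deriv \<epsilon>1(1)])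
  \<comment> \<open>The bound 1 is for the estimate of \<open>norm (g n)\<close>; the other makes
    the error of the second replacement, divided by \<open>\<bar>c0\<bar>\<close>, at most
    \<open>\<epsilon> / 2 * V n\<close>.\<close>
  define \<rho> where "\<rho> = min 1 (\<epsilon> * \<bar>c0\<bar> / 2)"
  have \<rho>: "\<rho> > 0" using \<epsilon> c0 by (simp add: \<rho>_def)
  have "\<forall>\<^sub>F n in sequentially. \<kappa> n < \<rho>" by (rule order_tendstoD(2)[OF \<kappa>lim \<rho>])
  with ex eventually_gt_at_top[of 0] show ?thesis
  proof eventually_elim
    case (elim n)
    have V0: "0 \<le> V n" unfolding V_def by (intro sum_nonneg) auto
    have \<kappa>V: "\<kappa> n * V n \<le> 1 * V n" "\<kappa> n * V n \<le> (\<epsilon> * \<bar>c0\<bar> / 2) * V n"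
      using mult_right_mono[of "\<kappa> n" 1, OF _ V0] mult_right_mono[of "\<kappa> n" "\<epsilon> * \<bar>c0\<bar> / 2", OF _ V0] elim(3)
      by (simp_all add: \<rho>_def)
    have "norm (g n) \<le> norm (g n - c0 *\<^sub>R y n) + norm (c0 *\<^sub>R y n)"
      using norm_triangle_ineq[of "g n - c0 *\<^sub>R y n" "c0 *\<^sub>R y n"] by simp
    then have "norm (g n) \<le> (K + 1) * V n"
      using gy[OF elim(2)] cy[of n] \<kappa>V(1) by (simp only: distrib_right)
    then have "\<epsilon>1 * norm (g n) \<le> \<epsilon>1 * ((K + 1) * V n)" using \<epsilon>1(1) by (intro mult_left_mono) auto
    then have 1: "norm (v n - e - (1 / c0) *\<^sub>R g n) \<le> \<epsilon> / 2 * V n"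
      using elim(1) \<epsilon>1(2) by (simp only: mult.assoc[symmetric])
    have "\<bar>c0\<bar> * norm ((1 / c0) *\<^sub>R g n - y n) = norm (g n - c0 *\<^sub>R y n)"
      using c0 by (simp only: norm_scaleR[symmetric] scaleR_diff_right) simp
    also have "\<dots> \<le> (\<epsilon> * \<bar>c0\<bar> / 2) * V n" using gy[OF elim(2)] \<kappa>V(2) by (rule order_trans)
    finally have "\<bar>c0\<bar> * norm ((1 / c0) *\<^sub>R g n - y n) \<le> \<bar>c0\<bar> * (\<epsilon> / 2 * V n)" by (simp add: mult_ac)
    then have 2: "norm ((1 / c0) *\<^sub>R g n - y n) \<le> \<epsilon> / 2 * V n"
      by (rule mult_left_le_imp_le) (use c0 in simp)
    have 3: "norm (v n - e - y n) \<le> \<epsilon> * V n"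
    proof -
      have "v n - e - y n = (v n - e - (1 / c0) *\<^sub>R g n) + ((1 / c0) *\<^sub>R g n - y n)" by simp
      then have "norm (v n - e - y n) \<le> norm (v n - e - (1 / c0) *\<^sub>R g n) + norm ((1 / c0) *\<^sub>R g n - y n)"
        by (metis norm_triangle_ineq)
      with 1 2 show ?thesis by linarith
    qed
    have "sqrt (real n) * (1 / real n) = 1 / sqrt (real n)" using elim(2) by (simp add: field_simps real_sqrt_mult_self)
    then have sm: "scaled_mean x n = sqrt (real n) *\<^sub>R y n"
      by (simp only: scaled_mean_def y_def scaleR_scaleR)
    have gv: "gauge x n = sqrt (real n) * V n"
    proof -
      have "sqrt (real n) * \<bar>B t k n\<bar> = \<bar>(1 / sqrt (real n)) * (\<Sum>i<n. (e \<bullet> (x i - m)) ^ k * (dual t \<bullet> (x i - m)))\<bar>" for t k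
        unfolding sqrt_times_avg[symmetric] B_def a_def bb_def by (simp add: abs_mult)
      then show ?thesis unfolding gauge_def V_def sum_distrib_left by simp
    qed
    have "norm (sqrt (real n) *\<^sub>R (v n - e) - scaled_mean x n) = sqrt (real n) * norm (v n - e - y n)"
      unfolding sm scaleR_diff_right[symmetric] norm_scaleR by simp
    also have "\<dots> \<le> sqrt (real n) * (\<epsilon> * V n)" using 3 by (intro mult_left_mono) auto
    finally show ?case unfolding gv by (simp add: mult_ac)
  qed
qed

end

section \<open>The limiting covariance matrix and the limit theorem\<close>

lemma matrix_projection: "(mat 1 - (1 / (norm \<theta>)\<^sup>2) *\<^sub>R outer_prod \<theta> \<theta>) *v T = proj T"
proof -
  have "outer_prod \<theta> \<theta> *v T = (\<theta> \<bullet> T) *\<^sub>R \<theta>"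
    by (simp add: vec_eq_iff outer_prod_def matrix_vector_mult_def inner_vec_def sum_distrib_left mult_ac)
  moreover have "(T \<bullet> e) *\<^sub>R e = (1 / (norm \<theta>)\<^sup>2) *\<^sub>R ((\<theta> \<bullet> T) *\<^sub>R \<theta>)"
    by (simp add: e_def power2_eq_square inner_commute)
  ultimately show ?thesis
    by (simp only: matrix_vector_mult_diff_rdistrib scaleR_matrix_vector_assoc[symmetric] matrix_vector_mul_lid proj_def)
qed

definition \<Psi> :: "real^'p^'p" where
  "\<Psi> = ((6 + 24 * \<beta> * \<tau> + 9 * \<beta> * (1 - 2 * \<beta>) * \<tau>\<^sup>2 + \<beta> * (1 - 3 * \<beta>) * \<tau> ^ 3) / (\<beta> * \<tau> ^ 3 * (1 - 6 * \<beta>)\<^sup>2)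
      * ((1 + \<beta> * \<tau>) / ((norm \<theta>)\<^sup>2 * \<beta>))) *\<^sub>R
     ((mat 1 - (1 / (norm \<theta>)\<^sup>2) *\<^sub>R outer_prod \<theta> \<theta>) ** matrix_inv \<Sigma> ** (mat 1 - (1 / (norm \<theta>)\<^sup>2) *\<^sub>R outer_prod \<theta> \<theta>))"

lemma \<Psi>_inner: "v \<bullet> (\<Psi> *v w) = (6 + 24 * \<beta> * \<tau> + 9 * \<beta> * (1 - 2 * \<beta>) * \<tau>\<^sup>2 + \<beta> * (1 - 3 * \<beta>) * \<tau> ^ 3) / (\<beta> * \<tau> ^ 3 * (1 - 6 * \<beta>)\<^sup>2)
      * ((1 + \<beta> * \<tau>) / ((norm \<theta>)\<^sup>2 * \<beta>)) * (proj v \<bullet> (matrix_inv \<Sigma> *v proj w))"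
  unfolding \<Psi>_def scaleR_matrix_vector_assoc[symmetric] matrix_vector_mul_assoc[symmetric] matrix_projection
    inner_scaleR_right proj_self_adjoint[symmetric] ..

lemma variance_\<Psi>: "1 - 6 * \<beta> \<noteq> 0 \<Longrightarrow> (\<integral>x. (T \<bullet> \<psi> x)\<^sup>2 \<partial>L) = T \<bullet> (\<Psi> *v T)"
  unfolding \<Psi>_inner by (rule variance_\<psi>)

text \<open>The quadratic form is nonnegative because it is the variance of a component of \<psi>;
  symmetry is inherited from the inverse of \<Sigma> through the bilinear form.\<close>

lemma covariance_\<Psi>:
  assumes "1 - 6 * \<beta> \<noteq> 0"
  shows "covariance_matrix \<Psi>"
  unfolding covariance_matrix_def
proof (intro conjI allI)
  show "0 \<le> T \<bullet> (\<Psi> *v T)" for T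
    unfolding variance_\<Psi>[OF assms, symmetric] by (intro Bochner_Integration.integral_nonneg) simp
  have "(transpose \<Psi> *v v) \<bullet> w = (\<Psi> *v v) \<bullet> w" for v w
  proof -
    have "(transpose \<Psi> *v v) \<bullet> w = v \<bullet> (\<Psi> *v w)" by (rule inner_matrix_mult[symmetric])
    also have "\<dots> = w \<bullet> (\<Psi> *v v)" unfolding \<Psi>_inner using inv_sym[of "proj v" "proj w"] by simp
    finally show ?thesis by (simp only: inner_commute)
  qed
  then have "transpose \<Psi> *v v = \<Psi> *v v" for v
    using vector_eq_rdot by blast
  then show "transpose \<Psi> = \<Psi>" unfolding matrix_eq by blast
qed

text \<open>The pathwise results hold on the almost sure event where the sample is good and
  maximality holds eventually. For the second claim the limit is carried by
  \<open>scaled_mean\<close>, whose components obey the univariate central limit theorem, and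
  \<open>gauge\<close> is the integrable majorant of the remainder.\<close>

lemma asymptotic_normality:
  fixes M :: "'a measure" and X u :: "nat \<Rightarrow> 'a \<Rightarrow> real^'p"
  assumes "iid_sample M X L" and b: "1 - 6 * \<beta> \<noteq> 0"
    and u [measurable]: "\<And>n. u n \<in> borel_measurable M" and unit: "\<And>n \<omega>. \<omega> \<in> space M \<Longrightarrow> norm (u n \<omega>) = 1"
    and max: "\<forall>\<^sub>F n in sequentially. AE \<omega> in M. \<forall>v. norm v = 1 \<longrightarrow>
      (sample_kurtosis (\<lambda>i. X i \<omega>) n v - 3)\<^sup>2 \<le> (sample_kurtosis (\<lambda>i. X i \<omega>) n (u n \<omega>) - 3)\<^sup>2"
  defines "s \<equiv> \<lambda>n \<omega>. if 0 \<le> u n \<omega> \<bullet> e then 1 else - 1 :: real"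
  shows "AE \<omega> in M. (\<lambda>n. s n \<omega> *\<^sub>R u n \<omega>) \<longlonglongrightarrow> e"
    and "converges_in_distribution M (\<lambda>n \<omega>. sqrt (real n) *\<^sub>R (s n \<omega> *\<^sub>R u n \<omega> - e)) (mvnormal 0 \<Psi>)"
proof -
  interpret S: iid_sample M X L by fact
  have [measurable]: "s n \<in> borel_measurable M" for n
    unfolding s_def by measurable
  obtain N where N: "\<And>n. n \<ge> N \<Longrightarrow> AE \<omega> in M. \<forall>v. norm v = 1 \<longrightarrow>
      (sample_kurtosis (\<lambda>i. X i \<omega>) n v - 3)\<^sup>2 \<le> (sample_kurtosis (\<lambda>i. X i \<omega>) n (u n \<omega>) - 3)\<^sup>2"
    using max unfolding eventually_sequentially by blast
  \<comment> \<open>The exceptional set of the hypothesis depends on \<open>n\<close>; as there are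
    countably many \<open>n\<close>, one null set serves all of them.\<close>
  have "AE \<omega> in M. \<forall>n. n \<ge> N \<longrightarrow> (\<forall>v. norm v = 1 \<longrightarrow>
      (sample_kurtosis (\<lambda>i. X i \<omega>) n v - 3)\<^sup>2 \<le> (sample_kurtosis (\<lambda>i. X i \<omega>) n (u n \<omega>) - 3)\<^sup>2)"
    unfolding AE_all_countable
  proof
    show "AE \<omega> in M. n \<ge> N \<longrightarrow> (\<forall>v. norm v = 1 \<longrightarrow>
      (sample_kurtosis (\<lambda>i. X i \<omega>) n v - 3)\<^sup>2 \<le> (sample_kurtosis (\<lambda>i. X i \<omega>) n (u n \<omega>) - 3)\<^sup>2)" for n
      using N[of n] by (cases "n \<ge> N") simp_all
  qed
  then have maxAE: "AE \<omega> in M. \<forall>\<^sub>F n in sequentially. \<forall>v. norm v = 1 \<longrightarrow>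
      (sample_kurtosis (\<lambda>i. X i \<omega>) n v - 3)\<^sup>2 \<le> (sample_kurtosis (\<lambda>i. X i \<omega>) n (u n \<omega>) - 3)\<^sup>2"
    unfolding eventually_sequentially by eventually_elim blast
  note ev = AE_good[OF assms(1)] maxAE AE_space
  show "AE \<omega> in M. (\<lambda>n. s n \<omega> *\<^sub>R u n \<omega>) \<longlonglongrightarrow> e"
    using ev
  proof eventually_elim
    case (elim \<omega>)
    show ?case
      by (rule v_tendsto[OF b elim(1) unit[OF elim(3)] elim(2)]) (simp only: s_def)
  qed
  have gen: "AE \<omega> in M. \<forall>\<^sub>F n in sequentially. norm (sqrt (real n) *\<^sub>R (s n \<omega> *\<^sub>R u n \<omega> - e) - scaled_mean (\<lambda>i. X i \<omega>) n)
      \<le> \<epsilon> * gauge (\<lambda>i. X i \<omega>) n" if "\<epsilon> > 0" for \<epsilon>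
    using ev
  proof eventually_elim
    case (elim \<omega>)
    show ?case
      by (rule gauge_remainder[OF b elim(1) unit[OF elim(3)] elim(2) _ that]) (simp only: s_def)
  qed
  have psi_meas: "\<psi> \<in> borel_measurable borel"
    unfolding borel_measurable_euclidean_space[of \<psi>] using poly_bounded_measurable[OF poly_bounded_\<psi>]
    by (simp add: inner_commute)
  have meas [measurable]: "(\<lambda>\<omega>. scaled_mean (\<lambda>i. X i \<omega>) n) \<in> borel_measurable M" for n
    using psi_meas unfolding scaled_mean_def by measurable
  have inner_mean: "T \<bullet> scaled_mean (\<lambda>i. X i \<omega>) n = (1 / sqrt (real n)) * (\<Sum>i<n. T \<bullet> \<psi> (X i \<omega>))" for T \<omega> n
    by (simp add: scaled_mean_def inner_sum_right)
  note sa = S.scaled_sum_abs[OF poly_bounded_\<psi> integral_\<psi>]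
  have le: "norm (scaled_mean (\<lambda>i. X i \<omega>) n) \<le> (\<Sum>t\<in>Basis. \<bar>(1 / sqrt (real n)) * (\<Sum>i<n. t \<bullet> \<psi> (X i \<omega>))\<bar>)" for \<omega> n
    unfolding inner_mean[symmetric] inner_commute[of _ "scaled_mean _ _"] by (rule norm_le_l1)
  have isum: "integrable M (\<lambda>\<omega>. \<Sum>t\<in>Basis. \<bar>(1 / sqrt (real n)) * (\<Sum>i<n. t \<bullet> \<psi> (X i \<omega>))\<bar>)" for n
    by (intro Bochner_Integration.integrable_sum sa)
  have inorm: "integrable M (\<lambda>\<omega>. norm (scaled_mean (\<lambda>i. X i \<omega>) n))" for n
    by (rule Bochner_Integration.integrable_bound[OF isum]) (use le in \<open>auto intro!: AE_I2 order_trans[OF _ abs_ge_self]\<close>)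
  have pbd: "poly_bounded (\<lambda>x. (e \<bullet> (x - m)) ^ k * (dual t \<bullet> (x - m)))" for k t
    by (intro pb)
  note sg = S.scaled_sum_abs[OF pbd integral_powers_dual]
  show "converges_in_distribution M (\<lambda>n \<omega>. sqrt (real n) *\<^sub>R (s n \<omega> *\<^sub>R u n \<omega> - e)) (mvnormal 0 \<Psi>)"
  proof (rule converges_in_distribution_perturbed[where Y = "\<lambda>n \<omega>. scaled_mean (\<lambda>i. X i \<omega>) n" and
        K = "\<Sum>t\<in>Basis. 1 + (\<integral>x. (t \<bullet> \<psi> x)\<^sup>2 \<partial>L)"])
    show "prob_space M" by (rule S.prob_space_axioms)
    show "prob_space (mvnormal 0 \<Psi>)" by (rule prob_space_mvnormal)
    show "integrable (mvnormal 0 \<Psi>) norm"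
      by (rule integrable_poly_bounded[OF has_all_moments_mvnormal[OF covariance_\<Psi>[OF b]] poly_bounded_norm])
    show "integrable M (\<lambda>\<omega>. norm (scaled_mean (\<lambda>i. X i \<omega>) n))" for n by (rule inorm)
    show "(\<integral>\<omega>. norm (scaled_mean (\<lambda>i. X i \<omega>) n) \<partial>M) \<le> (\<Sum>t\<in>Basis. 1 + (\<integral>x. (t \<bullet> \<psi> x)\<^sup>2 \<partial>L))" for n
    proof -
      have "(\<integral>\<omega>. norm (scaled_mean (\<lambda>i. X i \<omega>) n) \<partial>M) \<le> (\<integral>\<omega>. (\<Sum>t\<in>Basis. \<bar>(1 / sqrt (real n)) * (\<Sum>i<n. t \<bullet> \<psi> (X i \<omega>))\<bar>) \<partial>M)"
        by (intro integral_mono inorm isum le)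
      also have "\<dots> = (\<Sum>t\<in>Basis. (\<integral>\<omega>. \<bar>(1 / sqrt (real n)) * (\<Sum>i<n. t \<bullet> \<psi> (X i \<omega>))\<bar> \<partial>M))"
        by (intro Bochner_Integration.integral_sum sa)
      also have "\<dots> \<le> (\<Sum>t\<in>Basis. 1 + (\<integral>x. (t \<bullet> \<psi> x)\<^sup>2 \<partial>L))"
        by (intro sum_mono sa)
      finally show ?thesis .
    qed
    show "(\<lambda>n. CLINT \<omega>|M. iexp (T \<bullet> scaled_mean (\<lambda>i. X i \<omega>) n)) \<longlonglongrightarrow> (CLINT y|mvnormal 0 \<Psi>. iexp (T \<bullet> y))" for T
      unfolding iexp_mvnormal[OF covariance_\<Psi>[OF b]] variance_\<Psi>[OF b, symmetric] inner_mean
      by (rule S.clt_char[OF poly_bounded_\<psi> integral_\<psi>])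
    show "(\<lambda>n. \<integral>\<omega>. min 1 (norm (sqrt (real n) *\<^sub>R (s n \<omega> *\<^sub>R u n \<omega> - e) - scaled_mean (\<lambda>i. X i \<omega>) n)) \<partial>M) \<longlonglongrightarrow> 0"
    proof (rule expectation_min_tendsto_0[where W = "\<lambda>n \<omega>. gauge (\<lambda>i. X i \<omega>) n" and
          K = "\<Sum>t\<in>Basis. \<Sum>k\<le>3. 1 + (\<integral>x. ((e \<bullet> (x - m)) ^ k * (dual t \<bullet> (x - m)))\<^sup>2 \<partial>L)"])
      show "prob_space M" by (rule S.prob_space_axioms)
      show "integrable M (\<lambda>\<omega>. gauge (\<lambda>i. X i \<omega>) n)" for n
        unfolding gauge_def by (intro Bochner_Integration.integrable_sum sg)
      show "0 \<le> gauge (\<lambda>i. X i \<omega>) n" for n \<omega>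
        unfolding gauge_def by (intro sum_nonneg) simp
      have "(\<integral>\<omega>. gauge (\<lambda>i. X i \<omega>) n \<partial>M) = (\<Sum>t\<in>Basis. \<Sum>k\<le>3. (\<integral>\<omega>. \<bar>(1 / sqrt (real n)) * (\<Sum>i<n. (e \<bullet> (X i \<omega> - m)) ^ k * (dual t \<bullet> (X i \<omega> - m)))\<bar> \<partial>M))" for n
        unfolding gauge_def
        by (subst Bochner_Integration.integral_sum, intro Bochner_Integration.integrable_sum sg)
          (intro sum.cong refl Bochner_Integration.integral_sum sg)
      then show "(\<integral>\<omega>. gauge (\<lambda>i. X i \<omega>) n \<partial>M) \<le> (\<Sum>t\<in>Basis. \<Sum>k\<le>3. 1 + (\<integral>x. ((e \<bullet> (x - m)) ^ k * (dual t \<bullet> (x - m)))\<^sup>2 \<partial>L))" for n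
        by (simp only:) (intro sum_mono sg)
    qed (use gen in auto)
  qed auto
qed

end

theorem theorem2:
  fixes M :: "'a measure"
    and X :: "nat \<Rightarrow> 'a \<Rightarrow> real^'p"
    and u :: "nat \<Rightarrow> 'a \<Rightarrow> real^'p"
    and \<mu>\<^sub>1 \<mu>\<^sub>2 \<theta> :: "real^'p"
    and \<Sigma> \<Psi> :: "real^'p^'p"
    and \<alpha>\<^sub>1 \<alpha>\<^sub>2 \<beta> \<tau> C :: real
  assumes "prob_space M"
    and "0 < \<alpha>\<^sub>1" and "\<alpha>\<^sub>1 < 1" and "\<alpha>\<^sub>2 = 1 - \<alpha>\<^sub>1"
    and "\<mu>\<^sub>1 \<noteq> \<mu>\<^sub>2"
    and "covariance_matrix \<Sigma>" and "rank \<Sigma> = CARD('p)"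
    and "prob_space.indep_vars M (\<lambda>_. borel) X UNIV"
    and "\<And>i. distr M borel (X i) = mixture \<alpha>\<^sub>1 (mvnormal \<mu>\<^sub>1 \<Sigma>) (mvnormal \<mu>\<^sub>2 \<Sigma>)"
    and "\<alpha>\<^sub>1 \<notin> {1/2 - 1 / sqrt 12, 1/2 + 1 / sqrt 12}"
    and "\<And>n. u n \<in> borel_measurable M"
    and "\<And>n \<omega>. \<omega> \<in> space M \<Longrightarrow> u n \<omega> \<in> sphere 0 1"
    and "\<forall>\<^sub>F n in sequentially. AE \<omega> in M.
           is_arg_max (\<lambda>v. (sample_kurtosis (\<lambda>i. X i \<omega>) n v - 3)\<^sup>2) (\<lambda>v. v \<in> sphere 0 1) (u n \<omega>)"
    and "\<theta> = matrix_inv \<Sigma> *v (\<mu>\<^sub>2 - \<mu>\<^sub>1)"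
    and "\<beta> = \<alpha>\<^sub>1 * \<alpha>\<^sub>2"
    and "\<tau> = (\<mu>\<^sub>2 - \<mu>\<^sub>1) \<bullet> (matrix_inv \<Sigma> *v (\<mu>\<^sub>2 - \<mu>\<^sub>1))"
    and "C = (6 + 24 * \<beta> * \<tau> + 9 * \<beta> * (1 - 2 * \<beta>) * \<tau>^2 + \<beta> * (1 - 3 * \<beta>) * \<tau>^3) /
             (\<beta> * \<tau>^3 * (1 - 6 * \<beta>)^2)"
    and "\<Psi> = (C * ((1 + \<beta> * \<tau>) / ((norm \<theta>)^2 * \<beta>))) *\<^sub>R
             ((mat 1 - (1 / (norm \<theta>)^2) *\<^sub>R outer_prod \<theta> \<theta>) ** matrix_inv \<Sigma> **
              (mat 1 - (1 / (norm \<theta>)^2) *\<^sub>R outer_prod \<theta> \<theta>))"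
  shows "\<exists>s :: nat \<Rightarrow> 'a \<Rightarrow> real.
           (\<forall>n. s n \<in> borel_measurable M) \<and>
           (\<forall>n. \<forall>\<omega> \<in> space M. s n \<omega> \<in> {-1, 1}) \<and>
           (AE \<omega> in M. (\<lambda>n. s n \<omega> *\<^sub>R u n \<omega>) \<longlonglongrightarrow> (1 / norm \<theta>) *\<^sub>R \<theta>) \<and>
           converges_in_distribution M
             (\<lambda>n \<omega>. sqrt (real n) *\<^sub>R (s n \<omega> *\<^sub>R u n \<omega> - (1 / norm \<theta>) *\<^sub>R \<theta>))
             (mvnormal 0 \<Psi>)"
proof -
  interpret N: normal_mixture \<mu>\<^sub>1 \<mu>\<^sub>2 \<Sigma> \<alpha>\<^sub>1
    by (rule normal_mixture.intro) (rule assms)+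
  have \<theta>: "\<theta> = N.\<theta>" and \<beta>: "\<beta> = N.\<beta>" and \<tau>: "\<tau> = N.\<tau>"
    using assms by (simp_all add: N.\<theta>_def N.\<delta>_def N.\<beta>_def N.\<tau>_def)
  have e: "(1 / norm \<theta>) *\<^sub>R \<theta> = N.e" by (simp add: N.e_def \<theta>)
  have \<Psi>: "\<Psi> = N.\<Psi>" using assms by (simp only: N.\<Psi>_def \<theta> \<beta> \<tau>)
  have iid: "iid_sample M X N.L"
    using assms(1,8,9) N.moments_L by (simp add: iid_sample_def iid_sample_axioms_def N.L_def)
  \<comment> \<open>Completing the square in 1 = 6 \<alpha> (1 - \<alpha>) gives (\<alpha> - 1/2)^2
    = 1/12, the two excluded weights.\<close>
  have b: "1 - 6 * N.\<beta> \<noteq> 0"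
  proof
    assume "1 - 6 * N.\<beta> = 0"
    then have "(\<alpha>\<^sub>1 - 1 / 2)\<^sup>2 = (1 / sqrt 12)\<^sup>2"
      by (simp add: N.\<beta>_def power2_eq_square algebra_simps)
    then have "\<alpha>\<^sub>1 - 1 / 2 = 1 / sqrt 12 \<or> \<alpha>\<^sub>1 - 1 / 2 = - (1 / sqrt 12)"
      unfolding power2_eq_iff .
    then have "\<alpha>\<^sub>1 = 1 / 2 + 1 / sqrt 12 \<or> \<alpha>\<^sub>1 = 1 / 2 - 1 / sqrt 12" by linarith
    then show False using assms(10) by blast
  qed
  have max: "\<forall>\<^sub>F n in sequentially. AE \<omega> in M. \<forall>v. norm v = 1 \<longrightarrow>
      (sample_kurtosis (\<lambda>i. X i \<omega>) n v - 3)\<^sup>2 \<le> (sample_kurtosis (\<lambda>i. X i \<omega>) n (u n \<omega>) - 3)\<^sup>2"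
    using assms(13)
  proof eventually_elim
    case (elim n)
    then show ?case by eventually_elim (auto simp: is_arg_max_def not_less)
  qed
  have unit: "norm (u n \<omega>) = 1" if "\<omega> \<in> space M" for n \<omega>
    using assms(12)[OF that, of n] by simp
  show ?thesis
    unfolding e \<Psi>
  \<comment> \<open>The sign puts \<open>u n \<omega>\<close> in the closed half-space of the limit
    direction, with 1 in case of a tie; as a function of \<open>u n\<close> it is
    measurable.\<close>
  proof (intro exI[of _ "\<lambda>n \<omega>. if 0 \<le> u n \<omega> \<bullet> N.e then 1 else - 1"] conjI allI ballI)
    show "(\<lambda>\<omega>. if 0 \<le> u n \<omega> \<bullet> N.e then 1 else - 1 :: real) \<in> borel_measurable M" for n
      using assms(11)[of n] by measurable
    show "(if 0 \<le> u n \<omega> \<bullet> N.e then 1 else - 1 :: real) \<in> {-1, 1}" for n \<omega> by simp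
    show "AE \<omega> in M. (\<lambda>n. (if 0 \<le> u n \<omega> \<bullet> N.e then 1 else - 1) *\<^sub>R u n \<omega>) \<longlonglongrightarrow> N.e"
      by (rule N.asymptotic_normality(1)[OF iid b assms(11) unit max])
    show "converges_in_distribution M
        (\<lambda>n \<omega>. sqrt (real n) *\<^sub>R ((if 0 \<le> u n \<omega> \<bullet> N.e then 1 else - 1) *\<^sub>R u n \<omega> - N.e)) (mvnormal 0 N.\<Psi>)"
      by (rule N.asymptotic_normality(2)[OF iid b assms(11) unit max])
  qed
qed

end
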